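(* Let $X$ be a locally finite, regular right-angled building, let $G$ be a closed, cocompact group of type-preserving automorphisms of $X$, and let $\Gamma$ be a non-cocompact lattice in $G$. If $\Gamma$ has a strict fundamental domain, then $\Gamma$ is not finitely generated.
   Context: Right-angled buildings. Let $(W,S)$ be a right-angled Coxeter system with $S$ finite: $W=\langle S\mid (st)^{m_{st}}=1\rangle$ with $m_{ss}=1$ for all $s\in S$ and $m_{st}\in\{2,\infty\}$ for $s\neq t$. Fix integers $q_s\geq 2$ and groups $H_s$ with $|H_s|=q_s$ ($s\in S$), and let $H$ be the quotient of the free product of the $H_s$ by the normal subgroup generated by all commutators $[h_s,h_t]$ with $h_s\in H_s$, $h_t\in H_t$, $m_{st}=2$. Let $X$ be the piecewise Euclidean CAT(0) (Davis) geometric realization of the chamber system $\Phi(H,\{1\},(H_s)_{s\in S})$ (chambers are the elements of $H$; two distinct chambers $h,h'$ are $s$-adjacent if $hH_s=h'H_s$). A locally finite, regular right-angled building is such an $X$. $G$ carries the compact-open topology, and is cocompact if $G\backslash X$ is compact. A lattice $\Gamma$ in $G$ is a discrete subgroup such that the series $\sum|\mathrm{Stab}_\Gamma(\phi)|^{-1}$ converges, where the sum is over the chambers $\phi$ of a fundamental domain for $\Gamma$ (one chamber from each $\Gamma$-orbit). $\Gamma$ is cocompact in $G$ if and only if $\Gamma\backslash X$ is compact. A strict fundamental domain for $\Gamma$ is a subcomplex $Y\subset X$ containing exactly one point from each $\Gamma$-orbit on $X$. *)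

theory Defs
  imports "HOL-Analysis.Analysis" "HOL-Algebra.Group_Action" "HOL-Algebra.Generated_Groups"
begin

section \<open>Groups given by generators and relations\<close>

inductive_set word_cong :: "'a set \<Rightarrow> ('a list \<times> 'a list) set \<Rightarrow> ('a list \<times> 'a list) set"
  for A R where
  refl: "w \<in> lists A \<Longrightarrow> (w, w) \<in> word_cong A R"
| sym: "(v, w) \<in> word_cong A R \<Longrightarrow> (w, v) \<in> word_cong A R"
| trans: "(u, v) \<in> word_cong A R \<Longrightarrow> (v, w) \<in> word_cong A R \<Longrightarrow> (u, w) \<in> word_cong A R"
| rel: "(u, v) \<in> R \<Longrightarrow> u \<in> lists A \<Longrightarrow> v \<in> lists A \<Longrightarrow> x \<in> lists A \<Longrightarrow> y \<in> lists A
    \<Longrightarrow> (x @ u @ y, x @ v @ y) \<in> word_cong A R"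

text \<open>The monoid presented by the generators \<open>A\<close> and the relations \<open>u = v\<close>, for \<open>(u, v) \<in> R\<close>.
  In both uses below the relations make every generator invertible, so that
  this is also the group with the same presentation.\<close>

definition presented :: "'a set \<Rightarrow> ('a list \<times> 'a list) set \<Rightarrow> 'a list set monoid" where
  "presented A R =
    \<lparr>carrier = lists A // word_cong A R,
     mult = \<lambda>X Y. {w. \<exists>x\<in>X. \<exists>y\<in>Y. (x @ y, w) \<in> word_cong A R},
     one = word_cong A R `` {[]}\<rparr>"

definition normal_closure :: "('a, 'b) monoid_scheme \<Rightarrow> 'a set \<Rightarrow> 'a set" where
  "normal_closure G A = \<Inter>{N. N \<lhd> G \<and> A \<subseteq> N}"


section \<open>Right-angled Coxeter systems\<close>

definition right_angled :: "'s set \<Rightarrow> ('s \<Rightarrow> 's \<Rightarrow> enat) \<Rightarrow> bool" where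
  "right_angled S m \<longleftrightarrow> finite S \<and> (\<forall>s\<in>S. m s s = 1) \<and>
    (\<forall>s\<in>S. \<forall>t\<in>S. m s t = m t s \<and> (s \<noteq> t \<longrightarrow> m s t \<in> {2, \<infinity>}))"

definition coxeter_relations :: "'s set \<Rightarrow> ('s \<Rightarrow> 's \<Rightarrow> enat) \<Rightarrow> ('s list \<times> 's list) set" where
  "coxeter_relations S m =
    {(concat (replicate n [s, t]), []) | s t n. s \<in> S \<and> t \<in> S \<and> m s t = enat n}"

definition coxeter_group :: "'s set \<Rightarrow> ('s \<Rightarrow> 's \<Rightarrow> enat) \<Rightarrow> 's list set monoid" where
  "coxeter_group S m = presented S (coxeter_relations S m)"

definition spherical :: "'s set \<Rightarrow> ('s \<Rightarrow> 's \<Rightarrow> enat) \<Rightarrow> 's set \<Rightarrow> bool" where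
  "spherical S m T \<longleftrightarrow> T \<subseteq> S \<and>
    finite (generate (coxeter_group S m) ((\<lambda>s. word_cong S (coxeter_relations S m) `` {[s]}) ` T))"


section \<open>Graph products and their chamber systems\<close>

definition free_product_letters :: "'s set \<Rightarrow> ('s \<Rightarrow> 'a monoid) \<Rightarrow> ('s \<times> 'a) set" where
  "free_product_letters S Hs = (SIGMA s:S. carrier (Hs s))"

definition free_product_relations ::
    "'s set \<Rightarrow> ('s \<Rightarrow> 'a monoid) \<Rightarrow> (('s \<times> 'a) list \<times> ('s \<times> 'a) list) set" where
  "free_product_relations S Hs =
    {([(s, \<one>\<^bsub>Hs s\<^esub>)], []) | s. s \<in> S} \<union>
    {([(s, a), (s, b)], [(s, a \<otimes>\<^bsub>Hs s\<^esub> b)]) | s a b.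
      s \<in> S \<and> a \<in> carrier (Hs s) \<and> b \<in> carrier (Hs s)}"

definition free_product :: "'s set \<Rightarrow> ('s \<Rightarrow> 'a monoid) \<Rightarrow> ('s \<times> 'a) list set monoid" where
  "free_product S Hs = presented (free_product_letters S Hs) (free_product_relations S Hs)"

definition free_product_inj ::
    "'s set \<Rightarrow> ('s \<Rightarrow> 'a monoid) \<Rightarrow> 's \<Rightarrow> 'a \<Rightarrow> ('s \<times> 'a) list set" where
  "free_product_inj S Hs s a =
    word_cong (free_product_letters S Hs) (free_product_relations S Hs) `` {[(s, a)]}"

definition graph_product_kernel ::
    "'s set \<Rightarrow> ('s \<Rightarrow> 's \<Rightarrow> enat) \<Rightarrow> ('s \<Rightarrow> 'a monoid) \<Rightarrow> ('s \<times> 'a) list set set" where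
  "graph_product_kernel S m Hs = (let F = free_product S Hs; \<iota> = free_product_inj S Hs in
    normal_closure F
      {\<iota> s a \<otimes>\<^bsub>F\<^esub> \<iota> t b \<otimes>\<^bsub>F\<^esub> inv\<^bsub>F\<^esub> (\<iota> s a) \<otimes>\<^bsub>F\<^esub> inv\<^bsub>F\<^esub> (\<iota> t b) | s t a b.
        s \<in> S \<and> t \<in> S \<and> m s t = 2 \<and> a \<in> carrier (Hs s) \<and> b \<in> carrier (Hs t)})"

definition graph_product ::
    "'s set \<Rightarrow> ('s \<Rightarrow> 's \<Rightarrow> enat) \<Rightarrow> ('s \<Rightarrow> 'a monoid) \<Rightarrow> ('s \<times> 'a) list set set monoid" where
  "graph_product S m Hs = free_product S Hs Mod graph_product_kernel S m Hs"

definition vertex_subgroup ::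
    "'s set \<Rightarrow> ('s \<Rightarrow> 's \<Rightarrow> enat) \<Rightarrow> ('s \<Rightarrow> 'a monoid) \<Rightarrow> 's \<Rightarrow> ('s \<times> 'a) list set set set" where
  "vertex_subgroup S m Hs s =
    (\<lambda>a. graph_product_kernel S m Hs #>\<^bsub>free_product S Hs\<^esub> free_product_inj S Hs s a)
      ` carrier (Hs s)"

record ('c, 's) chamber_system =
  chambers :: "'c set"
  adjacent :: "'s \<Rightarrow> ('c \<times> 'c) set"

text \<open>The chamber system \<open>\<Phi>(H, {1}, (H\<^sub>s))\<close>.\<close>

definition graph_product_chambers ::
    "'s set \<Rightarrow> ('s \<Rightarrow> 's \<Rightarrow> enat) \<Rightarrow> ('s \<Rightarrow> 'a monoid)
      \<Rightarrow> (('s \<times> 'a) list set set, 's) chamber_system" where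
  "graph_product_chambers S m Hs = (let H = graph_product S m Hs in
    \<lparr>chambers = carrier H,
     adjacent = \<lambda>s. {(h, h'). h \<in> carrier H \<and> h' \<in> carrier H \<and> h \<noteq> h' \<and>
       h <#\<^bsub>H\<^esub> vertex_subgroup S m Hs s = h' <#\<^bsub>H\<^esub> vertex_subgroup S m Hs s}\<rparr>)"

definition residue_rel :: "('c, 's) chamber_system \<Rightarrow> 's set \<Rightarrow> ('c \<times> 'c) set" where
  "residue_rel \<Phi> T = (\<Union>s\<in>T. adjacent \<Phi> s)\<^sup>* \<inter> chambers \<Phi> \<times> chambers \<Phi>"


section \<open>The Davis realization\<close>

text \<open>The model chamber \<open>K\<close> is the geometric realization of the poset of spherical subsets of \<open>S\<close>.
  The vertex \<open>T\<close> is placed at the indicator vector of \<open>T\<close> in the space of functions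
  from \<open>S\<close> to the reals. For right-angled \<open>m\<close> this gives the piecewise Euclidean structure
  of the Davis complex: the simplices on chains between \<open>U\<close> and \<open>T\<close> triangulate
  a Euclidean unit cube of dimension \<open>|T - U|\<close>.\<close>

definition spherical_chains :: "'s set \<Rightarrow> ('s \<Rightarrow> 's \<Rightarrow> enat) \<Rightarrow> 's set set set" where
  "spherical_chains S m = {C. C \<noteq> {} \<and> (\<forall>T\<in>C. spherical S m T) \<and> chain\<^sub>\<subseteq> C}"

definition chain_simplex :: "'s set set \<Rightarrow> ('s \<Rightarrow> real) set" where
  "chain_simplex C =
    {(\<lambda>s. \<Sum>T\<in>C. l T * indicat_real T s) | l. (\<forall>T\<in>C. 0 \<le> l T) \<and> sum l C = 1}"

definition model_chamber :: "'s set \<Rightarrow> ('s \<Rightarrow> 's \<Rightarrow> enat) \<Rightarrow> ('s \<Rightarrow> real) set" where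
  "model_chamber S m = (\<Union>C\<in>spherical_chains S m. chain_simplex C)"

text \<open>The \<open>s\<close>-mirror of \<open>K\<close> is the closed star of the vertex \<open>{s}\<close> in the barycentric subdivision of
  the nerve, i.e. in the realization of the poset of nonempty spherical subsets.\<close>

definition mirror :: "'s set \<Rightarrow> ('s \<Rightarrow> 's \<Rightarrow> enat) \<Rightarrow> 's \<Rightarrow> ('s \<Rightarrow> real) set" where
  "mirror S m s = (\<Union>C\<in>{C \<in> spherical_chains S m. {s} \<in> C \<and> {} \<notin> C}. chain_simplex C)"

definition mirror_types :: "'s set \<Rightarrow> ('s \<Rightarrow> 's \<Rightarrow> enat) \<Rightarrow> ('s \<Rightarrow> real) \<Rightarrow> 's set" where
  "mirror_types S m x = {s \<in> S. x \<in> mirror S m s}"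

definition davis_rel ::
    "'s set \<Rightarrow> ('s \<Rightarrow> 's \<Rightarrow> enat) \<Rightarrow> ('c, 's) chamber_system
      \<Rightarrow> (('c \<times> ('s \<Rightarrow> real)) \<times> ('c \<times> ('s \<Rightarrow> real))) set" where
  "davis_rel S m \<Phi> =
    {((h, x), (h', x)) | h h' x.
      x \<in> model_chamber S m \<and> (h, h') \<in> residue_rel \<Phi> (mirror_types S m x)}"

definition davis ::
    "'s set \<Rightarrow> ('s \<Rightarrow> 's \<Rightarrow> enat) \<Rightarrow> ('c, 's) chamber_system
      \<Rightarrow> ('c \<times> ('s \<Rightarrow> real)) set set" where
  "davis S m \<Phi> = (chambers \<Phi> \<times> model_chamber S m) // davis_rel S m \<Phi>"

definition davis_point ::
    "'s set \<Rightarrow> ('s \<Rightarrow> 's \<Rightarrow> enat) \<Rightarrow> ('c, 's) chamber_system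
      \<Rightarrow> 'c \<Rightarrow> ('s \<Rightarrow> real) \<Rightarrow> ('c \<times> ('s \<Rightarrow> real)) set" where
  "davis_point S m \<Phi> h x = davis_rel S m \<Phi> `` {(h, x)}"

definition davis_simplices ::
    "'s set \<Rightarrow> ('s \<Rightarrow> 's \<Rightarrow> enat) \<Rightarrow> ('c, 's) chamber_system
      \<Rightarrow> ('c \<times> ('s \<Rightarrow> real)) set set set" where
  "davis_simplices S m \<Phi> =
    {davis_point S m \<Phi> h ` chain_simplex C | h C. h \<in> chambers \<Phi> \<and> C \<in> spherical_chains S m}"

definition subcomplex ::
    "'s set \<Rightarrow> ('s \<Rightarrow> 's \<Rightarrow> enat) \<Rightarrow> ('c, 's) chamber_system
      \<Rightarrow> ('c \<times> ('s \<Rightarrow> real)) set set \<Rightarrow> bool" where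
  "subcomplex S m \<Phi> Y \<longleftrightarrow> (\<exists>\<A>\<subseteq>davis_simplices S m \<Phi>. Y = \<Union>\<A>)"

definition davis_chambers ::
    "'s set \<Rightarrow> ('s \<Rightarrow> 's \<Rightarrow> enat) \<Rightarrow> ('c, 's) chamber_system
      \<Rightarrow> ('c \<times> ('s \<Rightarrow> real)) set set set" where
  "davis_chambers S m \<Phi> = {davis_point S m \<Phi> h ` model_chamber S m | h. h \<in> chambers \<Phi>}"

text \<open>The piecewise Euclidean length metric: \<open>davis_string S m \<Phi> p q r\<close> says that \<open>p\<close> and \<open>q\<close> are
  joined by a string of points of total length \<open>r\<close> such that any two consecutive points lie
  in a common closed simplex, where their distance is the Euclidean one.\<close>

inductive davis_string ::
    "'s set \<Rightarrow> ('s \<Rightarrow> 's \<Rightarrow> enat) \<Rightarrow> ('c, 's) chamber_system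
      \<Rightarrow> ('c \<times> ('s \<Rightarrow> real)) set \<Rightarrow> ('c \<times> ('s \<Rightarrow> real)) set \<Rightarrow> real \<Rightarrow> bool"
  for S m \<Phi> where
  start: "p \<in> davis S m \<Phi> \<Longrightarrow> davis_string S m \<Phi> p p 0"
| step: "davis_string S m \<Phi> p (davis_point S m \<Phi> h x) r \<Longrightarrow> h \<in> chambers \<Phi> \<Longrightarrow>
    C \<in> spherical_chains S m \<Longrightarrow> x \<in> chain_simplex C \<Longrightarrow> y \<in> chain_simplex C \<Longrightarrow>
    davis_string S m \<Phi> p (davis_point S m \<Phi> h y) (r + L2_set (\<lambda>s. x s - y s) S)"

definition davis_dist ::
    "'s set \<Rightarrow> ('s \<Rightarrow> 's \<Rightarrow> enat) \<Rightarrow> ('c, 's) chamber_system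
      \<Rightarrow> ('c \<times> ('s \<Rightarrow> real)) set \<Rightarrow> ('c \<times> ('s \<Rightarrow> real)) set \<Rightarrow> real" where
  "davis_dist S m \<Phi> p q =
    (if p \<in> davis S m \<Phi> \<and> q \<in> davis S m \<Phi> then Inf {r. davis_string S m \<Phi> p q r} else 0)"

definition davis_topology ::
    "'s set \<Rightarrow> ('s \<Rightarrow> 's \<Rightarrow> enat) \<Rightarrow> ('c, 's) chamber_system
      \<Rightarrow> ('c \<times> ('s \<Rightarrow> real)) set topology" where
  "davis_topology S m \<Phi> = Metric_space.mtopology (davis S m \<Phi>) (davis_dist S m \<Phi>)"


section \<open>Type-preserving automorphisms\<close>

text \<open>A vertex of \<open>X\<close> is a point \<open>davis_point S m \<Phi> h (indicat_real T)\<close> with \<open>T\<close> spherical, and \<open>T\<close> is its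
  type. A map that takes simplices affinely to simplices and preserves
  the types of vertices therefore preserves the coordinates \<open>x\<close> on each simplex.\<close>

definition type_preserving_simplicial ::
    "'s set \<Rightarrow> ('s \<Rightarrow> 's \<Rightarrow> enat) \<Rightarrow> ('c, 's) chamber_system
      \<Rightarrow> (('c \<times> ('s \<Rightarrow> real)) set \<Rightarrow> ('c \<times> ('s \<Rightarrow> real)) set) \<Rightarrow> bool" where
  "type_preserving_simplicial S m \<Phi> f \<longleftrightarrow>
    (\<forall>h\<in>chambers \<Phi>. \<forall>C\<in>spherical_chains S m. \<exists>h'\<in>chambers \<Phi>.
      \<forall>x\<in>chain_simplex C. f (davis_point S m \<Phi> h x) = davis_point S m \<Phi> h' x)"

definition type_preserving_auts ::
    "'s set \<Rightarrow> ('s \<Rightarrow> 's \<Rightarrow> enat) \<Rightarrow> ('c, 's) chamber_system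
      \<Rightarrow> (('c \<times> ('s \<Rightarrow> real)) set \<Rightarrow> ('c \<times> ('s \<Rightarrow> real)) set) set" where
  "type_preserving_auts S m \<Phi> =
    {f \<in> Bij (davis S m \<Phi>). type_preserving_simplicial S m \<Phi> f \<and>
      type_preserving_simplicial S m \<Phi> (inv_into (davis S m \<Phi>) f)}"

definition aut_group ::
    "'s set \<Rightarrow> ('s \<Rightarrow> 's \<Rightarrow> enat) \<Rightarrow> ('c, 's) chamber_system
      \<Rightarrow> (('c \<times> ('s \<Rightarrow> real)) set \<Rightarrow> ('c \<times> ('s \<Rightarrow> real)) set) monoid" where
  "aut_group S m \<Phi> = (BijGroup (davis S m \<Phi>))\<lparr>carrier := type_preserving_auts S m \<Phi>\<rparr>"

definition compact_open_topology :: "'p topology \<Rightarrow> ('p \<Rightarrow> 'p) set \<Rightarrow> ('p \<Rightarrow> 'p) topology" where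
  "compact_open_topology X F =
    topology_generated_by {{f \<in> F. f ` C \<subseteq> U} | C U. compactin X C \<and> openin X U}"

definition aut_topology ::
    "'s set \<Rightarrow> ('s \<Rightarrow> 's \<Rightarrow> enat) \<Rightarrow> ('c, 's) chamber_system
      \<Rightarrow> (('c \<times> ('s \<Rightarrow> real)) set \<Rightarrow> ('c \<times> ('s \<Rightarrow> real)) set) topology" where
  "aut_topology S m \<Phi> =
    compact_open_topology (davis_topology S m \<Phi>) (type_preserving_auts S m \<Phi>)"


section \<open>Cocompactness, lattices and strict fundamental domains\<close>

definition orbit_space ::
    "'p topology \<Rightarrow> ('g, 'b) monoid_scheme \<Rightarrow> ('g \<Rightarrow> 'p \<Rightarrow> 'p) \<Rightarrow> 'p set topology" where
  "orbit_space X G \<phi> =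
    topology (\<lambda>U. U \<subseteq> orbits G (topspace X) \<phi> \<and> openin X {x \<in> topspace X. orbit G \<phi> x \<in> U})"

lemma openin_orbit_space:
  "openin (orbit_space X G \<phi>) U \<longleftrightarrow>
    U \<subseteq> orbits G (topspace X) \<phi> \<and> openin X {x \<in> topspace X. orbit G \<phi> x \<in> U}"
proof -
  let ?L = "\<lambda>U. U \<subseteq> orbits G (topspace X) \<phi> \<and> openin X {x \<in> topspace X. orbit G \<phi> x \<in> U}"
  have "istopology ?L"
    unfolding istopology_def
  proof (intro conjI allI impI)
    fix U V assume "?L U" "?L V"
    then have "openin X ({x \<in> topspace X. orbit G \<phi> x \<in> U} \<inter> {x \<in> topspace X. orbit G \<phi> x \<in> V})"
      by blast
    moreover have "{x \<in> topspace X. orbit G \<phi> x \<in> U} \<inter> {x \<in> topspace X. orbit G \<phi> x \<in> V}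
        = {x \<in> topspace X. orbit G \<phi> x \<in> U \<inter> V}"
      by blast
    ultimately show "U \<inter> V \<subseteq> orbits G (topspace X) \<phi>"
        "openin X {x \<in> topspace X. orbit G \<phi> x \<in> U \<inter> V}"
      using \<open>?L U\<close> by auto
  next
    fix \<K> assume K: "\<forall>U\<in>\<K>. ?L U"
    show "\<Union>\<K> \<subseteq> orbits G (topspace X) \<phi>"
      using K by blast
    have "{x \<in> topspace X. orbit G \<phi> x \<in> \<Union>\<K>} = (\<Union>U\<in>\<K>. {x \<in> topspace X. orbit G \<phi> x \<in> U})"
      by blast
    then show "openin X {x \<in> topspace X. orbit G \<phi> x \<in> \<Union>\<K>}"
      using K by auto
  qed
  then show ?thesis
    unfolding orbit_space_def by (simp add: topology_inverse')
qed

definition cocompact ::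
    "'s set \<Rightarrow> ('s \<Rightarrow> 's \<Rightarrow> enat) \<Rightarrow> ('c, 's) chamber_system
      \<Rightarrow> (('c \<times> ('s \<Rightarrow> real)) set \<Rightarrow> ('c \<times> ('s \<Rightarrow> real)) set) set \<Rightarrow> bool" where
  "cocompact S m \<Phi> G \<longleftrightarrow> compact_space
    (orbit_space (davis_topology S m \<Phi>) ((aut_group S m \<Phi>)\<lparr>carrier := G\<rparr>) (\<lambda>g p. g p))"

text \<open>Chamber stabilizers in a discrete subgroup are finite, so \<open>card\<close> is their order.\<close>

definition lattice_in ::
    "'s set \<Rightarrow> ('s \<Rightarrow> 's \<Rightarrow> enat) \<Rightarrow> ('c, 's) chamber_system
      \<Rightarrow> (('c \<times> ('s \<Rightarrow> real)) set \<Rightarrow> ('c \<times> ('s \<Rightarrow> real)) set) set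
      \<Rightarrow> (('c \<times> ('s \<Rightarrow> real)) set \<Rightarrow> ('c \<times> ('s \<Rightarrow> real)) set) set \<Rightarrow> bool" where
  "lattice_in S m \<Phi> G \<Gamma> \<longleftrightarrow>
    subgroup \<Gamma> (aut_group S m \<Phi>) \<and> \<Gamma> \<subseteq> G \<and>
    subtopology (aut_topology S m \<Phi>) \<Gamma> = discrete_topology \<Gamma> \<and>
    (let A = (aut_group S m \<Phi>)\<lparr>carrier := \<Gamma>\<rparr> in
      \<exists>D \<subseteq> davis_chambers S m \<Phi>.
        (\<forall>\<phi>\<in>davis_chambers S m \<Phi>. \<exists>!\<psi>. \<psi> \<in> D \<and> \<psi> \<in> orbit A (`) \<phi>) \<and>
        (\<lambda>\<phi>. 1 / real (card (stabilizer A (`) \<phi>))) summable_on D)"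

definition strict_fundamental_domain ::
    "'s set \<Rightarrow> ('s \<Rightarrow> 's \<Rightarrow> enat) \<Rightarrow> ('c, 's) chamber_system
      \<Rightarrow> (('c \<times> ('s \<Rightarrow> real)) set \<Rightarrow> ('c \<times> ('s \<Rightarrow> real)) set) set
      \<Rightarrow> ('c \<times> ('s \<Rightarrow> real)) set set \<Rightarrow> bool" where
  "strict_fundamental_domain S m \<Phi> \<Gamma> Y \<longleftrightarrow> subcomplex S m \<Phi> Y \<and>
    (\<forall>p\<in>davis S m \<Phi>. \<exists>!y. y \<in> Y \<and>
      y \<in> orbit ((aut_group S m \<Phi>)\<lparr>carrier := \<Gamma>\<rparr>) (\<lambda>g p. g p) p)"

definition finitely_generated :: "('g, 'b) monoid_scheme \<Rightarrow> 'g set \<Rightarrow> bool" where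
  "finitely_generated G \<Gamma> \<longleftrightarrow> (\<exists>A. finite A \<and> A \<subseteq> \<Gamma> \<and> generate G A = \<Gamma>)"

end

theory Submission
  imports Defs
begin

text \<open>Why the theorem holds. A chamber is an element of the graph product \<open>H\<close>, and crossing an \<open>s\<close>-panel is
  right multiplication by an element of the vertex group of type \<open>s\<close>. For a type \<open>s\<close>, the cosets of the subgroup
  generated by the vertex groups of type \<open>s\<close> and of the types commuting with \<open>s\<close> are called walls. A wall
  separates: once the \<open>s\<close>-panels inside it may no longer be crossed, the chambers of each such
  panel lie in different components, the sides of the wall. The sides come from a function
  on \<open>H\<close> that is obtained from the universal property (\<open>side_function\<close>). A minimal gallery crosses a wall
  at most once (\<open>minimal_gallery_walls_distinct\<close>).

  A strict fundamental domain amounts to a set \<open>D\<close> of chambers, one from each orbit of \<open>\<Gamma>\<close>, such that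
  replacing chambers by their representatives in \<open>D\<close> takes adjacent chambers to adjacent or equal ones (\<open>strict_domain_vertices\<close>,
  \<open>morphism_rep\<close>). Hence chambers of \<open>D\<close> are joined by minimal galleries in \<open>D\<close>, and if a wall
  meets \<open>D\<close>, then the representatives of its chambers lie on it.

  If \<open>\<Gamma>\<close> is finitely generated, then the translates of some finite part \<open>F\<close> of \<open>D\<close> form a set \<open>U\<close> that is
  connected by galleries (\<open>finitely_generated_imp_linked\<close>). A wall that meets \<open>D\<close> but not \<open>F\<close> does not meet
  \<open>U\<close> at all, so \<open>U\<close> is on one side of it. Let \<open>g\<close> in \<open>\<Gamma>\<close> fix a chamber of \<open>D\<close> on this wall. Then \<open>g\<close> preserves the wall
  and \<open>U\<close>, so it also fixes the chamber of the same panel on the side of \<open>U\<close> (\<open>stab_step_subset\<close>). Along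
  a minimal gallery in \<open>D\<close> that starts in \<open>F\<close> the stabilizers can therefore grow only where a wall meeting \<open>F\<close> is
  crossed. There are finitely many such walls, each is crossed at most once, and each crossing multiplies
  the order by at most the order of a vertex group. So the orders of the chamber stabilizers
  are bounded (\<open>stabilizers_bounded\<close>).

  Now the sum of their reciprocals over the orbits of chambers can converge only if there are finitely
  many orbits, and then \<open>\<Gamma>\<close> is cocompact, because chambers are compact. Apart from that, the topology of \<open>X\<close>
  is used to see that discreteness makes the stabilizers finite. For this, \<open>X\<close> has to be
  locally finite in its length metric. In coordinates, the mirror of type \<open>s\<close> is where the
  coordinate \<open>s\<close> equals \<open>1\<close>, and coordinates are 1-Lipschitz, so a short path crosses only mirrors
  through its starting point (\<open>short_string\<close>).\<close>

section \<open>Groups given by generators and relations\<close>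

declare in_lists_conv_set [simp] ball_Un [simp]

lemma word_cong_lists:
  "(u, v) \<in> word_cong A R \<Longrightarrow> u \<in> lists A \<and> v \<in> lists A"
  by (induction rule: word_cong.induct) auto

lemma equiv_word_cong: "equiv (lists A) (word_cong A R)"
proof (rule equivI)
  show "word_cong A R \<subseteq> lists A \<times> lists A"
    using word_cong_lists by fastforce
  show "refl_on (lists A) (word_cong A R)"
    by (rule refl_onI) (rule word_cong.refl)
  show "sym (word_cong A R)"
    by (rule symI) (rule word_cong.sym)
  show "trans (word_cong A R)"
    by (rule transI) (rule word_cong.trans)
qed

lemma word_cong_context:
  assumes "(u, v) \<in> word_cong A R" "x \<in> lists A" "y \<in> lists A"
  shows "(x @ u @ y, x @ v @ y) \<in> word_cong A R"
  using assms
proof (induction rule: word_cong.induct)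
  case (rel u v x' y')
  then show ?case
    using word_cong.rel[of u v R A "x @ x'" "y' @ y"] by simp
next
  case (refl w)
  then show ?case by (intro word_cong.refl) simp
qed (auto intro: word_cong.sym word_cong.trans)

lemma word_cong_append:
  assumes "(u, u') \<in> word_cong A R" "(v, v') \<in> word_cong A R"
  shows "(u @ v, u' @ v') \<in> word_cong A R"
proof -
  have "(u @ v, u' @ v) \<in> word_cong A R" "(u' @ v, u' @ v') \<in> word_cong A R"
    using word_cong_context[OF assms(1), of "[]" v] word_cong_context[OF assms(2), of u' "[]"]
      word_cong_lists[OF assms(1)] word_cong_lists[OF assms(2)] by auto
  then show ?thesis by (rule word_cong.trans)
qed

lemma word_class_eq_iff:
  "u \<in> lists A \<Longrightarrow> v \<in> lists A \<Longrightarrow>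
    word_cong A R `` {u} = word_cong A R `` {v} \<longleftrightarrow> (u, v) \<in> word_cong A R"
  using eq_equiv_class_iff[OF equiv_word_cong] .

lemma presented_simps:
  shows carrier_presented: "carrier (presented A R) = (\<lambda>u. word_cong A R `` {u}) ` lists A"
    and one_presented: "\<one>\<^bsub>presented A R\<^esub> = word_cong A R `` {[]}"
    and mult_presented: "u \<in> lists A \<Longrightarrow> v \<in> lists A \<Longrightarrow>
      (word_cong A R `` {u}) \<otimes>\<^bsub>presented A R\<^esub> (word_cong A R `` {v}) = word_cong A R `` {u @ v}"
proof -
  show "carrier (presented A R) = (\<lambda>u. word_cong A R `` {u}) ` lists A"
    unfolding presented_def by (auto simp: quotient_def)
  show "\<one>\<^bsub>presented A R\<^esub> = word_cong A R `` {[]}"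
    by (simp add: presented_def)
  show "(word_cong A R `` {u}) \<otimes>\<^bsub>presented A R\<^esub> (word_cong A R `` {v}) = word_cong A R `` {u @ v}"
    if uv: "u \<in> lists A" "v \<in> lists A"
    for u v
  proof (rule Set.set_eqI)
    fix w
    show "w \<in> (word_cong A R `` {u}) \<otimes>\<^bsub>presented A R\<^esub> (word_cong A R `` {v})
        \<longleftrightarrow> w \<in> word_cong A R `` {u @ v}"
      unfolding presented_def
      using uv word_cong_append[of u _ A R v] word_cong.refl[of u A R] word_cong.refl[of v A R]
      by (auto intro: word_cong.trans[OF word_cong_append])
  qed
qed

text \<open>Inverting the letters one by one inverts words, so it suffices to invert generators.\<close>

lemma group_presented:
  assumes "\<And>a. a \<in> A \<Longrightarrow> \<exists>w\<in>lists A. (w @ [a], []) \<in> word_cong A R"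
  shows "group (presented A R)"
proof -
  let ?c = "\<lambda>u. word_cong A R `` {u}"
  have inv: "\<exists>w\<in>lists A. (w @ u, []) \<in> word_cong A R" if "u \<in> lists A" for u
    using that
  proof (induction u)
    case Nil
    then show ?case by (auto intro!: bexI[of _ "[]"] word_cong.refl)
  next
    case (Cons a u)
    then obtain w where w: "w \<in> lists A" "(w @ u, []) \<in> word_cong A R" by auto
    obtain z where z: "z \<in> lists A" "(z @ [a], []) \<in> word_cong A R"
      using assms[of a] Cons by auto
    have "(w @ (z @ [a]) @ u, w @ [] @ u) \<in> word_cong A R"
      using word_cong_context[OF z(2)] w(1) Cons by auto
    then have "((w @ z) @ a # u, []) \<in> word_cong A R"
      using w(2) by (auto intro: word_cong.trans)
    then show ?case using w z by (intro bexI[of _ "w @ z"]) auto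
  qed
  show ?thesis
  proof (rule groupI)
    fix x assume "x \<in> carrier (presented A R)"
    then obtain u where u: "u \<in> lists A" "x = ?c u" by (auto simp: carrier_presented)
    then obtain w where "w \<in> lists A" "(w @ u, []) \<in> word_cong A R" using inv by blast
    then show "\<exists>y\<in>carrier (presented A R). y \<otimes>\<^bsub>presented A R\<^esub> x = \<one>\<^bsub>presented A R\<^esub>"
      using u by (intro bexI[of _ "?c w"])
        (auto simp: mult_presented one_presented word_class_eq_iff carrier_presented)
  qed (auto simp: carrier_presented mult_presented one_presented
      intro!: imageI)
qed

definition word_value :: "('g, 'b) monoid_scheme \<Rightarrow> ('a \<Rightarrow> 'g) \<Rightarrow> 'a list \<Rightarrow> 'g" where
  "word_value L \<phi> w = foldr (\<lambda>a x. \<phi> a \<otimes>\<^bsub>L\<^esub> x) w \<one>\<^bsub>L\<^esub>"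

lemma word_value_simps [simp]:
  "word_value L \<phi> [] = \<one>\<^bsub>L\<^esub>"
  "word_value L \<phi> (a # w) = \<phi> a \<otimes>\<^bsub>L\<^esub> word_value L \<phi> w"
  by (auto simp: word_value_def)

context monoid begin

lemma word_value_closed:
  "\<phi> \<in> A \<rightarrow> carrier G \<Longrightarrow> w \<in> lists A \<Longrightarrow> word_value G \<phi> w \<in> carrier G"
  by (induction w) auto

lemma word_value_append:
  "\<phi> \<in> A \<rightarrow> carrier G \<Longrightarrow> u \<in> lists A \<Longrightarrow> v \<in> lists A \<Longrightarrow>
    word_value G \<phi> (u @ v) = word_value G \<phi> u \<otimes> word_value G \<phi> v"
  by (induction u) (auto simp: word_value_closed m_assoc Pi_iff)

lemma word_value_cong:
  assumes \<phi>: "\<phi> \<in> A \<rightarrow> carrier G"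
    and R: "\<And>u v. (u, v) \<in> R \<Longrightarrow> u \<in> lists A \<Longrightarrow> v \<in> lists A \<Longrightarrow>
      word_value G \<phi> u = word_value G \<phi> v"
    and "(u, v) \<in> word_cong A R"
  shows "word_value G \<phi> u = word_value G \<phi> v"
  using assms(3)
proof (induction rule: word_cong.induct)
  case (rel u v x y)
  have "word_value G \<phi> u = word_value G \<phi> v" using R rel by blast
  then show ?case using rel(2-) by (simp only: word_value_append[OF \<phi>] append_in_lists_conv simp_thms)
qed auto

lemma presented_hom:
  assumes \<phi>: "\<phi> \<in> A \<rightarrow> carrier G"
    and R: "\<And>u v. (u, v) \<in> R \<Longrightarrow> u \<in> lists A \<Longrightarrow> v \<in> lists A \<Longrightarrow>
      word_value G \<phi> u = word_value G \<phi> v"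
  obtains \<Psi> where "\<Psi> \<in> hom (presented A R) G"
    and "\<And>u. u \<in> lists A \<Longrightarrow> \<Psi> (word_cong A R `` {u}) = word_value G \<phi> u"
proof -
  define \<Psi> where "\<Psi> X = word_value G \<phi> (SOME u. u \<in> X)" for X
  have eq: "\<Psi> (word_cong A R `` {u}) = word_value G \<phi> u" if "u \<in> lists A" for u
  proof -
    have "(u, SOME v. v \<in> word_cong A R `` {u}) \<in> word_cong A R"
      using someI[of "\<lambda>v. v \<in> word_cong A R `` {u}" u] word_cong.refl[OF that] by simp
    then show ?thesis
      unfolding \<Psi>_def using word_value_cong[OF \<phi> R, of R] by metis
  qed
  have "\<Psi> \<in> hom (presented A R) G"
  proof (rule homI)
    fix x y assume "x \<in> carrier (presented A R)" "y \<in> carrier (presented A R)"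
    then obtain u v where uv: "u \<in> lists A" "v \<in> lists A"
      "x = word_cong A R `` {u}" "y = word_cong A R `` {v}"
      by (auto simp: carrier_presented)
    then have "u @ v \<in> lists A" by simp
    then show "\<Psi> x \<in> carrier G" "\<Psi> (x \<otimes>\<^bsub>presented A R\<^esub> y) = \<Psi> x \<otimes> \<Psi> y"
      using uv by (simp_all only: eq mult_presented word_value_append[OF \<phi>] word_value_closed[OF \<phi>])
  qed
  then show thesis using that eq by blast
qed

end


section \<open>The graph product\<close>

locale graph_product_data =
  fixes S :: "'s set" and m :: "'s \<Rightarrow> 's \<Rightarrow> enat" and Hs :: "'s \<Rightarrow> 'a monoid"
  assumes vertex_groups: "\<And>s. s \<in> S \<Longrightarrow> group (Hs s)"
    and m_sym: "\<And>s t. s \<in> S \<Longrightarrow> t \<in> S \<Longrightarrow> m s t = m t s"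
begin

abbreviation "F \<equiv> free_product S Hs"
abbreviation "\<iota> \<equiv> free_product_inj S Hs"
abbreviation "N \<equiv> graph_product_kernel S m Hs"
abbreviation "H \<equiv> graph_product S m Hs"
abbreviation "V \<equiv> vertex_subgroup S m Hs"
abbreviation "letters \<equiv> free_product_letters S Hs"
abbreviation "relations \<equiv> free_product_relations S Hs"

definition vertex_inj :: "'s \<Rightarrow> 'a \<Rightarrow> ('s \<times> 'a) list set set" where
  "vertex_inj s a = N #>\<^bsub>F\<^esub> \<iota> s a"

lemma V_eq: "V s = vertex_inj s ` carrier (Hs s)"
  by (simp add: vertex_subgroup_def vertex_inj_def)

lemma letter_iff: "(s, a) \<in> letters \<longleftrightarrow> s \<in> S \<and> a \<in> carrier (Hs s)"
  by (auto simp: free_product_letters_def)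

lemma group_F: "group F"
  unfolding free_product_def
proof (rule group_presented)
  fix x assume "x \<in> letters"
  then obtain s a where x: "x = (s, a)" "s \<in> S" "a \<in> carrier (Hs s)"
    by (auto simp: free_product_letters_def)
  interpret Hs: group "Hs s" using vertex_groups x by blast
  let ?b = "inv\<^bsub>Hs s\<^esub> a"
  have *: "[(s, ?b)] \<in> lists letters" "[(s, a)] \<in> lists letters" "[(s, \<one>\<^bsub>Hs s\<^esub>)] \<in> lists letters"
    using x by (auto simp: letter_iff)
  have "([(s, ?b), (s, a)], [(s, \<one>\<^bsub>Hs s\<^esub>)]) \<in> relations"
    using x unfolding free_product_relations_def by (auto intro!: exI[of _ s] exI[of _ ?b] exI[of _ a])
  then have "([(s, ?b), (s, a)], [(s, \<one>\<^bsub>Hs s\<^esub>)]) \<in> word_cong letters relations"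
    using word_cong.rel[of "[(s, ?b), (s, a)]" "[(s, \<one>\<^bsub>Hs s\<^esub>)]" relations letters "[]" "[]"] * by auto
  moreover have "([(s, \<one>\<^bsub>Hs s\<^esub>)], []) \<in> word_cong letters relations"
    using word_cong.rel[of "[(s, \<one>\<^bsub>Hs s\<^esub>)]" "[]" relations letters "[]" "[]"] * x
    by (auto simp: free_product_relations_def)
  ultimately show "\<exists>w\<in>lists letters. (w @ [x], []) \<in> word_cong letters relations"
    using * x by (intro bexI[of _ "[(s, ?b)]"]) (auto intro: word_cong.trans)
qed

lemma \<iota>_eq: "\<iota> s a = word_cong letters relations `` {[(s, a)]}"
  by (simp add: free_product_inj_def)

lemma \<iota>_closed: "s \<in> S \<Longrightarrow> a \<in> carrier (Hs s) \<Longrightarrow> \<iota> s a \<in> carrier F"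
  unfolding free_product_def by (simp add: carrier_presented \<iota>_eq letter_iff)

lemma \<iota>_mult:
  assumes "s \<in> S" "a \<in> carrier (Hs s)" "b \<in> carrier (Hs s)"
  shows "\<iota> s (a \<otimes>\<^bsub>Hs s\<^esub> b) = \<iota> s a \<otimes>\<^bsub>F\<^esub> \<iota> s b"
proof -
  interpret Hs: group "Hs s" using vertex_groups assms by blast
  have "([(s, a), (s, b)], [(s, a \<otimes>\<^bsub>Hs s\<^esub> b)]) \<in> relations"
    using assms unfolding free_product_relations_def by blast
  then have "([(s, a), (s, b)], [(s, a \<otimes>\<^bsub>Hs s\<^esub> b)]) \<in> word_cong letters relations"
    using word_cong.rel[of "[(s, a), (s, b)]" "[(s, a \<otimes>\<^bsub>Hs s\<^esub> b)]" relations letters "[]" "[]"] assms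
    by (auto simp: letter_iff)
  then show ?thesis
    unfolding free_product_def \<iota>_eq using assms
    by (subst mult_presented) (auto simp: letter_iff word_class_eq_iff dest: word_cong.sym)
qed

definition commutators :: "('s \<times> 'a) list set set" where
  "commutators = {\<iota> s a \<otimes>\<^bsub>F\<^esub> \<iota> t b \<otimes>\<^bsub>F\<^esub> inv\<^bsub>F\<^esub> (\<iota> s a) \<otimes>\<^bsub>F\<^esub> inv\<^bsub>F\<^esub> (\<iota> t b) | s t a b.
    s \<in> S \<and> t \<in> S \<and> m s t = 2 \<and> a \<in> carrier (Hs s) \<and> b \<in> carrier (Hs t)}"

lemma N_eq: "N = \<Inter>{M. M \<lhd> F \<and> commutators \<subseteq> M}"
  by (simp add: graph_product_kernel_def normal_closure_def commutators_def Let_def)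

lemma commutators_closed: "commutators \<subseteq> carrier F"
proof -
  interpret F: group F by (rule group_F)
  show ?thesis by (auto simp: commutators_def \<iota>_closed)
qed

lemma normal_N: "N \<lhd> F"
proof -
  interpret F: group F by (rule group_F)
  have ne: "carrier F \<in> {M. M \<lhd> F \<and> commutators \<subseteq> M}"
    using F.normal_self commutators_closed by (auto simp: F.normal_inv_iff F.subgroup_self)
  have sub: "subgroup N F"
    unfolding N_eq by (rule F.subgroups_Inter) (use ne in \<open>auto simp: normal_def\<close>)
  show ?thesis
    unfolding F.normal_inv_iff
  proof (intro conjI ballI sub)
    fix x h assume "x \<in> carrier F" "h \<in> N"
    then show "x \<otimes>\<^bsub>F\<^esub> h \<otimes>\<^bsub>F\<^esub> inv\<^bsub>F\<^esub> x \<in> N"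
      unfolding N_eq using F.normal_inv_iff by auto
  qed
qed

lemma group_H: "group H"
  unfolding graph_product_def using normal.factorgroup_is_group[OF normal_N] .

lemma vertex_inj_closed: "s \<in> S \<Longrightarrow> a \<in> carrier (Hs s) \<Longrightarrow> vertex_inj s a \<in> carrier H"
  by (auto simp: graph_product_def vertex_inj_def carrier_FactGroup \<iota>_closed)

lemma coset_mult:
  "x \<in> carrier F \<Longrightarrow> y \<in> carrier F \<Longrightarrow> (N #>\<^bsub>F\<^esub> x) \<otimes>\<^bsub>H\<^esub> (N #>\<^bsub>F\<^esub> y) = N #>\<^bsub>F\<^esub> (x \<otimes>\<^bsub>F\<^esub> y)"
  using normal.rcos_sum[OF normal_N] by (simp add: graph_product_def)

lemma vertex_inj_hom: "s \<in> S \<Longrightarrow> vertex_inj s \<in> hom (Hs s) H"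
  by (rule homI) (auto simp: vertex_inj_closed, auto simp: vertex_inj_def \<iota>_mult coset_mult \<iota>_closed)

lemma subgroup_V:
  assumes "s \<in> S" shows "subgroup (V s) H"
proof -
  interpret group_hom "Hs s" H "vertex_inj s"
    using assms vertex_groups group_H vertex_inj_hom
    by (auto simp: group_hom_def group_hom_axioms_def)
  show ?thesis unfolding V_eq by (rule img_is_subgroup)
qed

lemma V_commute:
  assumes "s \<in> S" "t \<in> S" "m s t = 2" "x \<in> V s" "y \<in> V t"
  shows "x \<otimes>\<^bsub>H\<^esub> y = y \<otimes>\<^bsub>H\<^esub> x"
proof -
  interpret F: group F by (rule group_F)
  interpret N: normal N F by (rule normal_N)
  obtain a b where ab: "a \<in> carrier (Hs s)" "b \<in> carrier (Hs t)" "x = vertex_inj s a" "y = vertex_inj t b"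
    using assms by (auto simp: V_eq)
  let ?a = "\<iota> s a" and ?b = "\<iota> t b"
  have c: "?a \<in> carrier F" "?b \<in> carrier F" using assms ab \<iota>_closed by auto
  have "?a \<otimes>\<^bsub>F\<^esub> ?b \<otimes>\<^bsub>F\<^esub> inv\<^bsub>F\<^esub> ?a \<otimes>\<^bsub>F\<^esub> inv\<^bsub>F\<^esub> ?b \<in> commutators"
    unfolding commutators_def using assms ab by blast
  then have n: "?a \<otimes>\<^bsub>F\<^esub> ?b \<otimes>\<^bsub>F\<^esub> inv\<^bsub>F\<^esub> ?a \<otimes>\<^bsub>F\<^esub> inv\<^bsub>F\<^esub> ?b \<in> N"
    by (auto simp: N_eq)
  have "?a \<otimes>\<^bsub>F\<^esub> ?b = (?a \<otimes>\<^bsub>F\<^esub> ?b \<otimes>\<^bsub>F\<^esub> inv\<^bsub>F\<^esub> ?a \<otimes>\<^bsub>F\<^esub> inv\<^bsub>F\<^esub> ?b) \<otimes>\<^bsub>F\<^esub> (?b \<otimes>\<^bsub>F\<^esub> ?a)"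
    using c by (simp add: F.m_assoc, simp add: F.m_assoc[symmetric])
  then have "?a \<otimes>\<^bsub>F\<^esub> ?b \<in> N #>\<^bsub>F\<^esub> (?b \<otimes>\<^bsub>F\<^esub> ?a)"
    unfolding r_coset_def using n by auto
  then have "N #>\<^bsub>F\<^esub> (?b \<otimes>\<^bsub>F\<^esub> ?a) = N #>\<^bsub>F\<^esub> (?a \<otimes>\<^bsub>F\<^esub> ?b)"
    using F.repr_independence c N.subgroup_axioms by blast
  then show ?thesis using ab c by (simp add: vertex_inj_def coset_mult)
qed

text \<open>The vertex groups generate \<open>H\<close>: induction on a word that represents \<open>h\<close>.\<close>

lemma carrier_H_induct [consumes 1, case_names one step]:
  assumes "h \<in> carrier H" and "P \<one>\<^bsub>H\<^esub>"
    and "\<And>s u h. s \<in> S \<Longrightarrow> u \<in> V s \<Longrightarrow> h \<in> carrier H \<Longrightarrow> P h \<Longrightarrow> P (u \<otimes>\<^bsub>H\<^esub> h)"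
  shows "P h"
proof -
  interpret F: group F by (rule group_F)
  interpret N: normal N F by (rule normal_N)
  let ?c = "\<lambda>w. N #>\<^bsub>F\<^esub> (word_cong letters relations `` {w})"
  have carF: "carrier F = (\<lambda>w. word_cong letters relations `` {w}) ` lists letters"
    by (simp add: free_product_def carrier_presented)
  have one: "?c [] = \<one>\<^bsub>H\<^esub>"
    using F.coset_mult_one[OF N.subset] one_presented[of letters relations]
    by (simp add: graph_product_def free_product_def)
  obtain w where "w \<in> lists letters" "h = ?c w"
    using assms(1) by (auto simp: graph_product_def carrier_FactGroup carF)
  moreover have "P (?c w)" if "w \<in> lists letters" for w
    using that
  proof (induction w)
    case Nil
    then show ?case using assms(2) by (simp add: one)
  next
    case (Cons x w)
    obtain s a where x: "x = (s, a)" "s \<in> S" "a \<in> carrier (Hs s)"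
      using Cons by (auto simp: free_product_letters_def)
    have "?c (x # w) = vertex_inj s a \<otimes>\<^bsub>H\<^esub> ?c w"
      using Cons x coset_mult[of "\<iota> s a" "word_cong letters relations `` {w}"]
        mult_presented[of "[(s, a)]" letters w relations]
      by (auto simp: vertex_inj_def \<iota>_eq carF letter_iff simp flip: free_product_def)
    moreover have "?c w \<in> carrier H"
      using Cons by (auto simp: graph_product_def carrier_FactGroup carF)
    ultimately show ?case using assms(3)[of s "vertex_inj s a" "?c w"] x Cons by (auto simp: V_eq)
  qed
  ultimately show ?thesis by simp
qed

text \<open>The universal property of the free product sends every commutator to \<open>1\<close>, hence the normal
  closure \<open>N\<close> too, because the kernel is one of the normal subgroups that are intersected to give \<open>N\<close>.
  Below it takes the place of a normal form theorem for \<open>H\<close>.\<close>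

lemma graph_product_hom:
  assumes "group L" and \<phi>: "\<And>s. s \<in> S \<Longrightarrow> \<phi> s \<in> hom (Hs s) L"
    and comm: "\<And>s t a b. s \<in> S \<Longrightarrow> t \<in> S \<Longrightarrow> m s t = 2 \<Longrightarrow> a \<in> carrier (Hs s) \<Longrightarrow>
      b \<in> carrier (Hs t) \<Longrightarrow> \<phi> s a \<otimes>\<^bsub>L\<^esub> \<phi> t b = \<phi> t b \<otimes>\<^bsub>L\<^esub> \<phi> s a"
  obtains \<Psi> where "\<Psi> \<in> hom H L"
    and "\<And>s a. s \<in> S \<Longrightarrow> a \<in> carrier (Hs s) \<Longrightarrow> \<Psi> (vertex_inj s a) = \<phi> s a"
proof -
  interpret L: group L by fact
  interpret F: group F by (rule group_F)
  have \<phi>c: "\<phi> s a \<in> carrier L" if "s \<in> S" "a \<in> carrier (Hs s)" for s a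
    using \<phi>[OF that(1)] that by (auto simp: hom_def)
  define \<phi>' where "\<phi>' = (\<lambda>(s, a). \<phi> s a)"
  have \<phi>'c: "\<phi>' \<in> letters \<rightarrow> carrier L"
    by (auto simp: \<phi>'_def letter_iff \<phi>c)
  have \<phi>'r: "word_value L \<phi>' u = word_value L \<phi>' v" if uv: "(u, v) \<in> relations" for u v
  proof -
    from uv consider s where "s \<in> S" "u = [(s, \<one>\<^bsub>Hs s\<^esub>)]" "v = []"
      | s a b where "s \<in> S" "a \<in> carrier (Hs s)" "b \<in> carrier (Hs s)"
         "u = [(s, a), (s, b)]" "v = [(s, a \<otimes>\<^bsub>Hs s\<^esub> b)]"
      by (auto simp: free_product_relations_def)
    then show ?thesis
    proof cases
      case 1
      then have "\<phi> s \<one>\<^bsub>Hs s\<^esub> = \<one>\<^bsub>L\<^esub>"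
        using hom_one \<phi> vertex_groups \<open>group L\<close> by blast
      then show ?thesis using 1 by (simp add: \<phi>'_def)
    next
      case 2
      then show ?thesis using hom_mult[OF \<phi>] \<phi>c by (simp add: \<phi>'_def)
    qed
  qed
  obtain \<Psi>0 where \<Psi>0: "\<Psi>0 \<in> hom F L"
    "\<And>u. u \<in> lists letters \<Longrightarrow> \<Psi>0 (word_cong letters relations `` {u}) = word_value L \<phi>' u"
    unfolding free_product_def by (rule L.presented_hom[OF \<phi>'c \<phi>'r]) blast+
  interpret h: group_hom F L \<Psi>0
    using \<Psi>0 by (unfold_locales) 
  have \<Psi>0\<iota>: "\<Psi>0 (\<iota> s a) = \<phi> s a" if "s \<in> S" "a \<in> carrier (Hs s)" for s a
    using that \<Psi>0(2)[of "[(s, a)]"] \<phi>c by (simp add: \<iota>_eq letter_iff \<phi>'_def)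
  have "commutators \<subseteq> kernel F L \<Psi>0"
  proof
    fix x assume "x \<in> commutators"
    then obtain s t a b where x: "s \<in> S" "t \<in> S" "m s t = 2" "a \<in> carrier (Hs s)" "b \<in> carrier (Hs t)"
      "x = \<iota> s a \<otimes>\<^bsub>F\<^esub> \<iota> t b \<otimes>\<^bsub>F\<^esub> inv\<^bsub>F\<^esub> (\<iota> s a) \<otimes>\<^bsub>F\<^esub> inv\<^bsub>F\<^esub> (\<iota> t b)"
      unfolding commutators_def by blast
    have "\<Psi>0 x = \<phi> s a \<otimes>\<^bsub>L\<^esub> \<phi> t b \<otimes>\<^bsub>L\<^esub> inv\<^bsub>L\<^esub> (\<phi> s a) \<otimes>\<^bsub>L\<^esub> inv\<^bsub>L\<^esub> (\<phi> t b)"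
      using x by (simp add: \<iota>_closed \<Psi>0\<iota>)
    also have "\<dots> = \<phi> t b \<otimes>\<^bsub>L\<^esub> (\<phi> s a \<otimes>\<^bsub>L\<^esub> inv\<^bsub>L\<^esub> (\<phi> s a)) \<otimes>\<^bsub>L\<^esub> inv\<^bsub>L\<^esub> (\<phi> t b)"
      unfolding comm[OF x(1-5)] using x \<phi>c by (simp add: L.m_assoc)
    also have "\<dots> = \<one>\<^bsub>L\<^esub>" using x \<phi>c by simp
    finally show "x \<in> kernel F L \<Psi>0"
      using x by (simp add: kernel_def \<iota>_closed)
  qed
  then have NK: "N \<subseteq> kernel F L \<Psi>0"
    using h.normal_kernel by (auto simp: N_eq)
  have "\<Psi>0 x = \<Psi>0 y" if "x \<in> carrier F" "y \<in> carrier F" "N #>\<^bsub>F\<^esub> x = N #>\<^bsub>F\<^esub> y" for x y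
  proof -
    have "x \<in> N #>\<^bsub>F\<^esub> y"
      using that F.rcos_self normal_imp_subgroup[OF normal_N] by metis
    then obtain n where "n \<in> N" "x = n \<otimes>\<^bsub>F\<^esub> y" by (auto simp: r_coset_def)
    then show ?thesis using NK that by (auto simp: kernel_def)
  qed
  then obtain \<Psi> where \<Psi>: "\<Psi> \<in> hom (F Mod N) L" "\<And>x. x \<in> carrier F \<Longrightarrow> \<Psi> (N #>\<^bsub>F\<^esub> x) = \<Psi>0 x"
    using FactGroup_universal[OF \<Psi>0(1) normal_N] by metis
  show thesis
    by (rule that[of \<Psi>]) (use \<Psi> \<Psi>0\<iota> \<iota>_closed in \<open>auto simp: graph_product_def vertex_inj_def\<close>)
qed

definition perp :: "'s \<Rightarrow> 's set" where
  "perp s = {t \<in> S. m s t = 2}"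

abbreviation star_group :: "'s \<Rightarrow> ('s \<times> 'a) list set set set" where
  "star_group s \<equiv> generate H (\<Union>t\<in>insert s (perp s). V t)"

lemma V_subset: "s \<in> S \<Longrightarrow> V s \<subseteq> carrier H"
  using subgroup.subset[OF subgroup_V] .

text \<open>The function \<open>f\<close> is a stand-in for the \<open>s\<close>-coordinate of the projection of a chamber to the residue
  of type \<open>{s} \<union> perp s\<close> of the chamber \<open>1\<close>: it tells on which side of that residue the chamber lies. Along a
  gallery it changes only where an \<open>s\<close>-panel of this residue is crossed. To see that such a function
  exists, let a generator \<open>x\<close> act on pairs \<open>(h, c)\<close> by right multiplication with the inverse of \<open>x\<close>, on
  \<open>h\<close> always and on the record \<open>c\<close> only if \<open>x\<close> has type \<open>s\<close> and \<open>h\<close> lies in the residue. Generators of types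
  \<open>s\<close> and \<open>t\<close> with \<open>m s t = 2\<close> act by commuting bijections, since multiplication by the one of type \<open>t\<close> does not
  leave the residue, so the universal property extends the action to \<open>H\<close>. The record that starts as
  \<open>1\<close> at the chamber \<open>1\<close> is \<open>f\<close>.\<close>

lemma side_function:
  assumes s: "s \<in> S"
  obtains f where "\<And>h. h \<in> carrier H \<Longrightarrow> f h \<in> carrier H"
    and "\<And>h t u. h \<in> carrier H \<Longrightarrow> t \<in> S \<Longrightarrow> u \<in> V t \<Longrightarrow> t \<noteq> s \<or> h \<notin> star_group s \<Longrightarrow>
      f (h \<otimes>\<^bsub>H\<^esub> u) = f h"
    and "\<And>h u. h \<in> star_group s \<Longrightarrow> u \<in> V s \<Longrightarrow> f (h \<otimes>\<^bsub>H\<^esub> u) = f h \<otimes>\<^bsub>H\<^esub> u"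
proof -
  interpret H: group H by (rule group_H)
  let ?P = "star_group s"
  let ?E = "carrier H \<times> carrier H"
  define act where "act t x = (\<lambda>(h, c)\<in>?E. (h \<otimes>\<^bsub>H\<^esub> inv\<^bsub>H\<^esub> x, if t = s \<and> h \<in> ?P then c \<otimes>\<^bsub>H\<^esub> inv\<^bsub>H\<^esub> x else c))" for t x
  have P: "subgroup ?P H"
    by (rule H.generate_is_subgroup) (use s V_subset in \<open>auto simp: perp_def\<close>)
  have Pc: "?P \<subseteq> carrier H" using P subgroup.subset by blast
  have VP: "V t \<subseteq> ?P" if "t = s \<or> t \<in> perp s" for t
    using that by (auto intro: generate.incl)
  have P_iff: "h \<otimes>\<^bsub>H\<^esub> inv\<^bsub>H\<^esub> x \<in> ?P \<longleftrightarrow> h \<in> ?P" if "h \<in> carrier H" "x \<in> ?P" for h x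
  proof
    assume "h \<otimes>\<^bsub>H\<^esub> inv\<^bsub>H\<^esub> x \<in> ?P"
    then have "h \<otimes>\<^bsub>H\<^esub> inv\<^bsub>H\<^esub> x \<otimes>\<^bsub>H\<^esub> x \<in> ?P"
      using subgroup.m_closed[OF P] that by blast
    then show "h \<in> ?P" using that Pc by (auto simp: H.m_assoc subset_iff)
  qed (use that P in \<open>auto intro: subgroup.m_closed subgroup.m_inv_closed\<close>)
  have closed: "x \<in> carrier H" if "t \<in> S" "x \<in> V t" for t x
    using V_subset that by blast
  have act_c: "act t x e \<in> ?E" if "t \<in> S" "x \<in> V t" "e \<in> ?E" for t x e
    using that closed[OF that(1,2)] by (auto simp: act_def)
  have act_mult: "act t (x \<otimes>\<^bsub>H\<^esub> y) e = act t x (act t y e)"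
    if t: "t \<in> S" and x: "x \<in> V t" and y: "y \<in> V t" and e: "e \<in> ?E" for t x y e
  proof -
    have *: "x \<in> carrier H" "y \<in> carrier H" using t x y closed by auto
    obtain h c where e': "e = (h, c)" "h \<in> carrier H" "c \<in> carrier H" using e by auto
    have "t = s \<Longrightarrow> h \<otimes>\<^bsub>H\<^esub> inv\<^bsub>H\<^esub> y \<in> ?P \<longleftrightarrow> h \<in> ?P" using y VP P_iff e' by blast
    then show ?thesis
      using * e' by (cases "t = s") (simp_all add: act_def H.inv_mult_group H.m_assoc)
  qed
  have act_one: "act t \<one>\<^bsub>H\<^esub> e = e" if "e \<in> ?E" for t e
    using that by (cases e) (simp add: act_def)
  have V_inv: "inv\<^bsub>H\<^esub> x \<in> V t" if "t \<in> S" "x \<in> V t" for t x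
    using subgroup.m_inv_closed[OF subgroup_V] that by blast
  have act_Bij: "act t x \<in> Bij ?E" if t: "t \<in> S" and x: "x \<in> V t" for t x
    unfolding Bij_def
  proof (intro IntI CollectI)
    show "act t x \<in> extensional ?E" by (simp add: act_def)
    show "bij_betw (act t x) ?E ?E"
    proof (rule bij_betw_byWitness[where f' = "act t (inv\<^bsub>H\<^esub> x)"])
      show "\<forall>a\<in>?E. act t (inv\<^bsub>H\<^esub> x) (act t x a) = a" "\<forall>a'\<in>?E. act t x (act t (inv\<^bsub>H\<^esub> x) a') = a'"
        using t x V_inv closed by (auto simp flip: act_mult simp: act_one)
      show "act t x ` ?E \<subseteq> ?E" "act t (inv\<^bsub>H\<^esub> x) ` ?E \<subseteq> ?E"
        using act_c t x V_inv by blast+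
    qed
  qed
  have Bmult: "g \<otimes>\<^bsub>BijGroup ?E\<^esub> g' = compose ?E g g'" if "g \<in> Bij ?E" "g' \<in> Bij ?E" for g g'
    using that by (simp add: BijGroup_def)
  have BC: "carrier (BijGroup ?E) = Bij ?E" by (simp add: BijGroup_def)
  have vV: "vertex_inj t a \<in> V t" if "a \<in> carrier (Hs t)" for t a
    using that by (auto simp: V_eq)
  define \<phi> where "\<phi> t a = act t (vertex_inj t a)" for t a
  obtain \<Psi> where \<Psi>: "\<Psi> \<in> hom H (BijGroup ?E)"
    "\<And>t a. t \<in> S \<Longrightarrow> a \<in> carrier (Hs t) \<Longrightarrow> \<Psi> (vertex_inj t a) = \<phi> t a"
  proof (rule graph_product_hom[of "BijGroup ?E" \<phi>])
    show "group (BijGroup ?E)" by (rule group_BijGroup)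
    fix t assume t: "t \<in> S"
    show "\<phi> t \<in> hom (Hs t) (BijGroup ?E)"
    proof (rule homI)
      fix a b assume ab: "a \<in> carrier (Hs t)" "b \<in> carrier (Hs t)"
      show "\<phi> t a \<in> carrier (BijGroup ?E)" using act_Bij t vV ab by (simp add: BC \<phi>_def)
      show "\<phi> t (a \<otimes>\<^bsub>Hs t\<^esub> b) = \<phi> t a \<otimes>\<^bsub>BijGroup ?E\<^esub> \<phi> t b"
        unfolding \<phi>_def hom_mult[OF vertex_inj_hom[OF t] ab]
        unfolding Bmult[OF act_Bij[OF t vV[OF ab(1)]] act_Bij[OF t vV[OF ab(2)]]]
        by (rule extensionalityI[where A = ?E])
          (use t vV[OF ab(1)] vV[OF ab(2)] in \<open>auto simp: compose_eq act_mult compose_extensional\<close>,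
            simp add: act_def)
    qed
  next
    fix t t' a b
    assume tt: "t \<in> S" "t' \<in> S" "m t t' = 2" and ab: "a \<in> carrier (Hs t)" "b \<in> carrier (Hs t')"
    let ?x = "vertex_inj t a" and ?y = "vertex_inj t' b"
    have xy: "?x \<in> V t" "?y \<in> V t'" "?x \<in> carrier H" "?y \<in> carrier H"
      using vV ab closed tt by auto
    have c: "inv\<^bsub>H\<^esub> ?x \<otimes>\<^bsub>H\<^esub> inv\<^bsub>H\<^esub> ?y = inv\<^bsub>H\<^esub> ?y \<otimes>\<^bsub>H\<^esub> inv\<^bsub>H\<^esub> ?x"
      using V_commute tt xy V_inv by blast
    have P: "t = s \<Longrightarrow> ?y \<in> ?P" "t' = s \<Longrightarrow> ?x \<in> ?P"
      using VP xy tt m_sym by (auto simp: perp_def)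
    have "act t ?x (act t' ?y e) = act t' ?y (act t ?x e)" if eE: "e \<in> ?E" for e
    proof -
      obtain h d where e: "e = (h, d)" "h \<in> carrier H" "d \<in> carrier H" using eE by auto
      have "t = s \<Longrightarrow> h \<otimes>\<^bsub>H\<^esub> inv\<^bsub>H\<^esub> ?y \<in> ?P \<longleftrightarrow> h \<in> ?P"
        "t' = s \<Longrightarrow> h \<otimes>\<^bsub>H\<^esub> inv\<^bsub>H\<^esub> ?x \<in> ?P \<longleftrightarrow> h \<in> ?P"
        using P P_iff e by blast+
      then show ?thesis
        using xy c e by (cases "t = s"; cases "t' = s") (simp_all add: act_def H.m_assoc)
    qed
    then show "\<phi> t a \<otimes>\<^bsub>BijGroup ?E\<^esub> \<phi> t' b = \<phi> t' b \<otimes>\<^bsub>BijGroup ?E\<^esub> \<phi> t a"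
      unfolding \<phi>_def using tt xy by (simp add: Bmult act_Bij compose_def cong: restrict_cong)
  qed blast
  have \<Psi>V: "\<Psi> u = act t u" if "t \<in> S" "u \<in> V t" for t u
    using that \<Psi>(2) by (auto simp: V_eq \<phi>_def)
  have \<Psi>mult: "\<Psi> (h \<otimes>\<^bsub>H\<^esub> k) e = \<Psi> h (\<Psi> k e)" if "h \<in> carrier H" "k \<in> carrier H" "e \<in> ?E" for h k e
  proof -
    have "\<Psi> h \<in> Bij ?E" "\<Psi> k \<in> Bij ?E" using \<Psi>(1) that by (auto simp: hom_def BC)
    then show ?thesis using hom_mult[OF \<Psi>(1) that(1,2)] that by (simp add: Bmult compose_eq)
  qed
  have \<Psi>one: "\<Psi> \<one>\<^bsub>H\<^esub> e = e" if "e \<in> ?E" for e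
    using hom_one[OF \<Psi>(1) group_H group_BijGroup] that by (simp add: BijGroup_def)
  have \<Psi>E: "\<Psi> k e \<in> ?E" if "k \<in> carrier H" "e \<in> ?E" for k e
    using \<Psi>(1) that Bij_imp_funcset[of "\<Psi> k" ?E] by (auto simp: hom_def BC)
  have \<Psi>fst: "fst (\<Psi> k e) = fst e \<otimes>\<^bsub>H\<^esub> inv\<^bsub>H\<^esub> k" if "k \<in> carrier H" "e \<in> ?E" for k e
    using that(1)
  proof (induction rule: carrier_H_induct)
    case one
    then show ?case using that by (auto simp: \<Psi>one)
  next
    case (step t u k)
    have "\<Psi> k e \<in> ?E" using \<Psi>E step that by blast
    moreover have "fst (act t u e') = fst e' \<otimes>\<^bsub>H\<^esub> inv\<^bsub>H\<^esub> u" if "e' \<in> ?E" for e'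
      using that by (auto simp: act_def)
    ultimately show ?case
      using step that closed[of t u] by (auto simp: \<Psi>mult \<Psi>V H.inv_mult_group H.m_assoc)
  qed
  \<comment> \<open>The inverse undoes the inversion in the action, which made it a left action.\<close>
  define f where "f h = snd (\<Psi> (inv\<^bsub>H\<^esub> h) (\<one>\<^bsub>H\<^esub>, \<one>\<^bsub>H\<^esub>))" for h
  have fE: "\<Psi> (inv\<^bsub>H\<^esub> h) (\<one>\<^bsub>H\<^esub>, \<one>\<^bsub>H\<^esub>) = (h, f h)" if "h \<in> carrier H" for h
    using \<Psi>fst[of "inv\<^bsub>H\<^esub> h" "(\<one>\<^bsub>H\<^esub>, \<one>\<^bsub>H\<^esub>)"] that by (simp add: f_def prod_eq_iff)
  have fc: "f h \<in> carrier H" if "h \<in> carrier H" for h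
    using \<Psi>E[of "inv\<^bsub>H\<^esub> h" "(\<one>\<^bsub>H\<^esub>, \<one>\<^bsub>H\<^esub>)"] that by (simp add: fE)
  have f_step: "f (h \<otimes>\<^bsub>H\<^esub> u) = (if t = s \<and> h \<in> ?P then f h \<otimes>\<^bsub>H\<^esub> u else f h)"
    if "h \<in> carrier H" "t \<in> S" "u \<in> V t" for h t u
  proof -
    have u: "u \<in> carrier H" using closed that by blast
    have "\<Psi> (inv\<^bsub>H\<^esub> (h \<otimes>\<^bsub>H\<^esub> u)) (\<one>\<^bsub>H\<^esub>, \<one>\<^bsub>H\<^esub>) = act t (inv\<^bsub>H\<^esub> u) (h, f h)"
      using u that V_inv by (simp add: H.inv_mult_group \<Psi>mult fE \<Psi>V)
    then show ?thesis
      unfolding f_def[of "h \<otimes>\<^bsub>H\<^esub> u"] using u that fc by (simp add: act_def)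
  qed
  show thesis
    by (rule that[of f]) (use fc f_step s Pc in auto)
qed

end

section \<open>Walls in a right-angled group\<close>

text \<open>Chambers are the elements of \<open>H\<close>, and \<open>V s\<close> is the vertex group of type \<open>s\<close>; two chambers are \<open>s\<close>-adjacent
  or equal if they differ by right multiplication by an element of \<open>V s\<close>. The last assumption provides, for
  each type, a function that changes along a gallery exactly where an \<open>s\<close>-panel of the wall of type \<open>s\<close>
  through \<open>1\<close> is crossed; with it, walls can be shown to separate without normal forms for elements of \<open>H\<close>.\<close>

locale right_angled_group = group H for H :: "'c monoid" (structure) +
  fixes S :: "'s set" and V :: "'s \<Rightarrow> 'c set" and perp :: "'s \<Rightarrow> 's set"
  assumes finite_S: "finite S"
    and subgroup_V: "\<And>s. s \<in> S \<Longrightarrow> subgroup (V s) H"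
    and finite_V: "\<And>s. s \<in> S \<Longrightarrow> finite (V s)"
    and perp_subset: "\<And>s. s \<in> S \<Longrightarrow> perp s \<subseteq> S - {s}"
    and V_commute: "\<And>s t x y. s \<in> S \<Longrightarrow> t \<in> perp s \<Longrightarrow> x \<in> V s \<Longrightarrow> y \<in> V t \<Longrightarrow> x \<otimes> y = y \<otimes> x"
    and V_generate: "generate H (\<Union>s\<in>S. V s) = carrier H"
    and side_functions: "\<And>s. s \<in> S \<Longrightarrow> \<exists>f. (\<forall>h\<in>carrier H. f h \<in> carrier H) \<and>
      (\<forall>h t u. h \<in> carrier H \<longrightarrow> t \<in> S \<longrightarrow> u \<in> V t \<longrightarrow>
        t \<noteq> s \<or> h \<notin> generate H (\<Union>t\<in>insert s (perp s). V t) \<longrightarrow> f (h \<otimes> u) = f h) \<and>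
      (\<forall>h u. h \<in> generate H (\<Union>t\<in>insert s (perp s). V t) \<longrightarrow> u \<in> V s \<longrightarrow> f (h \<otimes> u) = f h \<otimes> u)"
begin

definition coset_rel :: "'c set \<Rightarrow> 'c \<Rightarrow> 'c \<Rightarrow> bool" where
  "coset_rel K x y \<longleftrightarrow> x \<in> carrier H \<and> y \<in> carrier H \<and> inv x \<otimes> y \<in> K"

text \<open>The cosets of this subgroup are the walls of type \<open>s\<close> (tree-walls in the terminology of right-angled
  buildings). It is the product of \<open>V s\<close> and \<open>perp_group s\<close>, which commute with each other.\<close>

definition wall_group :: "'s \<Rightarrow> 'c set" where
  "wall_group s = generate H (\<Union>t\<in>insert s (perp s). V t)"

definition perp_group :: "'s \<Rightarrow> 'c set" where
  "perp_group s = generate H (\<Union>t\<in>perp s. V t)"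

abbreviation "adj s \<equiv> coset_rel (V s)"
abbreviation "wall s \<equiv> coset_rel (wall_group s)"

lemma coset_rel_carrier: "coset_rel K x y \<Longrightarrow> x \<in> carrier H" "coset_rel K x y \<Longrightarrow> y \<in> carrier H"
  by (auto simp: coset_rel_def)

lemma coset_rel_refl: "subgroup K H \<Longrightarrow> x \<in> carrier H \<Longrightarrow> coset_rel K x x"
  by (auto simp: coset_rel_def subgroup.one_closed)

lemma coset_rel_sym:
  assumes "subgroup K H" "coset_rel K x y" shows "coset_rel K y x"
proof -
  have "inv (inv x \<otimes> y) \<in> K"
    using assms subgroup.m_inv_closed by (auto simp: coset_rel_def)
  then show ?thesis using assms by (simp add: coset_rel_def inv_mult_group)
qed

lemma coset_rel_trans:
  assumes "subgroup K H" "coset_rel K x y" "coset_rel K y z" shows "coset_rel K x z"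
proof -
  have "(inv x \<otimes> y) \<otimes> (inv y \<otimes> z) \<in> K"
    using assms subgroup.m_closed by (fastforce simp: coset_rel_def)
  moreover have "(inv x \<otimes> y) \<otimes> (inv y \<otimes> z) = inv x \<otimes> z"
    using assms by (simp add: coset_rel_def m_assoc) (simp add: m_assoc[symmetric])
  ultimately show ?thesis using assms by (simp add: coset_rel_def)
qed

lemma coset_rel_iff: "coset_rel K x y \<longleftrightarrow> x \<in> carrier H \<and> (\<exists>u\<in>K. y = x \<otimes> u)" if "K \<subseteq> carrier H"
proof
  assume "coset_rel K x y"
  then show "x \<in> carrier H \<and> (\<exists>u\<in>K. y = x \<otimes> u)"
    by (auto simp: coset_rel_def m_assoc[symmetric] intro!: bexI[of _ "inv x \<otimes> y"])
next
  assume "x \<in> carrier H \<and> (\<exists>u\<in>K. y = x \<otimes> u)"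
  then show "coset_rel K x y"
    using that by (auto simp: coset_rel_def m_assoc[symmetric])
qed

lemma V_closed: "s \<in> S \<Longrightarrow> u \<in> V s \<Longrightarrow> u \<in> carrier H"
  using subgroup.subset[OF subgroup_V] by blast

lemma V_subset: "s \<in> S \<Longrightarrow> V s \<subseteq> carrier H"
  using V_closed by blast

lemma V_inv: "s \<in> S \<Longrightarrow> u \<in> V s \<Longrightarrow> inv u \<in> V s"
  using subgroup.m_inv_closed[OF subgroup_V] by blast

lemma perp_S: "s \<in> S \<Longrightarrow> t \<in> perp s \<Longrightarrow> t \<in> S"
  using perp_subset by blast

lemma subgroup_wall_group: "s \<in> S \<Longrightarrow> subgroup (wall_group s) H"
  unfolding wall_group_def
  by (rule generate_is_subgroup) (use V_closed perp_subset in auto)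

lemma subgroup_perp_group: "s \<in> S \<Longrightarrow> subgroup (perp_group s) H"
  unfolding perp_group_def
  by (rule generate_is_subgroup) (use V_closed perp_subset in auto)

lemma V_wall_group: "V s \<subseteq> wall_group s"
  unfolding wall_group_def by (auto intro: generate.incl)

lemma adj_wall: "adj s x y \<Longrightarrow> wall s x y"
  using V_wall_group by (auto simp: coset_rel_def)

lemmas adj_sym = coset_rel_sym[OF subgroup_V]
  and adj_trans = coset_rel_trans[OF subgroup_V]
  and wall_refl = coset_rel_refl[OF subgroup_wall_group]
  and wall_sym = coset_rel_sym[OF subgroup_wall_group]
  and wall_trans = coset_rel_trans[OF subgroup_wall_group]

lemma perp_group_commute:
  assumes s: "s \<in> S" and u: "u \<in> V s" and v: "v \<in> perp_group s"
  shows "u \<otimes> v = v \<otimes> u"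
  using v unfolding perp_group_def
proof (induction rule: generate.induct)
  case one
  then show ?case using V_closed s u by simp
next
  case (incl h)
  then show ?case using V_commute s u by blast
next
  case (inv h)
  then obtain t where t: "t \<in> perp s" "h \<in> V t" by blast
  then have "inv h \<in> V t" using V_inv perp_S[OF s] by auto
  then show ?case using V_commute s u t by blast
next
  case (eng h k)
  have "h \<in> carrier H" "k \<in> carrier H" "u \<in> carrier H"
    using eng subgroup.subset[OF subgroup_perp_group[OF s]] V_closed s u by (auto simp: perp_group_def)
  then have "u \<otimes> (h \<otimes> k) = (u \<otimes> h) \<otimes> k" "(h \<otimes> u) \<otimes> k = h \<otimes> (u \<otimes> k)" "h \<otimes> (k \<otimes> u) = (h \<otimes> k) \<otimes> u"
    by (simp_all add: m_assoc)
  then show ?case using eng by simp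
qed

lemma wall_group_decomp:
  assumes s: "s \<in> S" and "p \<in> wall_group s"
  shows "\<exists>u\<in>V s. \<exists>v\<in>perp_group s. p = u \<otimes> v"
proof -
  note V1 = subgroup.one_closed[OF subgroup_V[OF s]]
  note B1 = subgroup.one_closed[OF subgroup_perp_group[OF s]]
  have Bc: "v \<in> carrier H" if "v \<in> perp_group s" for v
    using subgroup.subset[OF subgroup_perp_group[OF s]] that by blast
  have gen: "\<exists>u\<in>V s. \<exists>v\<in>perp_group s. h = u \<otimes> v" if "h \<in> V t" "t \<in> insert s (perp s)" for h t
  proof (cases "t = s")
    case True
    then show ?thesis using that B1 V_closed s by (intro bexI[of _ h] bexI[of _ \<one>]) auto
  next
    case False
    then have "h \<in> perp_group s"
      using that unfolding perp_group_def by (auto intro: generate.incl)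
    then show ?thesis using V1 Bc by (intro bexI[of _ \<one>] bexI[of _ h]) auto
  qed
  show ?thesis
    using assms(2) unfolding wall_group_def
  proof (induction rule: generate.induct)
    case one
    then show ?case using V1 B1 by (intro bexI[of _ \<one>]) auto
  next
    case (incl h)
    then show ?case using gen by blast
  next
    case (inv h)
    then obtain t where t: "t \<in> insert s (perp s)" "h \<in> V t" by blast
    then have "inv h \<in> V t" using V_inv perp_S[OF s] s by auto
    then show ?case using gen t by blast
  next
    case (eng h k)
    then obtain u v u' v' where *: "u \<in> V s" "v \<in> perp_group s" "h = u \<otimes> v"
      "u' \<in> V s" "v' \<in> perp_group s" "k = u' \<otimes> v'" by blast
    have "h \<otimes> k = (u \<otimes> u') \<otimes> (v \<otimes> v')"
    proof -
      have c: "u \<in> carrier H" "v \<in> carrier H" "u' \<in> carrier H" "v' \<in> carrier H"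
        using * V_closed s Bc by auto
      have "h \<otimes> k = u \<otimes> (v \<otimes> u') \<otimes> v'" using * c by (simp add: m_assoc)
      also have "v \<otimes> u' = u' \<otimes> v" using perp_group_commute[OF s *(4,2)] by simp
      finally show ?thesis using c by (simp add: m_assoc)
    qed
    moreover have "u \<otimes> u' \<in> V s" "v \<otimes> v' \<in> perp_group s"
      using * subgroup.m_closed[OF subgroup_V[OF s]] subgroup.m_closed[OF subgroup_perp_group[OF s]] by auto
    ultimately show ?case by blast
  qed
qed

text \<open>Translating the side function by the chamber \<open>w\<close> gives one for the wall through \<open>w\<close>. The second clause
  says that the wall separates: distinct chambers of an \<open>s\<close>-panel of the wall lie on distinct sides.\<close>

definition side_map :: "'s \<Rightarrow> 'c \<Rightarrow> ('c \<Rightarrow> 'c) \<Rightarrow> bool" where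
  "side_map s w \<sigma> \<longleftrightarrow>
    (\<forall>x y t. t \<in> S \<longrightarrow> adj t x y \<longrightarrow> t \<noteq> s \<or> \<not> wall s w x \<longrightarrow> \<sigma> x = \<sigma> y) \<and>
    (\<forall>x y. adj s x y \<longrightarrow> wall s w x \<longrightarrow> \<sigma> x = \<sigma> y \<longrightarrow> x = y)"

lemma ex_side_map:
  assumes s: "s \<in> S" and w: "w \<in> carrier H"
  shows "\<exists>\<sigma>. side_map s w \<sigma>"
proof -
  obtain f where f': "(\<forall>h\<in>carrier H. f h \<in> carrier H) \<and>
      (\<forall>h t u. h \<in> carrier H \<longrightarrow> t \<in> S \<longrightarrow> u \<in> V t \<longrightarrow>
        t \<noteq> s \<or> h \<notin> wall_group s \<longrightarrow> f (h \<otimes> u) = f h) \<and>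
      (\<forall>h u. h \<in> wall_group s \<longrightarrow> u \<in> V s \<longrightarrow> f (h \<otimes> u) = f h \<otimes> u)"
    using side_functions[OF s] unfolding wall_group_def by (elim exE)
  have f: "\<And>h. h \<in> carrier H \<Longrightarrow> f h \<in> carrier H"
    "\<And>h t u. h \<in> carrier H \<Longrightarrow> t \<in> S \<Longrightarrow> u \<in> V t \<Longrightarrow> t \<noteq> s \<or> h \<notin> wall_group s \<Longrightarrow> f (h \<otimes> u) = f h"
    "\<And>h u. h \<in> wall_group s \<Longrightarrow> u \<in> V s \<Longrightarrow> f (h \<otimes> u) = f h \<otimes> u"
    using f' by simp_all
  have "side_map s w (\<lambda>x. f (inv w \<otimes> x))"
    unfolding side_map_def
  proof (intro conjI allI impI)
    fix x y t assume t: "t \<in> S" "adj t x y" "t \<noteq> s \<or> \<not> wall s w x"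
    then obtain u where u: "u \<in> V t" "y = x \<otimes> u" "x \<in> carrier H"
      using coset_rel_iff[OF V_subset] by blast
    then have "inv w \<otimes> y = inv w \<otimes> x \<otimes> u" using w t V_closed by (simp add: m_assoc)
    then show "f (inv w \<otimes> x) = f (inv w \<otimes> y)"
      using f(2)[of "inv w \<otimes> x" t u] t u w by (simp add: coset_rel_def)
  next
    fix x y assume a: "adj s x y" "wall s w x" "f (inv w \<otimes> x) = f (inv w \<otimes> y)"
    then obtain u where u: "u \<in> V s" "y = x \<otimes> u" "x \<in> carrier H" "u \<in> carrier H"
      using coset_rel_iff[OF V_subset[OF s]] V_closed s by blast
    then have "inv w \<otimes> y = inv w \<otimes> x \<otimes> u" using w by (simp add: m_assoc)
    then have "f (inv w \<otimes> x) = f (inv w \<otimes> x) \<otimes> u"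
      using f(3)[of "inv w \<otimes> x" u] a u w by (simp add: coset_rel_def)
    then have "u = \<one>" using l_cancel_one'[of "f (inv w \<otimes> x)" u] f(1)[of "inv w \<otimes> x"] u w by simp
    then show "x = y" using u by simp
  qed
  then show ?thesis by blast
qed

definition step :: "'c \<Rightarrow> 'c \<Rightarrow> bool" where
  "step x y \<longleftrightarrow> (\<exists>s\<in>S. adj s x y)"

lemma step_carrier: "step x y \<Longrightarrow> x \<in> carrier H \<and> y \<in> carrier H"
  by (auto simp: step_def coset_rel_def)

lemma gallery_connected:
  assumes "x \<in> carrier H" "y \<in> carrier H"
  shows "step\<^sup>*\<^sup>* x y"
proof -
  have "\<forall>x\<in>carrier H. step\<^sup>*\<^sup>* x (x \<otimes> h)" if "h \<in> generate H (\<Union>s\<in>S. V s)" for h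
    using that
  proof (induction rule: generate.induct)
    case (incl h)
    then show ?case
      using coset_rel_iff[OF V_subset] by (auto simp: step_def intro!: r_into_rtranclp)
  next
    case (inv h)
    then obtain s where "s \<in> S" "inv h \<in> V s" using V_inv by auto
    then show ?case
      using coset_rel_iff[OF V_subset] by (auto simp: step_def intro!: r_into_rtranclp)
  next
    case (eng h k)
    then have "h \<in> carrier H" "k \<in> carrier H" by (auto simp: V_generate)
    then show ?case using eng by (auto simp: m_assoc[symmetric] intro: rtranclp_trans)
  qed auto
  from this[of "inv x \<otimes> y"] show ?thesis using assms by (auto simp: V_generate simp: m_assoc[symmetric] dest!: bspec[of _ _ x])
qed

definition gallery :: "nat \<Rightarrow> (nat \<Rightarrow> 'c) \<Rightarrow> (nat \<Rightarrow> 's) \<Rightarrow> bool" where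
  "gallery k c ty \<longleftrightarrow> (\<forall>i\<le>k. c i \<in> carrier H) \<and> (\<forall>i<k. ty i \<in> S \<and> adj (ty i) (c i) (c (Suc i)))"

definition minimal_gallery :: "nat \<Rightarrow> (nat \<Rightarrow> 'c) \<Rightarrow> (nat \<Rightarrow> 's) \<Rightarrow> bool" where
  "minimal_gallery k c ty \<longleftrightarrow> gallery k c ty \<and>
    (\<forall>k' c' ty'. gallery k' c' ty' \<longrightarrow> c' 0 = c 0 \<longrightarrow> c' k' = c k \<longrightarrow> k \<le> k')"

lemma ex_minimal_gallery:
  assumes "x \<in> carrier H" "y \<in> carrier H"
  shows "\<exists>k c ty. minimal_gallery k c ty \<and> c 0 = x \<and> c k = y"
proof -
  let ?Q = "\<lambda>k. \<exists>c ty. gallery k c ty \<and> c 0 = x \<and> c k = y"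
  obtain n where "(step ^^ n) x y"
    using gallery_connected[OF assms] by (auto dest: rtranclp_imp_relpowp)
  then obtain c where c: "c 0 = x" "c n = y" "\<forall>i<n. step (c i) (c (Suc i))"
    by (auto simp: relpowp_fun_conv)
  then have "\<forall>i. \<exists>s. i < n \<longrightarrow> s \<in> S \<and> adj s (c i) (c (Suc i))" by (auto simp: step_def)
  then obtain ty where ty: "\<forall>i<n. ty i \<in> S \<and> adj (ty i) (c i) (c (Suc i))" by metis
  have "c i \<in> carrier H" if "i \<le> n" for i
  proof (cases i)
    case (Suc j)
    then show ?thesis using c(3) step_carrier that by (metis Suc_le_lessD)
  qed (use assms c in auto)
  then have "?Q n" using c ty by (auto simp: gallery_def)
  then have Q: "?Q (LEAST k. ?Q k)" by (rule LeastI)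
  have le: "(LEAST k. ?Q k) \<le> k'" if "?Q k'" for k' using that by (rule Least_le)
  from Q obtain c' ty' where *: "gallery (LEAST k. ?Q k) c' ty'" "c' 0 = x" "c' (LEAST k. ?Q k) = y"
    by (elim exE conjE)
  have "minimal_gallery (LEAST k. ?Q k) c' ty'"
    unfolding minimal_gallery_def
  proof (intro conjI allI impI)
    fix k' c'' ty''
    assume "gallery k' c'' ty''" "c'' 0 = c' 0" "c'' k' = c' (LEAST k. ?Q k)"
    then show "(LEAST k. ?Q k) \<le> k'" using * by (intro le exI[of _ c''] exI[of _ ty'']) simp
  qed (rule *)
  then show ?thesis using * by blast
qed

text \<open>Suppose that a gallery crosses the same wall at steps \<open>i < j\<close>, and at no step in between. Then
  the chambers \<open>c (i + 1)\<close> and \<open>c j\<close> lie on the wall and on the same side of it, so they differ by some \<open>v\<close>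
  that commutes with \<open>V s\<close>. Translating the part of the gallery between them back by the first
  crossing makes it start at \<open>c i\<close> and end at \<open>c i \<otimes> v\<close>, and from there the two crossings are done in
  one step. The new gallery is shorter.\<close>

lemma minimal_gallery_walls_distinct:
  assumes min: "minimal_gallery k c ty" and "i < j" "j < k" "ty i = ty j"
  shows "\<not> wall (ty i) (c i) (c j)"
proof
  define s where "s = ty i"
  assume "wall (ty i) (c i) (c j)"
  let ?Q = "\<lambda>j. i < j \<and> ty j = s \<and> wall s (c i) (c j)"
  define j0 where "j0 = (LEAST j. ?Q j)"
  have "?Q j" using assms \<open>wall (ty i) (c i) (c j)\<close> by (simp add: s_def)
  then have j0: "?Q j0" and "j0 \<le> j" unfolding j0_def by (rule LeastI, rule Least_le)
  then have jk: "j0 < k" using assms by simp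
  have between: "ty l \<noteq> s \<or> \<not> wall s (c i) (c l)" if "i < l" "l < j0" for l
    using not_less_Least[of l ?Q] that by (auto simp: j0_def)
  have g: "gallery k c ty" using min by (simp add: minimal_gallery_def)
  have s: "s \<in> S" and ci: "c i \<in> carrier H" and cj: "c j0 \<in> carrier H" and ci': "c (Suc i) \<in> carrier H"
    using g j0 jk by (auto simp: gallery_def s_def)
  have adj_i: "adj s (c i) (c (Suc i))" and adj_j: "adj s (c j0) (c (Suc j0))"
    using g j0 jk by (auto simp: gallery_def s_def)
  obtain \<sigma> where "side_map s (c i) \<sigma>"
    using ex_side_map[OF s ci] by blast
  then have \<sigma>: "\<And>x y t. t \<in> S \<Longrightarrow> adj t x y \<Longrightarrow> t \<noteq> s \<or> \<not> wall s (c i) x \<Longrightarrow> \<sigma> x = \<sigma> y"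
    "\<And>x y. adj s x y \<Longrightarrow> wall s (c i) x \<Longrightarrow> \<sigma> x = \<sigma> y \<Longrightarrow> x = y"
    by (simp_all add: side_map_def)
  have "\<sigma> (c (Suc i)) = \<sigma> (c l)" if "Suc i \<le> l" "l \<le> j0" for l
    using that
  proof (induction l rule: dec_induct)
    case (step l)
    then have "\<sigma> (c l) = \<sigma> (c (Suc l))"
      using \<sigma>(1)[of "ty l"] between[of l] g jk by (auto simp: gallery_def)
    then show ?case using step by simp
  qed simp
  then have same: "\<sigma> (c (Suc i)) = \<sigma> (c j0)" using j0 by simp
  have \<sigma>_perp: "\<forall>x\<in>carrier H. \<sigma> (x \<otimes> v) = \<sigma> x" if "v \<in> perp_group s" for v
    using that unfolding perp_group_def
  proof (induction rule: generate.induct)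
    case (incl h)
    then obtain t where "t \<in> perp s" "h \<in> V t" by blast
    then show ?case
      using \<sigma>(1)[of t] perp_subset[OF s] coset_rel_iff[OF V_subset, of t] by fastforce
  next
    case (inv h)
    then obtain t where "t \<in> perp s" "inv h \<in> V t"
      using V_inv perp_S[OF s] by auto
    then show ?case
      using \<sigma>(1)[of t] perp_subset[OF s] coset_rel_iff[OF V_subset, of t] by fastforce
  next
    case (eng h k)
    then have "h \<in> carrier H" "k \<in> carrier H"
      using subgroup.subset[OF subgroup_perp_group[OF s]] by (auto simp: perp_group_def)
    then show ?case using eng by (simp add: m_assoc[symmetric])
  qed simp
  have "wall s (c (Suc i)) (c j0)"
    using wall_trans[OF s wall_sym[OF s adj_wall[OF adj_i]]] j0 by blast
  then obtain p where p: "p \<in> wall_group s" "c j0 = c (Suc i) \<otimes> p"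
    using coset_rel_iff[OF subgroup.subset[OF subgroup_wall_group[OF s]]] by blast
  then obtain u v where uv: "u \<in> V s" "v \<in> perp_group s" "p = u \<otimes> v"
    using wall_group_decomp s by blast
  have uc: "u \<in> carrier H" and vc: "v \<in> carrier H"
    using uv V_closed s subgroup.subset[OF subgroup_perp_group[OF s]] by auto
  have cj_eq: "c j0 = c (Suc i) \<otimes> u \<otimes> v" using p uv uc vc ci' by (simp add: m_assoc)
  have "\<sigma> (c (Suc i)) = \<sigma> (c (Suc i) \<otimes> u)"
    using same \<sigma>_perp[OF uv(2)] cj_eq ci' uc by simp
  moreover have "adj s (c (Suc i)) (c (Suc i) \<otimes> u)"
    using coset_rel_iff[OF V_subset[OF s]] ci' uv by blast
  ultimately have "c (Suc i) = c (Suc i) \<otimes> u"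
    using \<sigma>(2) adj_wall[OF adj_i] by blast
  then have cjv: "c j0 = c (Suc i) \<otimes> v" using cj_eq by simp
  \<comment> \<open>Left translation by z undoes the first crossing.\<close>
  define z where "z = c i \<otimes> inv (c (Suc i))"
  have zc: "z \<in> carrier H" using ci ci' by (simp add: z_def)
  have zi: "z \<otimes> c (Suc i) = c i" using ci ci' by (simp add: z_def m_assoc)
  define c' where "c' n = (if n \<le> i then c n else if n < j0 then z \<otimes> c (Suc n) else c (Suc n))" for n
  define ty' where "ty' n = (if n < i then ty n else ty (Suc n))" for n
  have zadj: "adj t (z \<otimes> x) (z \<otimes> y)" if "adj t x y" for t x y
    using that zc by (auto simp: coset_rel_def inv_mult_group m_assoc) (simp add: m_assoc[symmetric])
  \<comment> \<open>The two crossings combined: their elements of V s multiply, because v commutes past the first.\<close>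
  have last: "adj s (z \<otimes> c j0) (c (Suc j0))"
  proof -
    obtain u1 where u1: "u1 \<in> V s" "c (Suc i) = c i \<otimes> u1"
      using adj_i coset_rel_iff[OF V_subset[OF s]] by blast
    obtain u2 where u2: "u2 \<in> V s" "c (Suc j0) = c j0 \<otimes> u2"
      using adj_j coset_rel_iff[OF V_subset[OF s]] by blast
    have cc: "u1 \<in> carrier H" "u2 \<in> carrier H" using u1 u2 V_closed s by auto
    have "z \<otimes> c j0 = c i \<otimes> v" using zi cjv zc ci' vc by (simp add: m_assoc[symmetric])
    moreover have "c (Suc j0) = c i \<otimes> (u1 \<otimes> v) \<otimes> u2"
      using u1 u2 cjv ci cc vc by (simp add: m_assoc)
    then have "c (Suc j0) = (c i \<otimes> v) \<otimes> (u1 \<otimes> u2)"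
      using perp_group_commute[OF s u1(1) uv(2)] ci cc vc by (simp add: m_assoc)
    moreover have "u1 \<otimes> u2 \<in> V s" using u1 u2 subgroup.m_closed[OF subgroup_V[OF s]] by blast
    ultimately show ?thesis using coset_rel_iff[OF V_subset[OF s]] ci vc by auto
  qed
  have "gallery (k - 1) c' ty'"
    unfolding gallery_def
  proof (intro conjI allI impI)
    fix n assume "n \<le> k - 1"
    then show "c' n \<in> carrier H" using g zc jk j0 by (auto simp: c'_def gallery_def)
  next
    fix n assume n: "n < k - 1"
    then show "ty' n \<in> S" using g by (auto simp: ty'_def gallery_def)
    consider "n < i" | "i \<le> n" "Suc n < j0" | "Suc n = j0" | "j0 \<le> n" using j0 by linarith
    then show "adj (ty' n) (c' n) (c' (Suc n))"
    proof cases
      case 1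
      then show ?thesis using g n by (auto simp: c'_def ty'_def gallery_def)
    next
      case 2
      then have "n = i \<or> i < n" by linarith
      then have "c' n = z \<otimes> c (Suc n)" "c' (Suc n) = z \<otimes> c (Suc (Suc n))"
        using 2 zi by (auto simp: c'_def)
      then show ?thesis using 2 g n zadj by (auto simp: ty'_def gallery_def)
    next
      case 3
      have "n = i \<or> i < n" using 3 j0 by linarith
      then have "c' n = z \<otimes> c j0" "c' (Suc n) = c (Suc j0)" "ty' n = s"
        using 3 zi j0 by (auto simp: c'_def ty'_def)
      then show ?thesis using last by simp
    next
      case 4
      then show ?thesis using g n j0 by (auto simp: c'_def ty'_def gallery_def)
    qed
  qed
  moreover have "c' 0 = c 0" "c' (k - 1) = c k" using j0 jk by (auto simp: c'_def)
  ultimately have "k \<le> k - 1" using min unfolding minimal_gallery_def by blast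
  then show False using jk by simp
qed

text \<open>Maps that send panels into panels; both automorphisms and the retraction to a strict
  fundamental domain are of this kind.\<close>

definition morphism :: "('c \<Rightarrow> 'c) \<Rightarrow> bool" where
  "morphism f \<longleftrightarrow> (\<forall>s x y. s \<in> S \<longrightarrow> adj s x y \<longrightarrow> adj s (f x) (f y))"

lemma morphism_adj: "morphism f \<Longrightarrow> s \<in> S \<Longrightarrow> adj s x y \<Longrightarrow> adj s (f x) (f y)"
  by (auto simp: morphism_def)

lemma morphism_closed: "morphism f \<Longrightarrow> s \<in> S \<Longrightarrow> x \<in> carrier H \<Longrightarrow> f x \<in> carrier H"
  by (rule coset_rel_carrier(2)[of "V s" "f x"], rule morphism_adj, assumption+,
    rule coset_rel_refl, rule subgroup_V)

lemma morphism_wall: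
  assumes f: "morphism f" and s: "s \<in> S" and "wall s x y"
  shows "wall s (f x) (f y)"
proof -
  have "\<forall>x\<in>carrier H. wall s (f x) (f (x \<otimes> p))"
    if "p \<in> generate H (\<Union>t\<in>insert s (perp s). V t)" for p
    using that
  proof (induction rule: generate.induct)
    case one
    then show ?case using wall_refl[OF s] morphism_closed[OF f s] by simp
  next
    case (incl h)
    then obtain t where t: "t \<in> insert s (perp s)" "h \<in> V t" "t \<in> S"
      using s perp_subset by blast
    have "V t \<subseteq> wall_group s"
      unfolding wall_group_def using t by (auto intro: generate.incl)
    moreover have "adj t (f x) (f (x \<otimes> h))" if "x \<in> carrier H" for x
      using morphism_adj[OF f] t that coset_rel_iff[OF V_subset] by blast
    ultimately show ?case by (auto simp: coset_rel_def)
  next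
    case (inv h)
    then obtain t where t: "t \<in> insert s (perp s)" "h \<in> V t" "t \<in> S"
      using s perp_subset by blast
    then have hi: "inv h \<in> V t" using V_inv by auto
    have "V t \<subseteq> wall_group s"
      unfolding wall_group_def using t by (auto intro: generate.incl)
    moreover have "adj t (f x) (f (x \<otimes> inv h))" if "x \<in> carrier H" for x
      using morphism_adj[OF f] t hi that coset_rel_iff[OF V_subset] by blast
    ultimately show ?case by (auto simp: coset_rel_def)
  next
    case (eng h k)
    then have hk: "h \<in> carrier H" "k \<in> carrier H"
      using subgroup.subset[OF subgroup_wall_group[OF s]] by (auto simp: wall_group_def)
    show ?case
    proof
      fix x assume x: "x \<in> carrier H"
      then have "wall s (f x) (f (x \<otimes> h))" "wall s (f (x \<otimes> h)) (f (x \<otimes> h \<otimes> k))"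
        using eng hk by auto
      then show "wall s (f x) (f (x \<otimes> (h \<otimes> k)))"
        using wall_trans[OF s] x hk by (simp add: m_assoc)
    qed
  qed
  moreover obtain p where "x \<in> carrier H" "p \<in> wall_group s" "y = x \<otimes> p"
    using assms(3) coset_rel_iff[OF subgroup.subset[OF subgroup_wall_group[OF s]]] by auto
  ultimately show ?thesis by (simp add: wall_group_def)
qed

end

section \<open>Strict fundamental domains of chambers\<close>

locale strict_chamber_action = right_angled_group H S V perp + G: group G
  for H :: "'c monoid" (structure) and S :: "'s set" and V perp and G :: "('g, 'b) monoid_scheme" +
  fixes act :: "'g \<Rightarrow> 'c \<Rightarrow> 'c" and D :: "'c set"
  assumes act_closed: "\<And>g x. g \<in> carrier G \<Longrightarrow> x \<in> carrier H \<Longrightarrow> act g x \<in> carrier H"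
    and act_one: "\<And>x. x \<in> carrier H \<Longrightarrow> act \<one>\<^bsub>G\<^esub> x = x"
    and act_mult: "\<And>g h x. g \<in> carrier G \<Longrightarrow> h \<in> carrier G \<Longrightarrow> x \<in> carrier H \<Longrightarrow>
      act (g \<otimes>\<^bsub>G\<^esub> h) x = act g (act h x)"
    and act_adj: "\<And>g s x y. g \<in> carrier G \<Longrightarrow> s \<in> S \<Longrightarrow> adj s x y \<Longrightarrow> adj s (act g x) (act g y)"
    and D_subset: "D \<subseteq> carrier H"
    and D_ex: "\<And>x. x \<in> carrier H \<Longrightarrow> \<exists>g\<in>carrier G. act g x \<in> D"
    and D_unique: "\<And>g d d'. g \<in> carrier G \<Longrightarrow> d \<in> D \<Longrightarrow> d' \<in> D \<Longrightarrow> act g d = d' \<Longrightarrow> d = d'"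
    and D_strict: "\<And>g s d d'. g \<in> carrier G \<Longrightarrow> s \<in> S \<Longrightarrow> d \<in> D \<Longrightarrow> d' \<in> D \<Longrightarrow>
      adj s (act g d) d' \<Longrightarrow> adj s d d'"
begin

definition stab :: "'c \<Rightarrow> 'g set" where
  "stab x = {g \<in> carrier G. act g x = x}"

definition rep :: "'c \<Rightarrow> 'c" where
  "rep x = (SOME d. d \<in> D \<and> (\<exists>g\<in>carrier G. act g x = d))"

lemma act_inv:
  assumes "g \<in> carrier G" "x \<in> carrier H"
  shows "act (inv\<^bsub>G\<^esub> g) (act g x) = x" "act g (act (inv\<^bsub>G\<^esub> g) x) = x"
  using assms act_mult[of "inv\<^bsub>G\<^esub> g" g x] act_mult[of g "inv\<^bsub>G\<^esub> g" x] act_one[of x] by simp_all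

lemma rep_spec:
  assumes "x \<in> carrier H" shows "rep x \<in> D" "\<exists>g\<in>carrier G. act g x = rep x"
proof -
  have "\<exists>d. d \<in> D \<and> (\<exists>g\<in>carrier G. act g x = d)" using D_ex[OF assms] by blast
  then have "rep x \<in> D \<and> (\<exists>g\<in>carrier G. act g x = rep x)" unfolding rep_def by (rule someI_ex)
  then show "rep x \<in> D" "\<exists>g\<in>carrier G. act g x = rep x" by auto
qed

lemma rep_eqI:
  assumes "x \<in> carrier H" "g \<in> carrier G" "act g x \<in> D"
  shows "rep x = act g x"
proof -
  obtain h where h: "h \<in> carrier G" "act h x = rep x" using rep_spec assms by blast
  have "act (h \<otimes>\<^bsub>G\<^esub> inv\<^bsub>G\<^esub> g) (act g x) = rep x"
    using assms h by (simp add: act_mult act_closed act_inv)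
  then have "act g x = rep x"
    using D_unique[of "h \<otimes>\<^bsub>G\<^esub> inv\<^bsub>G\<^esub> g" "act g x" "rep x"] assms h rep_spec(1)[OF assms(1)] by simp
  then show ?thesis by simp
qed

lemma rep_D: "d \<in> D \<Longrightarrow> rep d = d"
  using rep_eqI[of d "\<one>\<^bsub>G\<^esub>"] D_subset act_one by auto

lemma rep_act:
  assumes "g \<in> carrier G" "x \<in> carrier H" shows "rep (act g x) = rep x"
proof -
  obtain h where h: "h \<in> carrier G" "act h x = rep x" using rep_spec assms by blast
  have "act (h \<otimes>\<^bsub>G\<^esub> inv\<^bsub>G\<^esub> g) (act g x) = rep x"
    using assms h by (simp add: act_mult act_closed act_inv)
  then show ?thesis
    using rep_eqI[of "act g x" "h \<otimes>\<^bsub>G\<^esub> inv\<^bsub>G\<^esub> g"] assms h act_closed rep_spec(1)[OF assms(2)] by simp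
qed

lemma rep_same_orbit:
  assumes "x \<in> carrier H" "y \<in> carrier H" "rep x = rep y"
  shows "\<exists>g\<in>carrier G. act g x = y"
proof -
  obtain g where g: "g \<in> carrier G" "act g x = rep x" using rep_spec(2)[OF assms(1)] by blast
  obtain h where h: "h \<in> carrier G" "act h y = rep x" using rep_spec(2)[OF assms(2)] assms(3) by auto
  have "act (inv\<^bsub>G\<^esub> h \<otimes>\<^bsub>G\<^esub> g) x = y"
    using act_mult[of "inv\<^bsub>G\<^esub> h" g x] g h assms act_inv(1)[of h y] by simp
  then show ?thesis using g h by blast
qed

lemma morphism_act: "g \<in> carrier G \<Longrightarrow> morphism (act g)"
  by (auto simp: morphism_def act_adj)

text \<open>This is where strictness enters. A domain that meets each orbit of chambers once would make \<open>rep\<close>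
  well defined, but \<open>rep\<close> preserves adjacency only if no two panels that meet the domain are in one orbit.\<close>

lemma morphism_rep: "morphism rep"
  unfolding morphism_def
proof (intro allI impI)
  fix s x y assume s: "s \<in> S" and xy: "adj s x y"
  have c: "x \<in> carrier H" "y \<in> carrier H" using coset_rel_carrier[OF xy] by auto
  obtain g where g: "g \<in> carrier G" "act g x = rep x" using rep_spec(2)[OF c(1)] by blast
  obtain h where h: "h \<in> carrier G" "act h y = rep y" using rep_spec(2)[OF c(2)] by blast
  have "act (h \<otimes>\<^bsub>G\<^esub> inv\<^bsub>G\<^esub> g) (rep x) = act h x"
    using g(1) h(1) c by (simp add: g(2)[symmetric] act_mult act_closed act_inv)
  moreover have "adj s (act h x) (rep y)" using act_adj[OF h(1) s xy] h by simp
  ultimately show "adj s (rep x) (rep y)"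
    using D_strict[of "h \<otimes>\<^bsub>G\<^esub> inv\<^bsub>G\<^esub> g" s "rep x" "rep y"] g h s rep_spec(1) c by simp
qed

text \<open>The map \<open>rep\<close> takes a gallery to one of the same length and type, and it fixes the ends in \<open>D\<close>.\<close>

lemma ex_minimal_gallery_in_D:
  assumes "x \<in> D" "y \<in> D"
  shows "\<exists>k c ty. minimal_gallery k c ty \<and> c 0 = x \<and> c k = y \<and> (\<forall>i\<le>k. c i \<in> D)"
proof -
  obtain k c ty where c: "minimal_gallery k c ty" "c 0 = x" "c k = y"
    using ex_minimal_gallery[of x y] assms D_subset by blast
  then have "gallery k c ty" by (simp add: minimal_gallery_def)
  then have "gallery k (\<lambda>i. rep (c i)) ty"
    using morphism_adj[OF morphism_rep] rep_spec(1) D_subset by (auto simp: gallery_def)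
  moreover have "rep (c 0) = c 0" "rep (c k) = c k" using c rep_D assms by auto
  ultimately have "minimal_gallery k (\<lambda>i. rep (c i)) ty"
    using c(1) by (simp add: minimal_gallery_def)
  moreover have "\<forall>i\<le>k. rep (c i) \<in> D"
    using \<open>gallery k c ty\<close> rep_spec(1) by (simp add: gallery_def)
  ultimately show ?thesis using c rep_D assms by (intro exI[of _ k] exI[of _ "\<lambda>i. rep (c i)"]) auto
qed

definition linked :: "'c set \<Rightarrow> 'c \<Rightarrow> 'c \<Rightarrow> bool" where
  "linked U = (\<lambda>x y. x \<in> U \<and> y \<in> U \<and> step x y)\<^sup>*\<^sup>*"

lemma step_sym: "step x y \<Longrightarrow> step y x"
  unfolding step_def using adj_sym by blast

lemma linked_sym: "linked U x y \<Longrightarrow> linked U y x"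
  unfolding linked_def
proof (induction rule: rtranclp_induct)
  case (step y z)
  then have "(\<lambda>x y. x \<in> U \<and> y \<in> U \<and> step x y) z y" using step_sym by blast
  then show ?case using step.IH by (rule converse_rtranclp_into_rtranclp)
qed simp

lemma linked_trans: "linked U x y \<Longrightarrow> linked U y z \<Longrightarrow> linked U x z"
  unfolding linked_def by (rule rtranclp_trans)

lemma step_act: "g \<in> carrier G \<Longrightarrow> step x y \<Longrightarrow> step (act g x) (act g y)"
  unfolding step_def using act_adj by blast

text \<open>Join \<open>d\<close> by galleries to its images under the generators, and let \<open>F\<close> be the set of representatives of
  the chambers used. The union of the translates of \<open>F\<close> is connected: a chain of generators that leads from
  \<open>1\<close> to \<open>g\<close> gives a chain of translated galleries from \<open>d\<close> to \<open>act g d\<close>.\<close>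

lemma finitely_generated_imp_linked:
  assumes A: "finite A" "A \<subseteq> carrier G" "generate G A = carrier G" and d: "d \<in> D"
  shows "\<exists>F. finite F \<and> F \<subseteq> D \<and> d \<in> F \<and>
    (\<forall>x\<in>{x \<in> carrier H. rep x \<in> F}. linked {x \<in> carrier H. rep x \<in> F} d x)"
proof -
  have dc: "d \<in> carrier H" using d D_subset by blast
  have "\<forall>a\<in>A. \<exists>k c ty. gallery k c ty \<and> c 0 = d \<and> c k = act a d"
  proof
    fix a assume "a \<in> A"
    then have "act a d \<in> carrier H" using A dc act_closed by blast
    then show "\<exists>k c ty. gallery k c ty \<and> c 0 = d \<and> c k = act a d"
      using ex_minimal_gallery[OF dc] unfolding minimal_gallery_def by blast
  qed
  then obtain n where "\<forall>a\<in>A. \<exists>c ty. gallery (n a) c ty \<and> c 0 = d \<and> c (n a) = act a d"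
    by (rule bchoice[THEN exE]) blast
  then obtain c where "\<forall>a\<in>A. \<exists>ty. gallery (n a) (c a) ty \<and> c a 0 = d \<and> c a (n a) = act a d"
    by (rule bchoice[THEN exE]) blast
  then have c: "\<And>a. a \<in> A \<Longrightarrow> c a 0 = d" "\<And>a. a \<in> A \<Longrightarrow> c a (n a) = act a d"
    "\<And>a i. a \<in> A \<Longrightarrow> i \<le> n a \<Longrightarrow> c a i \<in> carrier H"
    "\<And>a i. a \<in> A \<Longrightarrow> i < n a \<Longrightarrow> step (c a i) (c a (Suc i))"
    by (auto simp: gallery_def step_def, blast+)
  define B where "B = insert d (\<Union>a\<in>A. c a ` {..n a})"
  define F where "F = rep ` B"
  define U where "U = {x \<in> carrier H. rep x \<in> F}"
  have Bc: "B \<subseteq> carrier H" using c dc by (auto simp: B_def)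
  have BU: "B \<subseteq> U" using Bc by (auto simp: U_def F_def)
  have finF: "finite F" using A by (simp add: F_def B_def)
  have FD: "F \<subseteq> D" using rep_spec(1) Bc by (auto simp: F_def)
  have dF: "d \<in> F" using rep_D[OF d] by (auto simp: F_def B_def intro!: image_eqI[of _ _ d])
  have link: "linked U d (c a i)" if "a \<in> A" "i \<le> n a" for a i
    using that(2)
  proof (induction i)
    case 0
    then show ?case using c that by (simp add: linked_def)
  next
    case (Suc i)
    have "c a j \<in> B" if "j \<le> n a" for j using that \<open>a \<in> A\<close> by (auto simp: B_def)
    then have "c a i \<in> B" "c a (Suc i) \<in> B" using Suc by auto
    then have "c a i \<in> U \<and> c a (Suc i) \<in> U \<and> step (c a i) (c a (Suc i))"
      using BU c(4)[of a i] that Suc by auto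
    moreover have "linked U d (c a i)" using Suc by simp
    ultimately show ?case unfolding linked_def by (rule rtranclp.rtrancl_into_rtrancl[rotated])
  qed
  have linkB: "linked U d b" if "b \<in> B" for b
    using that link by (auto simp: B_def linked_def)
  have linkA: "linked U d (act a d)" if "a \<in> A" for a
    using link[OF that, of "n a"] c that by simp
  have link_act: "linked U (act g x) (act g y)" if "g \<in> carrier G" "linked U x y" for g x y
    using that(2) unfolding linked_def
  proof (induction rule: rtranclp_induct)
    case (step y z)
    then have "act g y \<in> U \<and> act g z \<in> U \<and> step (act g y) (act g z)"
      using that(1) by (auto simp: U_def rep_act act_closed step_act)
    then show ?case using step.IH by (simp add: rtranclp.rtrancl_into_rtrancl)
  qed simp
  have linkG: "linked U d (act g d)" if "g \<in> generate G A" for g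
    using that
  proof (induction rule: generate.induct)
    case one
    then show ?case using act_one dc by (simp add: linked_def)
  next
    case (incl h)
    then show ?case using linkA by simp
  next
    case (inv h)
    then have h: "h \<in> carrier G" using A by blast
    then have "linked U (act (inv\<^bsub>G\<^esub> h) d) (act (inv\<^bsub>G\<^esub> h) (act h d))"
      using link_act linkA inv by simp
    then show ?case using h dc act_inv linked_sym by simp
  next
    case (eng h k)
    then have "h \<in> carrier G" "k \<in> carrier G" using A by auto
    then show ?case using link_act[of h d "act k d"] eng act_mult dc by (auto intro: linked_trans)
  qed
  have "linked U d x" if x: "x \<in> U" for x
  proof -
    obtain b where b: "b \<in> B" "rep x = rep b" using x by (auto simp: U_def F_def)
    then obtain g where g: "g \<in> carrier G" "act g b = x"
      using rep_same_orbit[of b x] Bc x by (auto simp: U_def)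
    have "linked U d (act g d)" using linkG A g by blast
    then show ?thesis using link_act[OF g(1) linkB[OF b(1)]] g linked_trans by simp
  qed
  then show ?thesis using finF FD dF unfolding U_def by blast
qed

text \<open>The key step. Let \<open>R\<close> be the wall between \<open>c i\<close> and \<open>c (i + 1)\<close>. It contains a chamber of \<open>D\<close>, so \<open>rep\<close> maps
  \<open>R\<close> into itself; as \<open>R\<close> misses \<open>F\<close>, it misses the whole of \<open>U\<close>, the union of the translates of \<open>F\<close>. Being
  connected, \<open>U\<close> lies on one side of \<open>R\<close>, which is the side of \<open>c i\<close>, because the minimal gallery from \<open>c 0\<close> in \<open>F\<close>
  to \<open>c i\<close> does not cross \<open>R\<close>. An element \<open>g\<close> that fixes \<open>c (i + 1)\<close> preserves \<open>R\<close> and \<open>U\<close>, hence this side. So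
  \<open>act g (c i)\<close> and \<open>c i\<close> are chambers of one \<open>s\<close>-panel of \<open>R\<close> on the same side, which forces them to be equal.\<close>

lemma stab_step_subset:
  assumes F: "F \<subseteq> D"
    and link: "\<And>x. x \<in> carrier H \<Longrightarrow> rep x \<in> F \<Longrightarrow> linked {x \<in> carrier H. rep x \<in> F} (c 0) x"
    and c: "minimal_gallery k c ty" "\<forall>i\<le>k. c i \<in> D" "c 0 \<in> F" and i: "i < k"
    and miss: "\<And>f. f \<in> F \<Longrightarrow> \<not> wall (ty i) (c i) f"
  shows "stab (c (Suc i)) \<subseteq> stab (c i)"
proof
  fix g assume "g \<in> stab (c (Suc i))"
  then have g: "g \<in> carrier G" "act g (c (Suc i)) = c (Suc i)" by (auto simp: stab_def)
  define s where "s = ty i"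
  define U where "U = {x \<in> carrier H. rep x \<in> F}"
  have gal: "gallery k c ty" using c by (simp add: minimal_gallery_def)
  have s: "s \<in> S" and adj_i: "adj s (c i) (c (Suc i))" and ci: "c i \<in> carrier H"
    using gal i by (auto simp: gallery_def s_def)
  obtain \<sigma> where "side_map s (c i) \<sigma>"
    using ex_side_map[OF s ci] by blast
  then have \<sigma>: "\<And>x y t. t \<in> S \<Longrightarrow> adj t x y \<Longrightarrow> t \<noteq> s \<or> \<not> wall s (c i) x \<Longrightarrow> \<sigma> x = \<sigma> y"
    "\<And>x y. adj s x y \<Longrightarrow> wall s (c i) x \<Longrightarrow> \<sigma> x = \<sigma> y \<Longrightarrow> x = y"
    by (simp_all add: side_map_def)
  have U: "\<not> wall s (c i) x" if "x \<in> U" for x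
  proof
    assume "wall s (c i) x"
    then have "wall s (rep (c i)) (rep x)" using morphism_wall[OF morphism_rep s] by blast
    then show False using miss that c i rep_D by (auto simp: U_def s_def)
  qed
  have \<sigma>_linked: "\<sigma> x = \<sigma> y" if "linked U x y" for x y
    using that unfolding linked_def
  proof (induction rule: rtranclp_induct)
    case (step y z)
    then obtain t where "t \<in> S" "adj t y z" by (auto simp: step_def)
    then show ?case using \<sigma>(1) U step by metis
  qed simp
  have gwall: "\<not> wall s (c i) (act g x)" if "x \<in> carrier H" "\<not> wall s (c i) x" for x
  proof
    assume "wall s (c i) (act g x)"
    moreover have "wall s (act g (c i)) (c (Suc i))"
      using adj_wall[OF act_adj[OF g(1) s adj_i]] g by simp
    then have "wall s (act g (c i)) (c i)"
      using wall_trans[OF s _ wall_sym[OF s adj_wall[OF adj_i]]] by blast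
    ultimately have "wall s (act g (c i)) (act g x)" using wall_trans[OF s] by blast
    then have "wall s (act (inv\<^bsub>G\<^esub> g) (act g (c i))) (act (inv\<^bsub>G\<^esub> g) (act g x))"
      using morphism_wall[OF morphism_act s] g by blast
    then show False using that act_inv(1)[OF g(1)] ci by simp
  qed
  have before: "ty l \<noteq> s \<or> \<not> wall s (c i) (c l)" if "l < i" for l
    using minimal_gallery_walls_distinct[OF c(1) that i] wall_sym[OF s] by (auto simp: s_def)
  have "\<sigma> (c 0) = \<sigma> (c l) \<and> \<sigma> (act g (c 0)) = \<sigma> (act g (c l))" if "l \<le> i" for l
    using that
  proof (induction l)
    case (Suc l)
    have a: "ty l \<in> S" "adj (ty l) (c l) (c (Suc l))" "c l \<in> carrier H"
      using gal Suc i by (auto simp: gallery_def)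
    then have "\<sigma> (c l) = \<sigma> (c (Suc l))" using \<sigma>(1) before[of l] Suc by simp
    moreover have "\<sigma> (act g (c l)) = \<sigma> (act g (c (Suc l)))"
      using \<sigma>(1)[OF a(1) act_adj[OF g(1) a(1,2)]] before[of l] gwall[OF a(3)] Suc by auto
    ultimately show ?case using Suc by simp
  qed simp
  then have "\<sigma> (c 0) = \<sigma> (c i)" "\<sigma> (act g (c 0)) = \<sigma> (act g (c i))" by auto
  moreover have "\<sigma> (c 0) = \<sigma> (act g (c 0))"
  proof (rule \<sigma>_linked)
    have "c 0 \<in> carrier H" using gal by (simp add: gallery_def)
    then show "linked U (c 0) (act g (c 0))"
      unfolding U_def using link[of "act g (c 0)"] g rep_act act_closed rep_D[of "c 0"] c by simp
  qed
  ultimately have same: "\<sigma> (c i) = \<sigma> (act g (c i))" by simp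
  have "adj s (act g (c i)) (c (Suc i))" using act_adj[OF g(1) s adj_i] g by simp
  then have "adj s (c i) (act g (c i))" using adj_trans[OF s adj_i adj_sym[OF s]] by blast
  then have "act g (c i) = c i" using \<sigma>(2)[OF _ wall_refl[OF s ci] same] by simp
  then show "g \<in> stab (c i)" using g by (simp add: stab_def)
qed

text \<open>An element that fixes \<open>y\<close> permutes the panel of \<open>y\<close>, and the elements that send \<open>x\<close> to a given
  chamber of the panel form a subset of a coset of the stabilizer of \<open>x\<close>.\<close>

lemma card_stab_step:
  assumes s: "s \<in> S" and xy: "adj s x y" and fin: "finite (stab x)" "finite (stab y)"
  shows "card (stab y) \<le> card (V s) * card (stab x)"
proof -
  have c: "x \<in> carrier H" "y \<in> carrier H" using coset_rel_carrier[OF xy] by auto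
  define panel where "panel = (\<lambda>u. y \<otimes> u) ` V s"
  have "act g x \<in> panel" if "g \<in> stab y" for g
  proof -
    have "adj s (act g y) (act g x)" using act_adj[OF _ s adj_sym[OF s xy], of g] that unfolding stab_def by blast
    then show ?thesis using that coset_rel_iff[OF V_subset[OF s]] by (auto simp: panel_def stab_def)
  qed
  then have "stab y = (\<Union>z\<in>panel. {g \<in> stab y. act g x = z})" by blast
  then have "card (stab y) \<le> (\<Sum>z\<in>panel. card {g \<in> stab y. act g x = z})"
    using card_UN_le[of panel "\<lambda>z. {g \<in> stab y. act g x = z}"] finite_V[OF s] by (simp add: panel_def)
  also have "\<dots> \<le> (\<Sum>z\<in>panel. card (stab x))"
  proof (rule sum_mono)
    fix z assume "z \<in> panel"
    show "card {g \<in> stab y. act g x = z} \<le> card (stab x)"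
    proof (cases "{g \<in> stab y. act g x = z} = {}")
      case False
      then obtain h where h: "h \<in> carrier G" "act h x = z" by (auto simp: stab_def)
      show ?thesis
      proof (rule card_inj_on_le[where f = "\<lambda>g. inv\<^bsub>G\<^esub> h \<otimes>\<^bsub>G\<^esub> g"])
        show "inj_on (\<lambda>g. inv\<^bsub>G\<^esub> h \<otimes>\<^bsub>G\<^esub> g) {g \<in> stab y. act g x = z}"
          using h by (auto simp: inj_on_def stab_def)
        show "(\<lambda>g. inv\<^bsub>G\<^esub> h \<otimes>\<^bsub>G\<^esub> g) ` {g \<in> stab y. act g x = z} \<subseteq> stab x"
          using h c act_inv(1)[OF h(1) c(1)] by (auto simp: stab_def act_mult)
      qed (rule fin)
    qed (simp only: card.empty zero_le)
  qed
  also have "\<dots> = card panel * card (stab x)" by simp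
  also have "\<dots> \<le> card (V s) * card (stab x)"
    unfolding panel_def by (intro mult_right_mono card_image_le finite_V s) simp
  finally show ?thesis .
qed

lemma card_stab_act:
  assumes g: "g \<in> carrier G" and x: "x \<in> carrier H" and fin: "finite (stab (act g x))"
  shows "card (stab x) \<le> card (stab (act g x))"
proof (rule card_inj_on_le[where f = "\<lambda>h. g \<otimes>\<^bsub>G\<^esub> h \<otimes>\<^bsub>G\<^esub> inv\<^bsub>G\<^esub> g"])
  show "inj_on (\<lambda>h. g \<otimes>\<^bsub>G\<^esub> h \<otimes>\<^bsub>G\<^esub> inv\<^bsub>G\<^esub> g) (stab x)"
    using g by (auto simp: inj_on_def stab_def)
  show "(\<lambda>h. g \<otimes>\<^bsub>G\<^esub> h \<otimes>\<^bsub>G\<^esub> inv\<^bsub>G\<^esub> g) ` stab x \<subseteq> stab (act g x)"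
    using g x by (auto simp: stab_def act_mult act_closed act_inv)
qed (rule fin)

text \<open>Walk from a chamber of \<open>F\<close> to any chamber of \<open>D\<close> along a minimal gallery. The stabilizers can grow only
  at the steps that cross a wall meeting \<open>F\<close>. These walls are distinct and a wall is determined by its type
  and one of its chambers, so there are at most \<open>card S * card F\<close> such steps.\<close>

theorem stabilizers_bounded:
  assumes A: "finite A" "A \<subseteq> carrier G" "generate G A = carrier G"
    and fin: "\<And>x. x \<in> carrier H \<Longrightarrow> finite (stab x)"
  shows "\<exists>M. \<forall>x\<in>carrier H. card (stab x) \<le> M"
proof -
  obtain d where d: "d \<in> D" using D_ex[OF one_closed] by blast
  obtain F where F: "finite F" "F \<subseteq> D" "d \<in> F"
    "\<And>x. x \<in> carrier H \<Longrightarrow> rep x \<in> F \<Longrightarrow> linked {x \<in> carrier H. rep x \<in> F} d x"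
    using finitely_generated_imp_linked[OF A d] by blast
  \<comment> \<open>The 1 makes Q at least 1, so that powers of Q are monotone in the exponent.\<close>
  define Q where "Q = Max (insert 1 ((\<lambda>s. card (V s)) ` S))"
  have Q: "card (V s) \<le> Q" if "s \<in> S" for s
    using that finite_S by (auto simp: Q_def)
  have Q1: "1 \<le> Q" using finite_S by (auto simp: Q_def)
  define M where "M = Q ^ (card S * card F) * card (stab d)"
  have "card (stab y) \<le> M" if y: "y \<in> D" for y
  proof -
    obtain k c ty where c: "minimal_gallery k c ty" "c 0 = d" "c k = y" "\<forall>i\<le>k. c i \<in> D"
      using ex_minimal_gallery_in_D[OF d y] by blast
    then have gal: "gallery k c ty" by (simp add: minimal_gallery_def)
    define I where "I = {i. i < k \<and> (\<exists>f\<in>F. wall (ty i) (c i) f)}"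
    have finI: "finite I" by (simp add: I_def)
    have le: "card (stab (c n)) \<le> Q ^ card (I \<inter> {..<n}) * card (stab d)" if "n \<le> k" for n
      using that
    proof (induction n)
      case 0
      then show ?case using c by simp
    next
      case (Suc n)
      then have n: "n < k" and cn: "c n \<in> carrier H" "c (Suc n) \<in> carrier H"
        and t: "ty n \<in> S" "adj (ty n) (c n) (c (Suc n))"
        using gal by (auto simp: gallery_def)
      have IH: "card (stab (c n)) \<le> Q ^ card (I \<inter> {..<n}) * card (stab d)" using Suc by simp
      show ?case
      proof (cases "n \<in> I")
        case True
        then have "I \<inter> {..<Suc n} = insert n (I \<inter> {..<n})" by auto
        then have "card (I \<inter> {..<Suc n}) = Suc (card (I \<inter> {..<n}))" using finI by simp
        moreover have "card (stab (c (Suc n))) \<le> Q * card (stab (c n))"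
          using card_stab_step[OF t fin fin] cn Q[OF t(1)] by (meson le_trans mult_le_mono1)
        ultimately show ?thesis using le_trans[OF _ mult_le_mono2[OF IH, of Q]] by (simp add: mult.assoc)
      next
        case False
        then have "I \<inter> {..<Suc n} = I \<inter> {..<n}" by (auto simp: less_Suc_eq)
        moreover have "stab (c (Suc n)) \<subseteq> stab (c n)"
          by (rule stab_step_subset[of F]) (use F c n False in \<open>auto simp: I_def\<close>)
        then have "card (stab (c (Suc n))) \<le> card (stab (c n))" using card_mono fin cn by blast
        ultimately show ?thesis using IH by simp
      qed
    qed
    have "\<forall>i\<in>I. \<exists>f. f \<in> F \<and> wall (ty i) (c i) f" by (auto simp: I_def)
    then obtain f where f: "\<forall>i\<in>I. f i \<in> F \<and> wall (ty i) (c i) (f i)" by metis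
    \<comment> \<open>Two crossings with the same type and the same chamber of F would cross the same wall.\<close>
    have distinct: False if "i \<in> I" "j \<in> I" "i < j" "ty i = ty j" "f i = f j" for i j
    proof -
      have s: "ty i \<in> S" using that gal by (auto simp: I_def gallery_def)
      have "wall (ty i) (c i) (f i)" "wall (ty i) (c j) (f i)" using that f by auto
      then have "wall (ty i) (c i) (c j)" using wall_trans[OF s _ wall_sym[OF s]] by blast
      then show False using minimal_gallery_walls_distinct[OF c(1) that(3) _ that(4)] that by (simp add: I_def)
    qed
    have "card I \<le> card (S \<times> F)"
    proof (rule card_inj_on_le[where f = "\<lambda>i. (ty i, f i)"])
      show "inj_on (\<lambda>i. (ty i, f i)) I"
      proof (rule inj_onI)
        fix i j assume "i \<in> I" "j \<in> I" "(ty i, f i) = (ty j, f j)"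
        then show "i = j" using distinct[of i j] distinct[of j i] by (cases i j rule: linorder_cases) auto
      qed
      show "(\<lambda>i. (ty i, f i)) ` I \<subseteq> S \<times> F" using f gal by (auto simp: I_def gallery_def)
    qed (use finite_S F in simp)
    then have cI: "card I \<le> card S * card F" by (simp add: card_cartesian_product)
    have "card (stab y) \<le> Q ^ card (I \<inter> {..<k}) * card (stab d)" using le[of k] c by simp
    also have "I \<inter> {..<k} = I" by (auto simp: I_def)
    also have "Q ^ card I * card (stab d) \<le> M"
      unfolding M_def by (intro mult_right_mono power_increasing cI Q1) simp
    finally show ?thesis .
  qed
  moreover have "card (stab x) \<le> card (stab (rep x))" if x: "x \<in> carrier H" for x
  proof -
    obtain g where "g \<in> carrier G" "act g x = rep x" using rep_spec(2) x by blast
    then show ?thesis using card_stab_act[of g x] x fin act_closed by metis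
  qed
  ultimately have "card (stab x) \<le> M" if "x \<in> carrier H" for x
    using that rep_spec(1) le_trans by blast
  then show ?thesis by blast
qed

text \<open>Induction along a gallery from \<open>x\<close> to \<open>y\<close>: each image of a chamber lies in a panel of an image of the
  preceding chamber, and panels are finite.\<close>

lemma finite_stab_orbit:
  assumes x: "x \<in> carrier H" and y: "y \<in> carrier H"
  shows "finite ((\<lambda>g. act g y) ` stab x)"
  using gallery_connected[OF assms]
proof (induction rule: rtranclp_induct)
  case base
  have "(\<lambda>g. act g x) ` stab x \<subseteq> {x}" by (auto simp: stab_def)
  then show ?case using finite_subset by blast
next
  case (step y z)
  then obtain s where s: "s \<in> S" "adj s y z" by (auto simp: step_def)
  have "(\<lambda>g. act g z) ` stab x \<subseteq> (\<Union>w\<in>(\<lambda>g. act g y) ` stab x. (\<lambda>u. w \<otimes> u) ` V s)"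
  proof
    fix w assume "w \<in> (\<lambda>g. act g z) ` stab x"
    then obtain g where g: "g \<in> stab x" "w = act g z" by blast
    then have "adj s (act g y) w" using act_adj s by (simp add: stab_def)
    then show "w \<in> (\<Union>w\<in>(\<lambda>g. act g y) ` stab x. (\<lambda>u. w \<otimes> u) ` V s)"
      using g coset_rel_iff[OF V_subset[OF s(1)]] by blast
  qed
  moreover have "finite (\<Union>w\<in>(\<lambda>g. act g y) ` stab x. (\<lambda>u. w \<otimes> u) ` V s)"
    using step.IH finite_V[OF s(1)] by blast
  ultimately show ?case using finite_subset by blast
qed

text \<open>The orbits of the chambers in \<open>E\<close> under the stabilizer of \<open>x\<close> are finite, so by the pigeonhole principle
  two of its elements agree on \<open>E\<close>.\<close>

lemma infinite_stab_fixing: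
  assumes x: "x \<in> carrier H" and inf: "infinite (stab x)" and E: "finite E" "E \<subseteq> carrier H"
  shows "\<exists>g\<in>carrier G. g \<noteq> \<one>\<^bsub>G\<^esub> \<and> (\<forall>e\<in>E. act g e = e)"
proof -
  let ?r = "\<lambda>g. \<lambda>e\<in>E. act g e"
  have "?r ` stab x \<subseteq> (\<Pi>\<^sub>E e\<in>E. (\<lambda>g. act g e) ` stab x)" by auto
  moreover have "finite (\<Pi>\<^sub>E e\<in>E. (\<lambda>g. act g e) ` stab x)"
    using E finite_stab_orbit[OF x] by (intro finite_PiE) auto
  ultimately have "\<not> inj_on ?r (stab x)" using inf finite_imageD finite_subset by blast
  then obtain g h where gh: "g \<in> stab x" "h \<in> stab x" "?r g = ?r h" "g \<noteq> h" by (auto simp: inj_on_def)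
  have c: "g \<in> carrier G" "h \<in> carrier G" using gh by (auto simp: stab_def)
  have "act (inv\<^bsub>G\<^esub> h \<otimes>\<^bsub>G\<^esub> g) e = e" if e: "e \<in> E" for e
  proof -
    have "act g e = act h e" using fun_cong[OF gh(3), of e] e by simp
    then show ?thesis using act_inv(1)[of h e] c e E by (auto simp: act_mult)
  qed
  moreover have "inv\<^bsub>G\<^esub> h \<otimes>\<^bsub>G\<^esub> g \<noteq> \<one>\<^bsub>G\<^esub>"
    using gh(4) c by (metis G.inv_closed G.inv_equality G.inv_inv)
  ultimately show ?thesis using c by (intro bexI[of _ "inv\<^bsub>G\<^esub> h \<otimes>\<^bsub>G\<^esub> g"]) auto
qed

end

section \<open>Spherical subsets\<close>

lemma right_angledD:
  assumes "right_angled S m"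
  shows "finite S" "s \<in> S \<Longrightarrow> m s s = 1" "s \<in> S \<Longrightarrow> t \<in> S \<Longrightarrow> m s t = m t s"
    "s \<in> S \<Longrightarrow> t \<in> S \<Longrightarrow> s \<noteq> t \<Longrightarrow> m s t = 2 \<or> m s t = \<infinity>"
  using assms by (auto simp: right_angled_def)

context
  fixes S :: "'s set" and m :: "'s \<Rightarrow> 's \<Rightarrow> enat"
  assumes ra: "right_angled S m"
begin

abbreviation "cox_class \<equiv> \<lambda>w. word_cong S (coxeter_relations S m) `` {w}"

lemma coxeter_involution:
  assumes "s \<in> S" shows "([s, s], []) \<in> word_cong S (coxeter_relations S m)"
proof -
  have "([s, s], []) \<in> coxeter_relations S m"
    unfolding coxeter_relations_def using assms right_angledD(2)[OF ra assms]
    by (auto intro!: exI[of _ s] exI[of _ "1::nat"] simp: one_enat_def)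
  then show ?thesis using word_cong.rel[of "[s, s]" "[]" _ S "[]" "[]"] assms by simp
qed

lemma group_coxeter: "group (coxeter_group S m)"
  unfolding coxeter_group_def
  by (rule group_presented) (auto intro!: bexI[of _ "[s]" for s] coxeter_involution)

lemma cox_class_closed: "w \<in> lists S \<Longrightarrow> cox_class w \<in> carrier (coxeter_group S m)"
  by (auto simp: coxeter_group_def carrier_presented)

lemma spherical_subset: "spherical S m T \<Longrightarrow> T' \<subseteq> T \<Longrightarrow> spherical S m T'"
  unfolding spherical_def
  by (meson finite_subset group.mono_generate[OF group_coxeter] image_mono subset_trans)

lemma spherical_singleton:
  assumes s: "s \<in> S" shows "spherical S m {s}"
proof -
  interpret W: group "coxeter_group S m" by (rule group_coxeter)
  let ?s = "cox_class [s]" and ?e = "\<one>\<^bsub>coxeter_group S m\<^esub>"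
  have c: "?s \<in> carrier (coxeter_group S m)" using s by (simp add: cox_class_closed)
  have sq: "?s \<otimes>\<^bsub>coxeter_group S m\<^esub> ?s = ?e"
    using s coxeter_involution[OF s]
    by (simp add: coxeter_group_def mult_presented one_presented word_class_eq_iff)
  then have inv: "inv\<^bsub>coxeter_group S m\<^esub> ?s = ?s" using W.inv_equality c by blast
  have "generate (coxeter_group S m) {?s} \<subseteq> {?e, ?s}"
  proof
    fix x assume "x \<in> generate (coxeter_group S m) {?s}"
    then show "x \<in> {?e, ?s}"
      by (induction rule: generate.induct) (use c sq inv in auto)
  qed
  then show ?thesis using s finite_subset by (fastforce simp: spherical_def)
qed

lemma spherical_empty: "spherical S m {}"
proof -
  interpret W: group "coxeter_group S m" by (rule group_coxeter)
  show ?thesis by (simp add: spherical_def W.generate_empty)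
qed

text \<open>If \<open>m s t\<close> is infinite then \<open>s\<close> and \<open>t\<close> generate an infinite group: let them act on the integers as the
  reflections at \<open>0\<close> and at \<open>1/2\<close>, and let all other generators act trivially. The product of the two
  reflections is a translation.\<close>

lemma spherical_commute:
  assumes T: "spherical S m T" and st: "s \<in> T" "t \<in> T" "s \<noteq> t"
  shows "m s t = 2"
proof (rule ccontr)
  assume "m s t \<noteq> 2"
  moreover have sS: "s \<in> S" "t \<in> S" using T st by (auto simp: spherical_def)
  ultimately have inf: "m s t = \<infinity>" "m t s = \<infinity>"
    using right_angledD[OF ra] st by metis+
  define L :: "(int \<Rightarrow> int) monoid" where "L = \<lparr>carrier = UNIV, mult = (\<circ>), one = id\<rparr>"
  interpret L: monoid L by unfold_locales (auto simp: L_def)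
  define \<phi> where "\<phi> r = (if r = s then \<lambda>x::int. - x else if r = t then \<lambda>x. 1 - x else id)" for r
  have val: "word_value L \<phi> (concat (replicate n [a, b])) = (\<phi> a \<circ> \<phi> b) ^^ n" for n a b
    by (induction n) (auto simp: L_def)
  have \<phi>L: "\<phi> \<in> S \<rightarrow> carrier L" by (simp add: L_def)
  have rel: "word_value L \<phi> u = word_value L \<phi> v" if uv: "(u, v) \<in> coxeter_relations S m" for u v
  proof -
    obtain a b n where ab: "a \<in> S" "b \<in> S" "m a b = enat n" "u = concat (replicate n [a, b])" "v = []"
      using uv by (auto simp: coxeter_relations_def)
    have "(\<phi> a \<circ> \<phi> b) ^^ n = id"
    proof (cases "a = b")
      case True
      then have "n = 1" using right_angledD(2)[OF ra ab(1)] ab by (simp add: one_enat_def)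
      then show ?thesis using True by (auto simp: \<phi>_def fun_eq_iff)
    next
      case False
      then have "enat n = 2" using right_angledD(4)[OF ra ab(1,2)] ab by auto
      then have n: "n = 2" by (simp add: numeral_eq_enat)
      have "{a, b} \<noteq> {s, t}" using inf ab by (auto simp: doubleton_eq_iff)
      then show ?thesis using False n by (auto simp: \<phi>_def fun_eq_iff numeral_2_eq_2)
    qed
    then show ?thesis by (simp add: ab val, simp add: L_def)
  qed
  obtain \<Psi> where \<Psi>: "\<And>u. u \<in> lists S \<Longrightarrow> \<Psi> (cox_class u) = word_value L \<phi> u"
    by (rule L.presented_hom[OF \<phi>L rel]) blast+
  let ?g = "generate (coxeter_group S m) ((\<lambda>s. cox_class [s]) ` T)"
  let ?w = "\<lambda>n. concat (replicate n [s, t])"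
  have wS: "?w n \<in> lists S" for n by (induction n) (use sS in auto)
  have "cox_class (?w n) \<in> ?g" for n
  proof (induction n)
    case 0
    have "\<one>\<^bsub>coxeter_group S m\<^esub> \<in> ?g" by (rule generate.one)
    then show ?case by (simp add: coxeter_group_def one_presented)
  next
    case (Suc n)
    have "cox_class [s] \<otimes>\<^bsub>coxeter_group S m\<^esub> (cox_class [t] \<otimes>\<^bsub>coxeter_group S m\<^esub> cox_class (?w n)) \<in> ?g"
      by (intro generate.eng Suc generate.incl imageI st)
    then show ?case
      using sS wS[of n] by (simp add: coxeter_group_def mult_presented)
  qed
  then have "range (\<lambda>n. (\<phi> s \<circ> \<phi> t) ^^ n) \<subseteq> \<Psi> ` ?g"
    using \<Psi>[OF wS] val by (metis (no_types, lifting) image_eqI image_subsetI)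
  moreover have "finite ?g" using T by (simp add: spherical_def)
  ultimately have "finite (range (\<lambda>n. (\<phi> s \<circ> \<phi> t) ^^ n))" using finite_surj by blast
  moreover have "((\<phi> s \<circ> \<phi> t) ^^ n) 0 = - int n" for n
    by (induction n) (use st in \<open>auto simp: \<phi>_def\<close>)
  then have "inj (\<lambda>n. (\<phi> s \<circ> \<phi> t) ^^ n)"
    by (intro injI) (metis neg_equal_iff_equal of_nat_eq_iff)
  ultimately show False using finite_imageD by fastforce
qed

end

section \<open>The model chamber\<close>

lemma chain_simplexE:
  assumes "x \<in> chain_simplex C"
  obtains l where "\<And>T. T \<in> C \<Longrightarrow> 0 \<le> l T" "sum l C = 1" "\<And>s. x s = (\<Sum>T\<in>C. l T * indicat_real T s)"
  using assms unfolding chain_simplex_def by blast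

lemma chain_simplex_mono:
  assumes "C \<subseteq> C'" "finite C'" shows "chain_simplex C \<subseteq> chain_simplex C'"
proof
  fix x assume "x \<in> chain_simplex C"
  then obtain l where l: "\<And>T. T \<in> C \<Longrightarrow> 0 \<le> l T" "sum l C = 1" "\<And>s. x s = (\<Sum>T\<in>C. l T * indicat_real T s)"
    by (rule chain_simplexE) blast
  define l' where "l' T = (if T \<in> C then l T else 0)" for T
  have "sum l' C' = sum l C"
    using assms by (intro sum.mono_neutral_cong_right) (auto simp: l'_def)
  moreover have "(\<Sum>T\<in>C'. l' T * indicat_real T s) = (\<Sum>T\<in>C. l T * indicat_real T s)" for s
    using assms by (intro sum.mono_neutral_cong_right) (auto simp: l'_def)
  ultimately show "x \<in> chain_simplex C'"
    unfolding chain_simplex_def using l by (auto simp: l'_def intro!: exI[of _ l'])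
qed

lemma chain_simplex_support:
  assumes C: "finite C" and l: "\<And>T. T \<in> C \<Longrightarrow> 0 \<le> l T" "sum l C = 1"
    and x: "\<And>s. x s = (\<Sum>T\<in>C. l T * indicat_real T s)"
  shows "x \<in> chain_simplex {T \<in> C. l T \<noteq> 0}"
proof -
  have "sum l {T \<in> C. l T \<noteq> 0} = sum l C"
    using C by (intro sum.mono_neutral_left) auto
  moreover have "(\<Sum>T\<in>{T \<in> C. l T \<noteq> 0}. l T * indicat_real T s) = (\<Sum>T\<in>C. l T * indicat_real T s)" for s
    using C by (intro sum.mono_neutral_left) auto
  ultimately show ?thesis
    unfolding chain_simplex_def using l x by (auto intro!: exI[of _ l])
qed

lemma indicator_in_chain_simplex:
  assumes "finite C" "T \<in> C" shows "indicat_real T \<in> chain_simplex C"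
proof -
  have "indicat_real T = (\<lambda>s. \<Sum>T'\<in>{T}. 1 * indicat_real T' s)"
    by (rule ext, subst sum.insert) auto
  then have "indicat_real T \<in> chain_simplex {T}"
    unfolding chain_simplex_def by (intro CollectI exI[of _ "\<lambda>_. 1"]) auto
  then show ?thesis using chain_simplex_mono[of "{T}" C] assms by blast
qed

lemma chain_simplex_coord:
  assumes "finite C" "x \<in> chain_simplex C"
  shows "0 \<le> x s" "x s \<le> 1" "x s = 1 \<Longrightarrow> x \<in> chain_simplex {T \<in> C. s \<in> T}"
    "x s \<noteq> 0 \<Longrightarrow> s \<in> \<Union>C"
proof -
  obtain l where l: "\<And>T. T \<in> C \<Longrightarrow> 0 \<le> l T" "sum l C = 1" "\<And>s. x s = (\<Sum>T\<in>C. l T * indicat_real T s)"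
    using assms(2) by (rule chain_simplexE) blast
  show "0 \<le> x s" unfolding l by (intro sum_nonneg mult_nonneg_nonneg l) auto
  have le: "l T * indicat_real T s \<le> l T" if "T \<in> C" for T
    using l(1)[OF that] by (auto simp: indicator_def)
  then show "x s \<le> 1" unfolding l(3) l(2)[symmetric] by (intro sum_mono)
  show "s \<in> \<Union>C" if "x s \<noteq> 0"
  proof (rule ccontr)
    assume "s \<notin> \<Union>C"
    then have "x s = 0" unfolding l by (intro sum.neutral) (auto simp: indicator_def)
    then show False using that by simp
  qed
  assume "x s = 1"
  then have "(\<Sum>T\<in>C. l T - l T * indicat_real T s) = 0"
    using l by (simp add: sum_subtractf)
  then have "\<forall>T\<in>C. l T - l T * indicat_real T s = 0"
    using assms(1) le by (subst (asm) sum_nonneg_eq_0_iff) auto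
  then have sub: "{T \<in> C. l T \<noteq> 0} \<subseteq> {T \<in> C. s \<in> T}" by (auto simp: indicator_def split: if_splits)
  have "x \<in> chain_simplex {T \<in> C. l T \<noteq> 0}"
    by (rule chain_simplex_support[OF assms(1) l])
  then show "x \<in> chain_simplex {T \<in> C. s \<in> T}"
    using subsetD[OF chain_simplex_mono[OF sub]] assms(1) by auto
qed

context
  fixes S :: "'s set" and m :: "'s \<Rightarrow> 's \<Rightarrow> enat"
  assumes ra: "right_angled S m"
begin

lemma spherical_subset_S: "spherical S m T \<Longrightarrow> T \<subseteq> S"
  by (simp add: spherical_def)

lemma spherical_chains_subset: "C \<in> spherical_chains S m \<Longrightarrow> C \<subseteq> Pow S"
  by (auto simp: spherical_chains_def dest: spherical_subset_S)

lemma finite_spherical_chains: "finite (spherical_chains S m)"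
proof (rule finite_subset)
  show "spherical_chains S m \<subseteq> Pow (Pow S)" using spherical_chains_subset by blast
qed (simp add: right_angledD(1)[OF ra])

lemma finite_chain: "C \<in> spherical_chains S m \<Longrightarrow> finite C"
  using finite_subset[OF spherical_chains_subset] right_angledD(1)[OF ra] by simp

lemma insert_empty_chain: "C \<in> spherical_chains S m \<Longrightarrow> insert {} C \<in> spherical_chains S m"
  using spherical_empty[OF ra] by (auto simp: spherical_chains_def chain_subset_def)

lemma edge_chain: "s \<in> S \<Longrightarrow> {{}, {s}} \<in> spherical_chains S m"
  using spherical_empty[OF ra] spherical_singleton[OF ra] by (auto simp: spherical_chains_def chain_subset_def)

lemma empty_chain: "{{}} \<in> spherical_chains S m"
  using spherical_empty[OF ra] by (auto simp: spherical_chains_def chain_subset_def)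

lemma simplex_model: "C \<in> spherical_chains S m \<Longrightarrow> x \<in> chain_simplex C \<Longrightarrow> x \<in> model_chamber S m"
  by (auto simp: model_chamber_def)

lemma model_chamberE:
  assumes "x \<in> model_chamber S m"
  obtains C where "C \<in> spherical_chains S m" "{} \<in> C" "x \<in> chain_simplex C"
proof -
  obtain C where C: "C \<in> spherical_chains S m" "x \<in> chain_simplex C"
    using assms by (auto simp: model_chamber_def)
  then have "x \<in> chain_simplex (insert {} C)"
    using chain_simplex_mono[of C "insert {} C"] finite_chain by auto
  then show thesis using that insert_empty_chain C by blast
qed

lemma model_chamber_coord:
  assumes "x \<in> model_chamber S m"
  shows "0 \<le> x s" "x s \<le> 1" "s \<notin> S \<Longrightarrow> x s = 0"
proof -
  obtain C where C: "C \<in> spherical_chains S m" "x \<in> chain_simplex C"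
    using assms by (auto simp: model_chamber_def)
  show "0 \<le> x s" "x s \<le> 1" using chain_simplex_coord[OF finite_chain] C by blast+
  show "x s = 0" if "s \<notin> S"
    using chain_simplex_coord(4)[OF finite_chain[OF C(1)] C(2), of s] spherical_chains_subset[OF C(1)] that by blast
qed

text \<open>Being on a mirror is a matter of one coordinate: in the definition, all vertices of the chain contain
  \<open>s\<close>, and conversely \<open>x s = 1\<close> forces all vertices of positive weight to contain \<open>s\<close>.\<close>

lemma mirror_iff:
  assumes s: "s \<in> S" and x: "x \<in> model_chamber S m"
  shows "x \<in> mirror S m s \<longleftrightarrow> x s = 1"
proof
  assume "x \<in> mirror S m s"
  then obtain C where C: "C \<in> spherical_chains S m" "{s} \<in> C" "{} \<notin> C" "x \<in> chain_simplex C"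
    by (auto simp: mirror_def)
  obtain l where l: "\<And>T. T \<in> C \<Longrightarrow> 0 \<le> l T" "sum l C = 1" "\<And>s. x s = (\<Sum>T\<in>C. l T * indicat_real T s)"
    using C(4) by (rule chain_simplexE) blast
  have "s \<in> T" if "T \<in> C" for T
  proof -
    have "T \<subseteq> {s} \<or> {s} \<subseteq> T" using C that by (auto simp: spherical_chains_def chain_subset_def)
    then show ?thesis using C that by (auto simp: subset_singleton_iff)
  qed
  then show "x s = 1" using l by simp
next
  assume "x s = 1"
  obtain C where C: "C \<in> spherical_chains S m" "x \<in> chain_simplex C"
    using x by (auto simp: model_chamber_def)
  have "x \<in> chain_simplex {T \<in> C. s \<in> T}"
    using chain_simplex_coord(3)[OF finite_chain[OF C(1)] C(2) \<open>x s = 1\<close>] .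
  moreover have "{T \<in> C. s \<in> T} \<subseteq> insert {s} {T \<in> C. s \<in> T}" by blast
  ultimately have "x \<in> chain_simplex (insert {s} {T \<in> C. s \<in> T})"
    using chain_simplex_mono[of "{T \<in> C. s \<in> T}" "insert {s} {T \<in> C. s \<in> T}"] finite_chain[OF C(1)] by auto
  moreover have "insert {s} {T \<in> C. s \<in> T} \<in> spherical_chains S m"
    using C(1) spherical_singleton[OF ra s] by (auto simp: spherical_chains_def chain_subset_def)
  ultimately show "x \<in> mirror S m s"
    unfolding mirror_def by (intro UN_I[of "insert {s} {T \<in> C. s \<in> T}"]) auto
qed

lemma mirror_types_eq: "x \<in> model_chamber S m \<Longrightarrow> mirror_types S m x = {s \<in> S. x s = 1}"
  using mirror_iff by (auto simp: mirror_types_def)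

lemma spherical_mirror_types:
  assumes x: "x \<in> model_chamber S m" shows "spherical S m (mirror_types S m x)"
proof -
  obtain C where C: "C \<in> spherical_chains S m" "x \<in> chain_simplex C"
    using x by (auto simp: model_chamber_def)
  obtain l where l: "\<And>T. T \<in> C \<Longrightarrow> 0 \<le> l T" "sum l C = 1" "\<And>s. x s = (\<Sum>T\<in>C. l T * indicat_real T s)"
    using C(2) by (rule chain_simplexE) blast
  then obtain T where T: "T \<in> C" "l T \<noteq> 0" by (metis sum.neutral zero_neq_one)
  have "mirror_types S m x \<subseteq> T"
  proof
    fix s assume "s \<in> mirror_types S m x"
    then have "(\<Sum>T\<in>C. l T - l T * indicat_real T s) = 0"
      using l by (simp add: sum_subtractf mirror_types_eq[OF x])
    moreover have "l T - l T * indicat_real T s \<ge> 0" if "T \<in> C" for T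
      using l(1)[OF that] by (auto simp: indicator_def)
    ultimately have "l T - l T * indicat_real T s = 0"
      using finite_chain[OF C(1)] T by (subst (asm) sum_nonneg_eq_0_iff) auto
    then show "s \<in> T" using T by (auto simp: indicator_def split: if_splits)
  qed
  moreover have "spherical S m T" using C T by (auto simp: spherical_chains_def)
  ultimately show ?thesis using spherical_subset[OF ra] by blast
qed

lemma vertex_model: "spherical S m T \<Longrightarrow> indicat_real T \<in> model_chamber S m"
  by (rule simplex_model[of "{T}"]) (auto simp: spherical_chains_def chain_subset_def indicator_in_chain_simplex)

lemma mirror_types_vertex: "spherical S m T \<Longrightarrow> mirror_types S m (indicat_real T) = T"
  using mirror_types_eq[OF vertex_model] spherical_subset_S by (auto simp: indicator_def)

end


section \<open>The metric on the Davis realization\<close>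

text \<open>The realization is studied for a connected chamber system of right-angled type; the last assumption
  is the local finiteness of the building.\<close>

locale davis_space =
  fixes S :: "'s set" and m :: "'s \<Rightarrow> 's \<Rightarrow> enat" and \<Phi> :: "('c, 's) chamber_system"
  assumes right_angled: "right_angled S m"
    and adjacent_sym: "\<And>s x y. s \<in> S \<Longrightarrow> (x, y) \<in> adjacent \<Phi> s \<Longrightarrow> (y, x) \<in> adjacent \<Phi> s"
    and adjacent_chambers: "\<And>s x y. s \<in> S \<Longrightarrow> (x, y) \<in> adjacent \<Phi> s \<Longrightarrow> x \<in> chambers \<Phi> \<and> y \<in> chambers \<Phi>"
    and connected: "\<And>h h'. h \<in> chambers \<Phi> \<Longrightarrow> h' \<in> chambers \<Phi> \<Longrightarrow> (h, h') \<in> residue_rel \<Phi> S"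
    and finite_residue: "\<And>T h. spherical S m T \<Longrightarrow> h \<in> chambers \<Phi> \<Longrightarrow> finite (residue_rel \<Phi> T `` {h})"
begin

abbreviation "Ch \<equiv> chambers \<Phi>"
abbreviation "K \<equiv> model_chamber S m"
abbreviation "X \<equiv> davis S m \<Phi>"
abbreviation "pt \<equiv> davis_point S m \<Phi>"
abbreviation "mt \<equiv> mirror_types S m"
abbreviation "dst \<equiv> davis_dist S m \<Phi>"
abbreviation "string \<equiv> davis_string S m \<Phi>"

lemma mt_subset: "mt x \<subseteq> S" by (auto simp: mirror_types_def)

lemma finite_S: "finite S" using right_angledD(1)[OF right_angled] .

lemma residue_sym: "T \<subseteq> S \<Longrightarrow> (h, h') \<in> residue_rel \<Phi> T \<Longrightarrow> (h', h) \<in> residue_rel \<Phi> T"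
proof -
  assume T: "T \<subseteq> S" "(h, h') \<in> residue_rel \<Phi> T"
  have "sym (\<Union>s\<in>T. adjacent \<Phi> s)" using T(1) adjacent_sym unfolding sym_def by blast
  then have "sym ((\<Union>s\<in>T. adjacent \<Phi> s)\<^sup>*)" by (rule sym_rtrancl)
  then show ?thesis using T by (auto simp: residue_rel_def dest: symD)
qed

lemma residue_trans: "(h, h') \<in> residue_rel \<Phi> T \<Longrightarrow> (h', h'') \<in> residue_rel \<Phi> T \<Longrightarrow> (h, h'') \<in> residue_rel \<Phi> T"
  by (auto simp: residue_rel_def)

lemma residue_refl: "h \<in> Ch \<Longrightarrow> (h, h) \<in> residue_rel \<Phi> T"
  by (auto simp: residue_rel_def)

lemma residue_Ch: "(h, h') \<in> residue_rel \<Phi> T \<Longrightarrow> h \<in> Ch \<and> h' \<in> Ch"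
  by (auto simp: residue_rel_def)

lemma residue_mono: "T \<subseteq> T' \<Longrightarrow> (h, h') \<in> residue_rel \<Phi> T \<Longrightarrow> (h, h') \<in> residue_rel \<Phi> T'"
  using rtrancl_mono[of "\<Union>s\<in>T. adjacent \<Phi> s" "\<Union>s\<in>T'. adjacent \<Phi> s"] by (auto simp: residue_rel_def)

lemma residue_empty: "(h, h') \<in> residue_rel \<Phi> {} \<Longrightarrow> h = h'"
  by (auto simp: residue_rel_def)

lemma pt_eq_iff:
  assumes "h \<in> Ch" "x \<in> K"
  shows "pt h x = pt h' x' \<longleftrightarrow> x = x' \<and> (h, h') \<in> residue_rel \<Phi> (mt x)"
proof
  assume "pt h x = pt h' x'"
  moreover have "(h, x) \<in> pt h x" using assms residue_refl by (auto simp: davis_point_def davis_rel_def)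
  ultimately have "(h, x) \<in> pt h' x'" by simp
  then have "x' = x" "(h', h) \<in> residue_rel \<Phi> (mt x)" by (auto simp: davis_point_def davis_rel_def)
  then show "x = x' \<and> (h, h') \<in> residue_rel \<Phi> (mt x)" using residue_sym[OF mt_subset] by simp
next
  assume "x = x' \<and> (h, h') \<in> residue_rel \<Phi> (mt x)"
  then have eq: "x = x'" "(h, h') \<in> residue_rel \<Phi> (mt x')" "(h', h) \<in> residue_rel \<Phi> (mt x')"
    using residue_sym[OF mt_subset] by auto
  then show "pt h x = pt h' x'"
    unfolding davis_point_def davis_rel_def
    by (auto intro: residue_trans[OF eq(2)] residue_trans[OF eq(3)])
qed

lemma X_eq: "X = {pt h x | h x. h \<in> Ch \<and> x \<in> K}"
  by (auto simp: davis_def quotient_def davis_point_def)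

lemma pt_in_X: "h \<in> Ch \<Longrightarrow> x \<in> K \<Longrightarrow> pt h x \<in> X"
  by (auto simp: X_eq)

lemma string_X: "string p q r \<Longrightarrow> p \<in> X \<and> q \<in> X"
proof (induction rule: davis_string.induct)
  case (step p h x r C y)
  then show ?case using pt_in_X[OF step.hyps(2) simplex_model[OF right_angled step.hyps(3) step.hyps(5)]] by blast
qed simp

lemma string_nonneg: "string p q r \<Longrightarrow> 0 \<le> r"
  by (induction rule: davis_string.induct) (auto simp: L2_set_nonneg)

lemma string_trans:
  assumes "string q z r'" "string p q r" shows "string p z (r + r')"
  using assms
proof (induction rule: davis_string.induct)
  case (step q h x r' C y)
  then show ?case using davis_string.step[of S m \<Phi> p h x "r + r'" C y] by (simp add: add.assoc)
qed simp

lemma string_single: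
  assumes "h \<in> Ch" "C \<in> spherical_chains S m" "x \<in> chain_simplex C" "y \<in> chain_simplex C"
  shows "string (pt h x) (pt h y) (L2_set (\<lambda>s. x s - y s) S)"
  using davis_string.step[OF davis_string.start assms] assms
    pt_in_X[OF assms(1) simplex_model[OF right_angled assms(2,3)]] by simp

lemma string_sym: "string p q r \<Longrightarrow> string q p r"
proof (induction rule: davis_string.induct)
  case (step p h x r C y)
  have "string (pt h y) (pt h x) (L2_set (\<lambda>s. y s - x s) S)" using string_single step by blast
  moreover have "L2_set (\<lambda>s. y s - x s) S = L2_set (\<lambda>s. x s - y s) S"
    by (simp add: L2_set_def power2_commute)
  ultimately show ?case
    using string_trans[OF step.IH, of "pt h y" "L2_set (\<lambda>s. x s - y s) S"] by (simp add: add.commute)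
qed (rule davis_string.start)

text \<open>Every point of a chamber can be joined to its apex, the vertex of type \<open>{}\<close>, and the apices of
  \<open>s\<close>-adjacent chambers are joined through the vertex of type \<open>{s}\<close>, which the two chambers share.\<close>

lemma string_exists:
  assumes "p \<in> X" "q \<in> X" shows "\<exists>r. string p q r"
proof -
  let ?o = "indicat_real {}"
  have cone: "\<exists>r. string (pt h x) (pt h ?o) r" if hx: "h \<in> Ch" "x \<in> K" for h x
  proof -
    obtain C where "C \<in> spherical_chains S m" "{} \<in> C" "x \<in> chain_simplex C"
      using model_chamberE[OF right_angled hx(2)] .
    then show ?thesis
      using string_single[OF hx(1)] indicator_in_chain_simplex finite_chain[OF right_angled] by blast
  qed
  have cross: "\<exists>r. string (pt h ?o) (pt h' ?o) r"
    if "(h, h') \<in> (\<Union>s\<in>S. adjacent \<Phi> s)\<^sup>*" "h \<in> Ch" for h h'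
    using that(1)
  proof (induction rule: rtrancl_induct)
    case base
    show ?case using cone[OF that(2)] string_X davis_string.start
      pt_in_X[OF that(2) vertex_model[OF right_angled spherical_empty[OF right_angled]]] by blast
  next
    case (step y z)
    then obtain s where s: "s \<in> S" "(y, z) \<in> adjacent \<Phi> s" by blast
    then have yz: "y \<in> Ch" "z \<in> Ch" using adjacent_chambers by auto
    let ?v = "indicat_real {s}"
    have v: "?v \<in> K" "mt ?v = {s}"
      using vertex_model[OF right_angled] mirror_types_vertex[OF right_angled]
        spherical_singleton[OF right_angled s(1)] by auto
    have "(y, z) \<in> residue_rel \<Phi> {s}" using s yz by (auto simp: residue_rel_def)
    then have "pt y ?v = pt z ?v" using pt_eq_iff[OF yz(1) v(1)] v by simp
    moreover obtain r1 where "string (pt y ?v) (pt y ?o) r1" using cone[OF yz(1) v(1)] by blast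
    moreover obtain r2 where "string (pt z ?v) (pt z ?o) r2" using cone[OF yz(2) v(1)] by blast
    ultimately have "\<exists>r. string (pt y ?o) (pt z ?o) r" using string_sym string_trans by metis
    then show ?case using step.IH string_trans by blast
  qed
  obtain h x where p: "p = pt h x" "h \<in> Ch" "x \<in> K" using assms by (auto simp: X_eq)
  obtain h' x' where q: "q = pt h' x'" "h' \<in> Ch" "x' \<in> K" using assms by (auto simp: X_eq)
  obtain r1 where "string p (pt h ?o) r1" using cone p by blast
  moreover obtain r2 where "string (pt h ?o) (pt h' ?o) r2"
    using cross connected[OF p(2) q(2)] p q by (auto simp: residue_rel_def)
  moreover obtain r3 where "string (pt h' ?o) q r3" using cone[OF q(2,3)] string_sym q by blast
  ultimately show ?thesis using string_trans by blast
qed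


lemma coordinate_le_L2: "s \<in> S \<Longrightarrow> \<bar>f s\<bar> \<le> L2_set f S" for f :: "'s \<Rightarrow> real"
  using member_le_L2_set[OF finite_S, of s "\<lambda>s. \<bar>f s\<bar>"] by (simp add: L2_set_def)

text \<open>A string that is shorter than \<open>1 - x s\<close> keeps the coordinate \<open>s\<close> below \<open>1\<close>, since it is 1-Lipschitz along
  strings. So it cannot leave a chamber through an \<open>s\<close>-mirror, and only the mirrors that contain the
  starting point are crossed.\<close>

lemma short_string:
  assumes "string p q r" and p: "p = pt h x" "h \<in> Ch" "x \<in> K"
    and "\<And>s. s \<in> S \<Longrightarrow> x s \<noteq> 1 \<Longrightarrow> r < 1 - x s"
  shows "\<exists>h' y. (h, h') \<in> residue_rel \<Phi> (mt x) \<and> y \<in> K \<and> q = pt h' y \<and> (\<forall>s\<in>S. \<bar>x s - y s\<bar> \<le> r)"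
  using assms
proof (induction rule: davis_string.induct)
  case (start p)
  then show ?case using residue_refl by (intro exI[of _ h] exI[of _ x]) auto
next
  case (step p h1 x1 r C y1)
  let ?L = "L2_set (\<lambda>s. x1 s - y1 s) S"
  have L: "0 \<le> ?L" by (rule L2_set_nonneg)
  then have small: "r < 1 - x s" if "s \<in> S" "x s \<noteq> 1" for s using step.prems(4)[OF that] by linarith
  then obtain h' y where y: "(h, h') \<in> residue_rel \<Phi> (mt x)" "y \<in> K" "pt h1 x1 = pt h' y"
    "\<forall>s\<in>S. \<bar>x s - y s\<bar> \<le> r"
    using step.IH[OF step.prems(1-3)] by blast
  have h'c: "h' \<in> Ch" using y(1) residue_Ch by blast
  have eq: "y = x1" "(h', h1) \<in> residue_rel \<Phi> (mt y)"
    using pt_eq_iff[OF h'c y(2), of h1 x1] y(3) by auto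
  have "mt y \<subseteq> mt x"
  proof
    fix s assume s: "s \<in> mt y"
    then have "s \<in> S" "y s = 1" using mirror_types_eq[OF right_angled y(2)] by auto
    then have "x s = 1" using y(4) small[of s] model_chamber_coord(2)[OF right_angled step.prems(3), of s] by fastforce
    then show "s \<in> mt x" using \<open>s \<in> S\<close> mirror_types_eq[OF right_angled step.prems(3)] by simp
  qed
  then have "(h, h1) \<in> residue_rel \<Phi> (mt x)"
    using y(1) eq(2) residue_mono residue_trans by blast
  moreover have "y1 \<in> K" using simplex_model[OF right_angled] step.hyps by blast
  moreover have "\<bar>x s - y1 s\<bar> \<le> r + ?L" if "s \<in> S" for s
    using coordinate_le_L2[OF that, of "\<lambda>s. x1 s - y1 s"] y(4) that eq(1) by fastforce
  ultimately show ?case by blast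
qed

text \<open>A radius at which balls about points with coordinates \<open>x\<close> touch only the mirrors that contain the
  centre. The \<open>1\<close> keeps the minimum defined if all coordinates in \<open>S\<close> are \<open>1\<close>.\<close>

definition gap :: "('s \<Rightarrow> real) \<Rightarrow> real" where
  "gap x = Min (insert 1 ((\<lambda>s. 1 - x s) ` {s \<in> S. x s \<noteq> 1}))"

lemma gap_pos: "x \<in> K \<Longrightarrow> 0 < gap x"
  unfolding gap_def using finite_S model_chamber_coord(2)[OF right_angled, of x]
  by (subst Min_gr_iff) (auto simp: less_le)

lemma gap_le: "s \<in> S \<Longrightarrow> x s \<noteq> 1 \<Longrightarrow> gap x \<le> 1 - x s"
  unfolding gap_def using finite_S by (intro Min_le) auto

lemma dst_def: "p \<in> X \<Longrightarrow> q \<in> X \<Longrightarrow> dst p q = Inf {r. string p q r}"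
  by (simp add: davis_dist_def)

lemma string_bdd: "bdd_below {r. string p q r}"
  using string_nonneg by (intro bdd_belowI[of _ 0]) auto

lemma dst_le_string: "string p q r \<Longrightarrow> dst p q \<le> r"
  using dst_def string_X cInf_lower[OF _ string_bdd] by fastforce

lemma dst_less_string:
  assumes "p \<in> X" "q \<in> X" "dst p q < e" shows "\<exists>r<e. string p q r"
  using assms dst_def cInf_lessD[of "{r. string p q r}" e] string_exists by auto

lemma near_point:
  assumes "h \<in> Ch" "x \<in> K" "q \<in> X" "dst (pt h x) q < e" "e \<le> gap x"
  shows "\<exists>h' y. (h, h') \<in> residue_rel \<Phi> (mt x) \<and> y \<in> K \<and> q = pt h' y \<and> (\<forall>s\<in>S. \<bar>x s - y s\<bar> < e)"
proof -
  obtain r where r: "r < e" "string (pt h x) q r"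
    using dst_less_string[OF pt_in_X assms(3,4)] assms by blast
  have "\<exists>h' y. (h, h') \<in> residue_rel \<Phi> (mt x) \<and> y \<in> K \<and> q = pt h' y \<and> (\<forall>s\<in>S. \<bar>x s - y s\<bar> \<le> r)"
    by (rule short_string[OF r(2) HOL.refl assms(1,2)]) (use gap_le[of _ x] r assms in fastforce)
  then obtain h' y where "(h, h') \<in> residue_rel \<Phi> (mt x)" "y \<in> K" "q = pt h' y" "\<forall>s\<in>S. \<bar>x s - y s\<bar> \<le> r"
    by blast
  moreover from this(4) have "\<forall>s\<in>S. \<bar>x s - y s\<bar> < e" using r(1) by fastforce
  ultimately show ?thesis by blast
qed

text \<open>Arbitrarily short strings force equal coordinates, and short strings stay in the residue on which
  points with these coordinates are identified.\<close>

lemma dst_zero_imp_eq: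
  assumes "p \<in> X" "q \<in> X" "dst p q = 0" shows "p = q"
proof -
  obtain h x where p: "p = pt h x" "h \<in> Ch" "x \<in> K" using assms by (auto simp: X_eq)
  obtain h0 y0 where q: "q = pt h0 y0" "h0 \<in> Ch" "y0 \<in> K" using assms by (auto simp: X_eq)
  have near: "(h, h0) \<in> residue_rel \<Phi> (mt x) \<or> x \<noteq> y0" "\<forall>s\<in>S. \<bar>x s - y0 s\<bar> < e"
    if e: "0 < e" "e \<le> gap x" for e
  proof -
    obtain h' y where y: "(h, h') \<in> residue_rel \<Phi> (mt x)" "y \<in> K" "q = pt h' y" "\<forall>s\<in>S. \<bar>x s - y s\<bar> < e"
      using near_point[OF p(2,3) assms(2), of e] assms e p by auto
    have "h' \<in> Ch" using y(1) residue_Ch by blast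
    then have "y = y0" "(h', h0) \<in> residue_rel \<Phi> (mt y)"
      using pt_eq_iff[of h' y h0 y0] y q by auto
    then show "(h, h0) \<in> residue_rel \<Phi> (mt x) \<or> x \<noteq> y0" "\<forall>s\<in>S. \<bar>x s - y0 s\<bar> < e"
      using y residue_trans by blast+
  qed
  have "x s = y0 s" for s
  proof (cases "s \<in> S")
    case True
    show ?thesis
    proof (rule ccontr)
      assume "x s \<noteq> y0 s"
      then have "\<bar>x s - y0 s\<bar> < min (gap x) \<bar>x s - y0 s\<bar>"
        using near(2)[of "min (gap x) \<bar>x s - y0 s\<bar>"] gap_pos[OF p(3)] True by auto
      then show False by simp
    qed
  next
    case False
    then show ?thesis
      using model_chamber_coord(3)[OF right_angled p(3)] model_chamber_coord(3)[OF right_angled q(3)] by simp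
  qed
  then have "x = y0" by blast
  then have "(h, h0) \<in> residue_rel \<Phi> (mt x)" using near(1)[of "gap x"] gap_pos[OF p(3)] by simp
  then show ?thesis using pt_eq_iff[OF p(2,3)] p q \<open>x = y0\<close> by simp
qed

sublocale davis: Metric_space X dst
proof
  fix p q
  have "0 \<le> Inf {r. string p q r}" if "p \<in> X" "q \<in> X"
    using string_exists[OF that] string_nonneg by (intro cInf_greatest) auto
  then show "0 \<le> dst p q" by (simp add: davis_dist_def)
  have "{r. string p q r} = {r. string q p r}" using string_sym by blast
  then show "dst p q = dst q p" by (simp add: davis_dist_def)
next
  fix p q assume "p \<in> X" "q \<in> X"
  moreover have "dst p p = 0" if "p \<in> X"
    using dst_le_string[OF davis_string.start[OF that]] string_exists[OF that that] string_nonneg that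
    by (intro antisym) (auto simp: dst_def intro!: cInf_greatest)
  ultimately show "dst p q = 0 \<longleftrightarrow> p = q" using dst_zero_imp_eq by blast
next
  fix p q z assume pqz: "p \<in> X" "q \<in> X" "z \<in> X"
  show "dst p z \<le> dst p q + dst q z"
  proof (rule field_le_epsilon)
    fix e :: real assume "0 < e"
    then obtain r r' where r: "r < dst p q + e / 2" "string p q r" "r' < dst q z + e / 2" "string q z r'"
      using dst_less_string[of p q "dst p q + e / 2"] dst_less_string[of q z "dst q z + e / 2"] pqz by auto
    have "dst p z \<le> r + r'" using dst_le_string string_trans r by blast
    then show "dst p z \<le> dst p q + dst q z + e" using r by simp
  qed
qed

lemma topology_eq: "davis_topology S m \<Phi> = davis.mtopology"
  by (simp add: davis_topology_def)

text \<open>The simplex is a continuous image of the compact set of barycentric weights.\<close>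

lemma compactin_simplex:
  assumes h: "h \<in> Ch" and C: "C \<in> spherical_chains S m"
  shows "compactin davis.mtopology (pt h ` chain_simplex C)"
proof -
  let ?P = "product_topology (\<lambda>_. top_of_set {0..1::real}) C"
  define f where "f l = (\<lambda>s. \<Sum>T\<in>C. l T * indicat_real T s)" for l :: "'s set \<Rightarrow> real"
  define W where "W = {l \<in> topspace ?P. sum l C = 1}"
  have finC: "finite C" using finite_chain[OF right_angled C] .
  have proj: "continuous_map ?P euclideanreal (\<lambda>l. l T)" if "T \<in> C" for T
    using continuous_map_product_projection[OF that, of "\<lambda>_. top_of_set {0..1::real}"]
    by (simp add: continuous_map_in_subtopology)
  have "continuous_map ?P euclideanreal (\<lambda>l. sum l C)"
    by (rule continuous_map_sum[OF finC proj])
  then have "closedin ?P W"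
    unfolding W_def using closedin_continuous_map_preimage[of ?P euclideanreal "\<lambda>l. sum l C" "{1}"] by simp
  moreover have "compact_space ?P"
    by (simp add: compact_space_product_topology compact_space_subtopology compactin_euclidean_iff)
  ultimately have W: "compactin ?P W" by (simp add: closedin_compact_space)
  have fW: "f l \<in> chain_simplex C" if "l \<in> W" for l
    using that unfolding W_def f_def chain_simplex_def by (auto simp: PiE_iff)
  have "continuous_map (subtopology ?P W) davis.mtopology (\<lambda>l. pt h (f l))"
    unfolding davis.continuous_map_to_metric
  proof (intro ballI allI impI)
    fix l and e :: real assume l: "l \<in> topspace (subtopology ?P W)" and e: "0 < e"
    then have lW: "l \<in> W" by simp
    define g where "g l' = (\<Sum>T\<in>C. \<bar>l T - l' T\<bar>)" for l'
    have "continuous_map ?P euclideanreal g"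
      unfolding g_def by (intro continuous_map_sum continuous_map_real_abs continuous_map_diff proj finC) auto
    then have "openin ?P {l' \<in> topspace ?P. g l' \<in> {..<e / (real (card S) + 1)}}"
      by (rule openin_continuous_map_preimage) simp
    then have "openin (subtopology ?P W) (W \<inter> {l' \<in> topspace ?P. g l' \<in> {..<e / (real (card S) + 1)}})"
      by (simp add: openin_subtopology_Int2)
    \<comment> \<open>The 1 added to card S keeps the denominator positive if S is empty.\<close>
    moreover have "l \<in> W \<inter> {l' \<in> topspace ?P. g l' \<in> {..<e / (real (card S) + 1)}}"
      using lW e by (auto simp: g_def W_def intro!: divide_pos_pos)
    moreover have "pt h (f l') \<in> davis.mball (pt h (f l)) e"
      if l': "l' \<in> W \<inter> {l' \<in> topspace ?P. g l' \<in> {..<e / (real (card S) + 1)}}" for l'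
    proof -
      have in_X: "pt h (f l'') \<in> X" if "l'' \<in> W" for l''
        using pt_in_X[OF h] simplex_model[OF right_angled C fW[OF that]] .
      have coord: "\<bar>f l s - f l' s\<bar> \<le> g l'" for s
      proof -
        have "f l s - f l' s = (\<Sum>T\<in>C. (l T - l' T) * indicat_real T s)"
          by (simp add: f_def sum_subtractf left_diff_distrib)
        also have "\<bar>\<dots>\<bar> \<le> (\<Sum>T\<in>C. \<bar>(l T - l' T) * indicat_real T s\<bar>)" by (rule sum_abs)
        also have "\<dots> \<le> g l'" unfolding g_def by (rule sum_mono) (auto simp: indicator_def)
        finally show ?thesis .
      qed
      have "dst (pt h (f l)) (pt h (f l')) \<le> L2_set (\<lambda>s. f l s - f l' s) S"
        using dst_le_string[OF string_single[OF h C fW fW]] lW l' by blast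
      also have "\<dots> \<le> (\<Sum>s\<in>S. \<bar>f l s - f l' s\<bar>)" by (rule L2_set_le_sum_abs)
      also have "\<dots> \<le> real (card S) * g l'" using sum_bounded_above[of S _ "g l'"] coord by simp
      also have "\<dots> \<le> (real (card S) + 1) * g l'"
        by (rule mult_right_mono) (auto simp: g_def intro: sum_nonneg)
      also have "\<dots> < e" using l' by (simp add: pos_less_divide_eq mult.commute)
      finally show ?thesis using in_X lW l' by (auto simp: davis.in_mball)
    qed
    ultimately show "\<exists>U. openin (subtopology ?P W) U \<and> l \<in> U \<and> (\<forall>y\<in>U. pt h (f y) \<in> davis.mball (pt h (f l)) e)"
      by blast
  qed
  then have "compactin davis.mtopology ((\<lambda>l. pt h (f l)) ` W)"
    using W by (intro image_compactin[of "subtopology ?P W"]) (auto simp: compactin_subtopology)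
  moreover have "chain_simplex C \<subseteq> f ` W"
  proof
    fix x assume "x \<in> chain_simplex C"
    then obtain l where l: "\<And>T. T \<in> C \<Longrightarrow> 0 \<le> l T" "sum l C = 1" "\<And>s. x s = (\<Sum>T\<in>C. l T * indicat_real T s)"
      by (rule chain_simplexE) blast
    have "l T \<le> 1" if "T \<in> C" for T
      using member_le_sum[of T C l] l finC that by simp
    then have "restrict l C \<in> W" using l by (auto simp: W_def)
    moreover have "f (restrict l C) = x" using l(3) by (auto simp: f_def fun_eq_iff intro!: sum.cong)
    ultimately show "x \<in> f ` W" by blast
  qed
  then have "(\<lambda>l. pt h (f l)) ` W = pt h ` chain_simplex C" using fW by auto
  ultimately show ?thesis by simp
qed

lemma compactin_chamber:
  assumes h: "h \<in> Ch" shows "compactin davis.mtopology (pt h ` K)"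
proof -
  have "compactin davis.mtopology (\<Union> ((\<lambda>C. pt h ` chain_simplex C) ` spherical_chains S m))"
    using finite_spherical_chains[OF right_angled]
    by (intro compactin_Union) (auto intro: compactin_simplex[OF h])
  also have "\<Union> ((\<lambda>C. pt h ` chain_simplex C) ` spherical_chains S m) = pt h ` K"
    by (auto simp: model_chamber_def)
  finally show ?thesis .
qed

text \<open>Local finiteness: the ball of radius \<open>gap x\<close> about a point with coordinates \<open>x\<close> is covered by the
  chambers of a spherical residue, and these are finitely many.\<close>

lemma compactin_finite_chambers:
  assumes A: "compactin davis.mtopology A"
  shows "\<exists>E. finite E \<and> E \<subseteq> Ch \<and> A \<subseteq> (\<Union>h\<in>E. pt h ` K)"
proof -
  have AX: "A \<subseteq> X" using compactin_subset_topspace[OF A] by simp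
  define \<U> where "\<U> = {U. openin davis.mtopology U \<and> (\<exists>E. finite E \<and> E \<subseteq> Ch \<and> U \<subseteq> (\<Union>h\<in>E. pt h ` K))}"
  have "A \<subseteq> \<Union>\<U>"
  proof
    fix p assume "p \<in> A"
    then obtain h x where p: "p = pt h x" "h \<in> Ch" "x \<in> K" using AX by (auto simp: X_eq)
    have "davis.mball p (gap x) \<subseteq> (\<Union>h'\<in>residue_rel \<Phi> (mt x) `` {h}. pt h' ` K)"
    proof
      fix q assume "q \<in> davis.mball p (gap x)"
      then have "q \<in> X" "dst (pt h x) q < gap x" using p by (auto simp: davis.in_mball)
      then show "q \<in> (\<Union>h'\<in>residue_rel \<Phi> (mt x) `` {h}. pt h' ` K)"
        using near_point[OF p(2,3), of q "gap x"] by blast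
    qed
    moreover have "finite (residue_rel \<Phi> (mt x) `` {h})"
      using finite_residue spherical_mirror_types[OF right_angled p(3)] p(2) by blast
    moreover have "residue_rel \<Phi> (mt x) `` {h} \<subseteq> Ch" using residue_Ch by blast
    ultimately have "davis.mball p (gap x) \<in> \<U>" unfolding \<U>_def by blast
    moreover have "p \<in> davis.mball p (gap x)"
      using p gap_pos pt_in_X by (simp add: davis.in_mball)
    ultimately show "p \<in> \<Union>\<U>" by blast
  qed
  moreover have "Ball \<U> (openin davis.mtopology)" by (auto simp: \<U>_def)
  ultimately obtain \<F> where F: "finite \<F>" "\<F> \<subseteq> \<U>" "A \<subseteq> \<Union>\<F>"
    using A unfolding compactin_def by meson
  then have "\<forall>U\<in>\<F>. \<exists>E. finite E \<and> E \<subseteq> Ch \<and> U \<subseteq> (\<Union>h\<in>E. pt h ` K)" by (auto simp: \<U>_def)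
  then obtain E where E: "\<forall>U\<in>\<F>. finite (E U) \<and> E U \<subseteq> Ch \<and> U \<subseteq> (\<Union>h\<in>E U. pt h ` K)"
    by (rule bchoice[THEN exE]) blast
  show ?thesis
    by (rule exI[of _ "\<Union>U\<in>\<F>. E U"]) (use F E in \<open>auto, blast\<close>)
qed

end

section \<open>Type-preserving automorphisms as chamber maps\<close>

context davis_space begin

abbreviation "apex \<equiv> indicat_real ({} :: 's set)"
abbreviation "Aut \<equiv> type_preserving_auts S m \<Phi>"

lemma apex: "apex \<in> K" "mt apex = {}"
  using vertex_model[OF right_angled] mirror_types_vertex[OF right_angled] spherical_empty[OF right_angled]
  by auto

lemma pt_eq_generic: "h \<in> Ch \<Longrightarrow> x \<in> K \<Longrightarrow> mt x = {} \<Longrightarrow> pt h x = pt h' x' \<longleftrightarrow> h = h' \<and> x = x'"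
  using pt_eq_iff[of h x h' x'] residue_empty residue_refl by auto

definition chamber_map :: "(('c \<times> ('s \<Rightarrow> real)) set \<Rightarrow> ('c \<times> ('s \<Rightarrow> real)) set) \<Rightarrow> ('c \<Rightarrow> 'c) \<Rightarrow> bool" where
  "chamber_map f \<phi> \<longleftrightarrow> (\<forall>h\<in>Ch. \<phi> h \<in> Ch \<and> (\<forall>x\<in>K. f (pt h x) = pt (\<phi> h) x))"

text \<open>The image chamber may a priori depend on the simplex, but all simplices needed to cover \<open>K\<close> can be
  taken to contain the apex, and the image of the apex determines the image chamber.\<close>

lemma type_preserving_iff: "type_preserving_simplicial S m \<Phi> f \<longleftrightarrow> (\<exists>\<phi>. chamber_map f \<phi>)"
proof
  assume f: "type_preserving_simplicial S m \<Phi> f"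
  have "\<exists>h'\<in>Ch. \<forall>x\<in>K. f (pt h x) = pt h' x" if h: "h \<in> Ch" for h
  proof -
    obtain h0 where h0: "h0 \<in> Ch" "f (pt h apex) = pt h0 apex"
      using f h empty_chain[OF right_angled] indicator_in_chain_simplex[of "{{}}" "{}"]
      unfolding type_preserving_simplicial_def by blast
    have "f (pt h x) = pt h0 x" if x: "x \<in> K" for x
    proof -
      obtain C where C: "C \<in> spherical_chains S m" "{} \<in> C" "x \<in> chain_simplex C"
        using model_chamberE[OF right_angled x] .
      then obtain h' where h': "h' \<in> Ch" "\<forall>y\<in>chain_simplex C. f (pt h y) = pt h' y"
        using f h unfolding type_preserving_simplicial_def by blast
      then have "f (pt h apex) = pt h' apex"
        using indicator_in_chain_simplex[OF finite_chain[OF right_angled C(1)] C(2)] by blast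
      then have "h' = h0" using h0 pt_eq_generic[OF h'(1) apex] by metis
      then show ?thesis using h' C by blast
    qed
    then show ?thesis using h0 by blast
  qed
  then have "\<forall>h\<in>Ch. \<exists>h'. h' \<in> Ch \<and> (\<forall>x\<in>K. f (pt h x) = pt h' x)" by blast
  then show "\<exists>\<phi>. chamber_map f \<phi>" unfolding chamber_map_def by (rule bchoice)
next
  assume "\<exists>\<phi>. chamber_map f \<phi>"
  then show "type_preserving_simplicial S m \<Phi> f"
    unfolding type_preserving_simplicial_def chamber_map_def
    using simplex_model[OF right_angled] by blast
qed

lemma Aut_iff: "f \<in> Aut \<longleftrightarrow> f \<in> Bij X \<and> (\<exists>\<phi>. chamber_map f \<phi>) \<and> (\<exists>\<psi>. chamber_map (inv_into X f) \<psi>)"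
  by (auto simp: type_preserving_auts_def type_preserving_iff)

lemma chamber_map_cong:
  assumes "chamber_map f \<phi>" "\<And>p. p \<in> X \<Longrightarrow> f' p = f p" shows "chamber_map f' \<phi>"
  using assms pt_in_X unfolding chamber_map_def by simp

lemma chamber_map_comp: "chamber_map f \<phi> \<Longrightarrow> chamber_map g \<psi> \<Longrightarrow> chamber_map (f \<circ> g) (\<phi> \<circ> \<psi>)"
  by (auto simp: chamber_map_def)

lemma subgroup_Aut: "subgroup Aut (BijGroup X)"
proof (rule group.subgroupI[OF group_BijGroup])
  show "Aut \<subseteq> carrier (BijGroup X)" by (auto simp: BijGroup_def Aut_iff)
  have "inv_into X (\<lambda>p\<in>X. p) p = p" if "p \<in> X" for p
    using that by (intro inv_into_f_eq) (auto intro: inj_onI)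
  then have id: "chamber_map (\<lambda>p\<in>X. p) id" "chamber_map (inv_into X (\<lambda>p\<in>X. p)) id"
    using pt_in_X by (simp_all add: chamber_map_def)
  then have "(\<lambda>p\<in>X. p) \<in> Aut" using id_Bij[of X] unfolding Aut_iff by blast
  then show "Aut \<noteq> {}" by blast
next
  fix f assume f: "f \<in> Aut"
  then have fB: "f \<in> Bij X" by (simp add: Aut_iff)
  then have bij: "bij_betw f X X" by (simp add: Bij_def)
  obtain \<phi> \<psi> where fp: "chamber_map f \<phi>" "chamber_map (inv_into X f) \<psi>" using f by (auto simp: Aut_iff)
  have "chamber_map (restrict (inv_into X f) X) \<psi>"
    by (rule chamber_map_cong[OF fp(2)]) simp
  moreover have "chamber_map (inv_into X (restrict (inv_into X f) X)) \<phi>"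
  proof (rule chamber_map_cong[OF fp(1)])
    fix p assume p: "p \<in> X"
    have "f p \<in> X" using bij p by (auto simp: bij_betw_def)
    moreover have "inv_into X f (f p) = p" using bij p by (simp add: bij_betw_def)
    moreover have "inj_on (restrict (inv_into X f) X) X"
      using bij_betw_inv_into[OF bij] by (simp add: bij_betw_def inj_on_restrict_eq)
    ultimately show "inv_into X (restrict (inv_into X f) X) p = f p"
      by (intro inv_into_f_eq) auto
  qed
  ultimately show "inv\<^bsub>BijGroup X\<^esub> f \<in> Aut"
    using fB restrict_inv_into_Bij[OF fB] by (auto simp: inv_BijGroup Aut_iff)
next
  fix f g assume fg: "f \<in> Aut" "g \<in> Aut"
  then have B: "f \<in> Bij X" "g \<in> Bij X" by (simp_all add: Aut_iff)
  then have bij: "bij_betw f X X" "bij_betw g X X" by (simp_all add: Bij_def)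
  obtain \<phi> \<psi> where fp: "chamber_map f \<phi>" "chamber_map (inv_into X f) \<psi>" using fg by (auto simp: Aut_iff)
  obtain \<phi>' \<psi>' where gp: "chamber_map g \<phi>'" "chamber_map (inv_into X g) \<psi>'" using fg by (auto simp: Aut_iff)
  have "chamber_map (compose X f g) (\<phi> \<circ> \<phi>')"
    by (rule chamber_map_cong[OF chamber_map_comp[OF fp(1) gp(1)]]) (simp add: compose_eq)
  moreover have "chamber_map (inv_into X (compose X f g)) (\<psi>' \<circ> \<psi>)"
  proof (rule chamber_map_cong[OF chamber_map_comp[OF gp(2) fp(2)]])
    fix p assume p: "p \<in> X"
    have 1: "inv_into X f p \<in> X" "f (inv_into X f p) = p"
      using bij(1) p by (auto simp: bij_betw_def inv_into_into f_inv_into_f)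
    then have 2: "inv_into X g (inv_into X f p) \<in> X" "g (inv_into X g (inv_into X f p)) = inv_into X f p"
      using bij(2) by (auto simp: bij_betw_def inv_into_into f_inv_into_f)
    show "inv_into X (compose X f g) p = (inv_into X g \<circ> inv_into X f) p"
      using bij_betw_compose[OF bij(2,1)] 1 2
      by (intro inv_into_f_eq) (auto simp: bij_betw_def compose_eq)
  qed
  ultimately show "f \<otimes>\<^bsub>BijGroup X\<^esub> g \<in> Aut"
    using B compose_Bij[OF B] unfolding Aut_iff by (auto simp: BijGroup_def)
qed

abbreviation "AG \<equiv> aut_group S m \<Phi>"

lemma group_AG: "group AG"
  unfolding aut_group_def using subgroup.subgroup_is_group[OF subgroup_Aut group_BijGroup] .

lemma AG_simps:
  shows "carrier AG = Aut" "\<one>\<^bsub>AG\<^esub> = (\<lambda>p\<in>X. p)"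
    "f \<in> Aut \<Longrightarrow> g \<in> Aut \<Longrightarrow> f \<otimes>\<^bsub>AG\<^esub> g = compose X f g"
  by (simp_all add: aut_group_def BijGroup_def type_preserving_auts_def)

definition move :: "(('c \<times> ('s \<Rightarrow> real)) set \<Rightarrow> ('c \<times> ('s \<Rightarrow> real)) set) \<Rightarrow> 'c \<Rightarrow> 'c" where
  "move f h = (THE h'. h' \<in> Ch \<and> f (pt h apex) = pt h' apex)"

lemma move_eqI:
  assumes "h' \<in> Ch" "f (pt h apex) = pt h' apex" shows "move f h = h'"
  unfolding move_def
proof (rule the_equality)
  fix h'' assume *: "h'' \<in> Ch \<and> f (pt h apex) = pt h'' apex"
  then have "pt h'' apex = pt h' apex" using assms(2) by metis
  then show "h'' = h'" using pt_eq_generic[OF _ apex, of h'' h' apex] * by blast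
qed (use assms in simp)

lemma move:
  assumes "f \<in> Aut" "h \<in> Ch"
  shows "move f h \<in> Ch" "x \<in> K \<Longrightarrow> f (pt h x) = pt (move f h) x"
proof -
  obtain \<phi> where \<phi>: "chamber_map f \<phi>" using assms by (auto simp: Aut_iff)
  then have "move f h = \<phi> h" using assms apex by (intro move_eqI) (auto simp: chamber_map_def)
  then show "move f h \<in> Ch" "x \<in> K \<Longrightarrow> f (pt h x) = pt (move f h) x"
    using \<phi> assms by (auto simp: chamber_map_def)
qed

lemma Aut_X: "f \<in> Aut \<Longrightarrow> p \<in> X \<Longrightarrow> f p \<in> X"
  by (auto simp: Aut_iff Bij_def bij_betw_def)

lemma move_id: "h \<in> Ch \<Longrightarrow> move (\<lambda>p\<in>X. p) h = h"
  using pt_in_X apex by (intro move_eqI) auto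

lemma move_compose: "f \<in> Aut \<Longrightarrow> g \<in> Aut \<Longrightarrow> h \<in> Ch \<Longrightarrow> move (compose X f g) h = move f (move g h)"
  using move apex pt_in_X by (intro move_eqI) (auto simp: compose_eq)

text \<open>Two chambers are \<open>s\<close>-adjacent or equal if and only if they share the vertex of type \<open>{s}\<close>.\<close>

lemma move_residue:
  assumes "f \<in> Aut" "s \<in> S" "(h, h') \<in> residue_rel \<Phi> {s}"
  shows "(move f h, move f h') \<in> residue_rel \<Phi> {s}"
proof -
  let ?v = "indicat_real {s}"
  have v: "?v \<in> K" "mt ?v = {s}"
    using vertex_model[OF right_angled] mirror_types_vertex[OF right_angled]
      spherical_singleton[OF right_angled assms(2)] by auto
  have c: "h \<in> Ch" "h' \<in> Ch" using assms residue_Ch by auto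
  have "pt h ?v = pt h' ?v" using pt_eq_iff[OF c(1) v(1)] v assms by simp
  then have "pt (move f h) ?v = pt (move f h') ?v" using move(2)[OF assms(1)] c v by metis
  then show ?thesis using pt_eq_iff[OF move(1)[OF assms(1) c(1)] v(1)] v by simp
qed

lemma move_chamber: "f \<in> Aut \<Longrightarrow> h \<in> Ch \<Longrightarrow> f ` (pt h ` K) = pt (move f h) ` K"
  by (simp add: image_image move(2) cong: image_cong)

lemma chamber_eq_iff: "h \<in> Ch \<Longrightarrow> h' \<in> Ch \<Longrightarrow> pt h ` K = pt h' ` K \<longleftrightarrow> h = h'"
proof
  assume *: "h \<in> Ch" "h' \<in> Ch" "pt h ` K = pt h' ` K"
  then obtain x where "x \<in> K" "pt h apex = pt h' x" using apex by blast
  then show "h = h'" using pt_eq_generic[OF *(1) apex] by simp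
qed simp

text \<open>A compact set lies in finitely many chambers, and an automorphism that fixes those fixes the
  compact set pointwise. This treats the subbasic open sets, and the general case follows by
  induction on the way in which \<open>U\<close> is generated.\<close>

lemma fixing_set_in_open:
  assumes U: "openin (aut_topology S m \<Phi>) U" and id: "(\<lambda>p\<in>X. p) \<in> U"
  shows "\<exists>E. finite E \<and> E \<subseteq> Ch \<and> (\<forall>g\<in>Aut. (\<forall>e\<in>E. move g e = e) \<longrightarrow> g \<in> U)"
proof -
  have "generate_topology_on {{f \<in> Aut. f ` A \<subseteq> W} | A W. compactin (davis_topology S m \<Phi>) A \<and> openin (davis_topology S m \<Phi>) W} U"
    using U by (simp add: aut_topology_def compact_open_topology_def openin_topology_generated_by_iff)
  then show ?thesis
    using id
  proof (induction rule: generate_topology_on.induct)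
    case (Int a b)
    then obtain E where E: "finite E" "E \<subseteq> Ch" "\<forall>g\<in>Aut. (\<forall>e\<in>E. move g e = e) \<longrightarrow> g \<in> a"
      by blast
    obtain E' where E': "finite E'" "E' \<subseteq> Ch" "\<forall>g\<in>Aut. (\<forall>e\<in>E'. move g e = e) \<longrightarrow> g \<in> b"
      using Int by blast
    show ?case
    proof (intro exI[of _ "E \<union> E'"] conjI ballI impI)
      fix g assume "g \<in> Aut" "\<forall>e\<in>E \<union> E'. move g e = e"
      then show "g \<in> a \<inter> b" using bspec[OF E(3)] bspec[OF E'(3)] by simp
    qed (use E(1,2) E'(1,2) in simp_all)
  next
    case (UN \<K>)
    then obtain k where k: "k \<in> \<K>" "(\<lambda>p\<in>X. p) \<in> k" by blast
    obtain E where "finite E" "E \<subseteq> Ch" "\<forall>g\<in>Aut. (\<forall>e\<in>E. move g e = e) \<longrightarrow> g \<in> k"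
      using UN.IH[OF k] by blast
    moreover have "k \<subseteq> \<Union>\<K>" using k(1) by blast
    ultimately show ?case by (meson subsetD)
  next
    case (Basis s)
    then obtain A W where AW: "s = {f \<in> Aut. f ` A \<subseteq> W}" "compactin davis.mtopology A"
      by (auto simp: topology_eq)
    obtain E where E: "finite E" "E \<subseteq> Ch" "A \<subseteq> (\<Union>h\<in>E. pt h ` K)"
      using compactin_finite_chambers[OF AW(2)] by blast
    have "g \<in> s" if g: "g \<in> Aut" "\<forall>e\<in>E. move g e = e" for g
    proof -
      have "g p = (\<lambda>p\<in>X. p) p" if p: "p \<in> A" for p
      proof -
        obtain e x where e: "e \<in> E" "x \<in> K" "p = pt e x" using E p by blast
        then have "e \<in> Ch" using E by blast
        then show ?thesis using move(2)[OF g(1), of e x] pt_in_X g(2) e by simp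
      qed
      then have "g ` A = (\<lambda>p\<in>X. p) ` A" by (simp cong: image_cong)
      then show ?thesis using Basis(2) g(1) unfolding AW(1) by auto
    qed
    then show ?case using E by blast
  qed simp
qed

text \<open>The midpoint of the edge between the vertices of types \<open>{}\<close> and \<open>{s}\<close>. It lies on no mirror, so it
  determines its chamber, and every simplex that contains it has both vertices.\<close>

definition half_edge :: "'s \<Rightarrow> 's \<Rightarrow> real" where
  "half_edge s t = (if t = s then 1 / 2 else 0)"

lemma half_edge:
  assumes s: "s \<in> S" shows "half_edge s \<in> K" "mt (half_edge s) = {}"
proof -
  have "half_edge s \<in> chain_simplex {{}, {s}}"
    unfolding chain_simplex_def
    by (intro CollectI exI[of _ "\<lambda>_. 1 / 2"]) (auto simp: half_edge_def fun_eq_iff)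
  then show K: "half_edge s \<in> K" using simplex_model[OF right_angled edge_chain[OF right_angled s]] by blast
  show "mt (half_edge s) = {}" using mirror_types_eq[OF right_angled K] by (auto simp: half_edge_def)
qed

lemma half_edge_simplex:
  assumes C: "finite C" and x: "half_edge s \<in> chain_simplex C"
  shows "{} \<in> C" "{s} \<in> C"
proof -
  obtain l where l: "\<And>T. T \<in> C \<Longrightarrow> 0 \<le> l T" "sum l C = 1"
    "\<And>t. half_edge s t = (\<Sum>T\<in>C. l T * indicat_real T t)"
    using x by (rule chain_simplexE) blast
  have sub: "T \<subseteq> {s}" if T: "T \<in> C" "l T \<noteq> 0" for T
  proof
    fix t assume t: "t \<in> T"
    show "t \<in> {s}"
    proof (rule ccontr)
      assume "t \<notin> {s}"
      then have "(\<Sum>T\<in>C. l T * indicat_real T t) = 0" using l(3)[of t] by (simp add: half_edge_def)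
      then have "\<forall>T\<in>C. l T * indicat_real T t = 0"
        using C l(1) by (subst (asm) sum_nonneg_eq_0_iff) auto
      then show False using T t by auto
    qed
  qed
  have half: "(\<Sum>T\<in>C. l T * indicat_real T s) = 1 / 2" using l(3)[of s] by (simp add: half_edge_def)
  show "{s} \<in> C"
  proof (rule ccontr)
    assume "{s} \<notin> C"
    then have "(\<Sum>T\<in>C. l T * indicat_real T s) = 0"
      using sub by (intro sum.neutral) (fastforce simp: indicator_def subset_singleton_iff)
    then show False using half by simp
  qed
  show "{} \<in> C"
  proof (rule ccontr)
    assume "{} \<notin> C"
    then have "(\<Sum>T\<in>C. l T * indicat_real T s) = sum l C"
      using sub by (intro sum.cong) (fastforce simp: indicator_def subset_singleton_iff)+
    then show False using half l(2) by simp
  qed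
qed

lemma subcomplex_half_edge:
  assumes Y: "subcomplex S m \<Phi> Y" and s: "s \<in> S" and h: "h \<in> Ch" and "pt h (half_edge s) \<in> Y"
  shows "pt h apex \<in> Y" "pt h (indicat_real {s}) \<in> Y"
proof -
  obtain h' C x where C: "h' \<in> Ch" "C \<in> spherical_chains S m" "pt h' ` chain_simplex C \<subseteq> Y"
    "x \<in> chain_simplex C" "pt h (half_edge s) = pt h' x"
    using assms(4) Y unfolding subcomplex_def davis_simplices_def by blast
  have "h = h'" "half_edge s = x" using pt_eq_generic[OF h half_edge[OF s]] C(5) by auto
  then show "pt h apex \<in> Y" "pt h (indicat_real {s}) \<in> Y"
    using C half_edge_simplex[OF finite_chain[OF right_angled C(2)]]
      indicator_in_chain_simplex[OF finite_chain[OF right_angled C(2)]] by blast+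
qed

end

section \<open>The building of a graph product\<close>

locale graph_product_building = graph_product_data S m Hs
  for S :: "'s set" and m :: "'s \<Rightarrow> 's \<Rightarrow> enat" and Hs :: "'s \<Rightarrow> 'a monoid" +
  assumes right_angled_Sm: "right_angled S m"
    and finite_Hs: "\<And>s. s \<in> S \<Longrightarrow> finite (carrier (Hs s))"
begin

abbreviation "\<Phi> \<equiv> graph_product_chambers S m Hs"

sublocale B: right_angled_group H S V perp
proof (intro right_angled_group.intro right_angled_group_axioms.intro group_H)
  show "finite S" using right_angledD(1)[OF right_angled_Sm] .
  fix s assume s: "s \<in> S"
  show "subgroup (V s) H" by (rule subgroup_V[OF s])
  show "finite (V s)" using finite_Hs[OF s] by (simp add: V_eq)
  have "m s s \<noteq> 2" using right_angledD(2)[OF right_angled_Sm s] by simp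
  then show "perp s \<subseteq> S - {s}" by (auto simp: perp_def)
  obtain f where f: "\<And>h. h \<in> carrier H \<Longrightarrow> f h \<in> carrier H"
    "\<And>h t u. h \<in> carrier H \<Longrightarrow> t \<in> S \<Longrightarrow> u \<in> V t \<Longrightarrow> t \<noteq> s \<or> h \<notin> star_group s \<Longrightarrow>
      f (h \<otimes>\<^bsub>H\<^esub> u) = f h"
    "\<And>h u. h \<in> star_group s \<Longrightarrow> u \<in> V s \<Longrightarrow> f (h \<otimes>\<^bsub>H\<^esub> u) = f h \<otimes>\<^bsub>H\<^esub> u"
    by (rule side_function[OF s]) blast+
  show "\<exists>f. (\<forall>h\<in>carrier H. f h \<in> carrier H) \<and>
      (\<forall>h t u. h \<in> carrier H \<longrightarrow> t \<in> S \<longrightarrow> u \<in> V t \<longrightarrow>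
        t \<noteq> s \<or> h \<notin> generate H (\<Union>t\<in>insert s (perp s). V t) \<longrightarrow> f (h \<otimes>\<^bsub>H\<^esub> u) = f h) \<and>
      (\<forall>h u. h \<in> generate H (\<Union>t\<in>insert s (perp s). V t) \<longrightarrow> u \<in> V s \<longrightarrow>
        f (h \<otimes>\<^bsub>H\<^esub> u) = f h \<otimes>\<^bsub>H\<^esub> u)"
    using f by (intro exI[of _ f]) blast
next
  fix s t x y assume "s \<in> S" "t \<in> perp s" "x \<in> V s" "y \<in> V t"
  then show "x \<otimes>\<^bsub>H\<^esub> y = y \<otimes>\<^bsub>H\<^esub> x" using V_commute[of s t x y] unfolding perp_def by blast
next
  interpret H: group H by (rule group_H)
  have sub: "(\<Union>s\<in>S. V s) \<subseteq> carrier H" using V_subset by blast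
  show "generate H (\<Union>s\<in>S. V s) = carrier H"
  proof
    show "generate H (\<Union>s\<in>S. V s) \<subseteq> carrier H" by (rule H.generate_incl[OF sub])
    show "carrier H \<subseteq> generate H (\<Union>s\<in>S. V s)"
    proof
      fix h assume "h \<in> carrier H"
      then show "h \<in> generate H (\<Union>s\<in>S. V s)"
      proof (induction rule: carrier_H_induct)
        case one
        show ?case by (rule generate.one)
      next
        case (step s u h)
        have "u \<in> generate H (\<Union>s\<in>S. V s)" using step by (auto intro: generate.incl)
        then show ?case using step.IH by (rule generate.eng)
      qed
    qed
  qed
qed

lemma chambers_eq: "chambers \<Phi> = carrier H"
  by (simp add: graph_product_chambers_def Let_def)

lemma left_coset_eq_iff:
  assumes s: "s \<in> S" and h: "h \<in> carrier H" "h' \<in> carrier H"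
  shows "h <#\<^bsub>H\<^esub> V s = h' <#\<^bsub>H\<^esub> V s \<longleftrightarrow> B.adj s h h'"
proof
  assume eq: "h <#\<^bsub>H\<^esub> V s = h' <#\<^bsub>H\<^esub> V s"
  have "h' \<in> h' <#\<^bsub>H\<^esub> V s"
    using subgroup.one_closed[OF subgroup_V[OF s]] h(2) B.r_one unfolding l_coset_def by force
  then have "h' \<in> h <#\<^bsub>H\<^esub> V s" by (simp only: eq)
  then obtain u where "u \<in> V s" "h' = h \<otimes>\<^bsub>H\<^esub> u" unfolding l_coset_def by blast
  then show "B.adj s h h'"
    using h B.coset_rel_iff[OF V_subset[OF s]] by blast
next
  have sub: "x <#\<^bsub>H\<^esub> V s \<subseteq> y <#\<^bsub>H\<^esub> V s" if "B.adj s y x" for x y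
  proof
    fix z assume "z \<in> x <#\<^bsub>H\<^esub> V s"
    then have "B.adj s x z"
      using that B.coset_rel_carrier B.coset_rel_iff[OF V_subset[OF s]] unfolding l_coset_def by blast
    then have "B.adj s y z" using that B.adj_trans[OF s] by blast
    then show "z \<in> y <#\<^bsub>H\<^esub> V s"
      using B.coset_rel_iff[OF V_subset[OF s]] unfolding l_coset_def by auto
  qed
  assume "B.adj s h h'"
  then show "h <#\<^bsub>H\<^esub> V s = h' <#\<^bsub>H\<^esub> V s"
    using sub B.adj_sym[OF s] by blast
qed

lemma adjacent_iff: "s \<in> S \<Longrightarrow> (h, h') \<in> adjacent \<Phi> s \<longleftrightarrow> h \<noteq> h' \<and> B.adj s h h'"
  using left_coset_eq_iff[of s h h'] B.coset_rel_carrier[of "V s" h h']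
  by (auto simp: graph_product_chambers_def Let_def)

lemma residue_singleton_iff:
  assumes s: "s \<in> S" shows "(h, h') \<in> residue_rel \<Phi> {s} \<longleftrightarrow> B.adj s h h'"
proof
  assume "(h, h') \<in> residue_rel \<Phi> {s}"
  then have "(h, h') \<in> (adjacent \<Phi> s)\<^sup>*" and h: "h \<in> carrier H" by (auto simp: residue_rel_def chambers_eq)
  then show "B.adj s h h'"
  proof (induction rule: rtrancl_induct)
    case base
    show ?case using B.coset_rel_refl[OF subgroup_V[OF s] h] .
  next
    case (step y z)
    then show ?case using adjacent_iff[OF s] B.adj_trans[OF s] by blast
  qed
next
  assume a: "B.adj s h h'"
  then have "(h, h') \<in> (adjacent \<Phi> s)\<^sup>*" using adjacent_iff[OF s] by (cases "h = h'") auto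
  then show "(h, h') \<in> residue_rel \<Phi> {s}"
    using B.coset_rel_carrier[OF a] by (simp add: residue_rel_def chambers_eq)
qed

text \<open>\<open>P\<close> is the product of the vertex groups with types in \<open>T\<close>, in any order.\<close>

lemma finite_commuting_residue:
  assumes "finite T" "T \<subseteq> S" "\<And>s t. s \<in> T \<Longrightarrow> t \<in> T \<Longrightarrow> s \<noteq> t \<Longrightarrow> m s t = 2"
  shows "\<exists>P. finite P \<and> \<one>\<^bsub>H\<^esub> \<in> P \<and> P \<subseteq> carrier H \<and> (\<forall>t\<in>T. \<forall>p\<in>P. \<forall>u\<in>V t. p \<otimes>\<^bsub>H\<^esub> u \<in> P)"
  using assms
proof (induction T rule: finite_induct)
  case empty
  then show ?case by (intro exI[of _ "{\<one>\<^bsub>H\<^esub>}"]) auto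
next
  case (insert t T)
  have "\<exists>P. finite P \<and> \<one>\<^bsub>H\<^esub> \<in> P \<and> P \<subseteq> carrier H \<and> (\<forall>t\<in>T. \<forall>p\<in>P. \<forall>u\<in>V t. p \<otimes>\<^bsub>H\<^esub> u \<in> P)"
    by (rule insert.IH) (use insert.prems in auto)
  then obtain P where "finite P \<and> \<one>\<^bsub>H\<^esub> \<in> P \<and> P \<subseteq> carrier H \<and> (\<forall>t\<in>T. \<forall>p\<in>P. \<forall>u\<in>V t. p \<otimes>\<^bsub>H\<^esub> u \<in> P)"
    by (elim exE)
  then have P: "finite P" "\<one>\<^bsub>H\<^esub> \<in> P" "P \<subseteq> carrier H"
    "\<And>s p u. s \<in> T \<Longrightarrow> p \<in> P \<Longrightarrow> u \<in> V s \<Longrightarrow> p \<otimes>\<^bsub>H\<^esub> u \<in> P" by simp_all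
  have t: "t \<in> S" using insert by blast
  define P' where "P' = (\<lambda>(p, v). p \<otimes>\<^bsub>H\<^esub> v) ` (P \<times> V t)"
  have "\<one>\<^bsub>H\<^esub> \<otimes>\<^bsub>H\<^esub> \<one>\<^bsub>H\<^esub> \<in> P'"
    unfolding P'_def using P(2) subgroup.one_closed[OF subgroup_V[OF t]] by blast
  moreover have "p \<otimes>\<^bsub>H\<^esub> u \<in> P'" if s: "s \<in> insert t T" and p: "p \<in> P'" and u: "u \<in> V s" for s p u
  proof -
    obtain k v where kv: "k \<in> P" "v \<in> V t" "p = k \<otimes>\<^bsub>H\<^esub> v" using p by (auto simp: P'_def)
    have sS: "s \<in> S" using s insert by blast
    have c: "k \<in> carrier H" "v \<in> carrier H" "u \<in> carrier H"
      using kv P(3) B.V_closed[OF t] B.V_closed[OF sS u] by auto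
    show ?thesis
    proof (cases "s = t")
      case True
      then have "v \<otimes>\<^bsub>H\<^esub> u \<in> V t" using kv u subgroup.m_closed[OF subgroup_V[OF t]] by blast
      then have "k \<otimes>\<^bsub>H\<^esub> (v \<otimes>\<^bsub>H\<^esub> u) \<in> P'" using kv(1) unfolding P'_def by blast
      then show ?thesis using kv c by (simp add: B.m_assoc)
    next
      case False
      then have "s \<in> T" using s by blast
      have "v \<otimes>\<^bsub>H\<^esub> u = u \<otimes>\<^bsub>H\<^esub> v"
        by (rule V_commute[OF t sS _ kv(2) u]) (use insert.prems(2) s False in blast)
      then have "p \<otimes>\<^bsub>H\<^esub> u = (k \<otimes>\<^bsub>H\<^esub> u) \<otimes>\<^bsub>H\<^esub> v" using kv c by (simp add: B.m_assoc)
      moreover have "k \<otimes>\<^bsub>H\<^esub> u \<in> P" using P(4)[OF \<open>s \<in> T\<close> kv(1) u] .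
      ultimately show ?thesis using kv(2) unfolding P'_def by blast
    qed
  qed
  moreover have "finite P'" using P(1) B.finite_V[OF t] by (simp add: P'_def)
  moreover have "P' \<subseteq> carrier H" using P(3) B.V_closed[OF t] by (auto simp: P'_def)
  ultimately show ?case by (intro exI[of _ P']) simp
qed

sublocale D: davis_space S m \<Phi>
proof
  show "right_angled S m" by (rule right_angled_Sm)
next
  fix s x y assume s: "s \<in> S" "(x, y) \<in> adjacent \<Phi> s"
  then show "(y, x) \<in> adjacent \<Phi> s" using adjacent_iff B.adj_sym by auto
  show "x \<in> chambers \<Phi> \<and> y \<in> chambers \<Phi>"
    using s adjacent_iff B.coset_rel_carrier[of "V s" x y] chambers_eq by auto
next
  fix h h' assume h: "h \<in> chambers \<Phi>" "h' \<in> chambers \<Phi>"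
  have "B.step\<^sup>*\<^sup>* h h'" using B.gallery_connected h chambers_eq by simp
  then have "(h, h') \<in> (\<Union>s\<in>S. adjacent \<Phi> s)\<^sup>*"
  proof (induction rule: rtranclp_induct)
    case (step y z)
    then obtain s where "s \<in> S" "B.adj s y z" by (auto simp: B.step_def)
    then have "y = z \<or> (y, z) \<in> (\<Union>s\<in>S. adjacent \<Phi> s)" using adjacent_iff by blast
    then show ?case using step.IH by (auto intro: rtrancl_into_rtrancl)
  qed simp
  then show "(h, h') \<in> residue_rel \<Phi> S" using h by (simp add: residue_rel_def)
next
  fix T h assume T: "spherical S m T" and h: "h \<in> chambers \<Phi>"
  have TS: "T \<subseteq> S" using T by (simp add: spherical_def)
  obtain P where P: "finite P" "\<one>\<^bsub>H\<^esub> \<in> P" "P \<subseteq> carrier H"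
    "\<forall>t\<in>T. \<forall>p\<in>P. \<forall>u\<in>V t. p \<otimes>\<^bsub>H\<^esub> u \<in> P"
    using finite_commuting_residue[OF finite_subset[OF TS B.finite_S] TS spherical_commute[OF right_angled_Sm T]]
    by blast
  have hc: "h \<in> carrier H" using h chambers_eq by simp
  have "h' \<in> (\<lambda>p. h \<otimes>\<^bsub>H\<^esub> p) ` P" if "(h, h') \<in> (\<Union>s\<in>T. adjacent \<Phi> s)\<^sup>*" for h'
    using that
  proof (induction rule: rtrancl_induct)
    case base
    show ?case using P(2) hc by (auto intro!: image_eqI[of _ _ "\<one>\<^bsub>H\<^esub>"])
  next
    case (step y z)
    then obtain s p where s: "s \<in> T" "B.adj s y z" "p \<in> P" "y = h \<otimes>\<^bsub>H\<^esub> p"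
      using adjacent_iff TS by blast
    have sS: "s \<in> S" using s TS by blast
    obtain u where u: "u \<in> V s" "z = y \<otimes>\<^bsub>H\<^esub> u" using s B.coset_rel_iff[OF V_subset[OF sS]] by blast
    have "p \<in> carrier H" "u \<in> carrier H" using s P(3) B.V_closed[OF sS u(1)] by auto
    then have "z = h \<otimes>\<^bsub>H\<^esub> (p \<otimes>\<^bsub>H\<^esub> u)" using u s hc by (simp add: B.m_assoc)
    moreover have "p \<otimes>\<^bsub>H\<^esub> u \<in> P" using P(4) s u by blast
    ultimately show ?case by blast
  qed
  then have "residue_rel \<Phi> T `` {h} \<subseteq> (\<lambda>p. h \<otimes>\<^bsub>H\<^esub> p) ` P" by (auto simp: residue_rel_def)
  then show "finite (residue_rel \<Phi> T `` {h})" using P(1) finite_subset by blast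
qed

end

section \<open>Lattices\<close>

lemma not_summable_infinite_lower_bound:
  fixes f :: "'x \<Rightarrow> real"
  assumes inf: "infinite A" and c: "0 < c" and f: "\<And>x. x \<in> A \<Longrightarrow> c \<le> f x"
  shows "\<not> f summable_on A"
proof
  assume sum: "f summable_on A"
  obtain n :: nat where n: "infsum f A / c < real n" using reals_Archimedean2 by blast
  obtain B where B: "finite B" "card B = n" "B \<subseteq> A" using infinite_arbitrarily_large[OF inf] by blast
  have "real n * c \<le> sum f B"
    using sum_bounded_below[of B c f] f B by auto
  also have "\<dots> \<le> infsum f A"
    using c f by (intro finite_sum_le_infsum sum B) (meson DiffD1 less_le_trans less_imp_le)
  finally show False using n c by (simp add: pos_divide_less_eq)
qed

context davis_space begin

abbreviation sub_AG where "sub_AG \<Gamma> \<equiv> AG\<lparr>carrier := \<Gamma>\<rparr>"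

lemma group_sub_AG: "subgroup \<Gamma> AG \<Longrightarrow> group (sub_AG \<Gamma>)"
  using subgroup.subgroup_is_group[OF _ group_AG] .

lemma sub_AG_Aut: "subgroup \<Gamma> AG \<Longrightarrow> g \<in> \<Gamma> \<Longrightarrow> g \<in> Aut"
  using subgroup.subset[of \<Gamma> AG] AG_simps(1) by blast

lemma sub_AG_mult:
  "subgroup \<Gamma> AG \<Longrightarrow> g \<in> \<Gamma> \<Longrightarrow> h \<in> \<Gamma> \<Longrightarrow> p \<in> X \<Longrightarrow> (g \<otimes>\<^bsub>AG\<^esub> h) p = g (h p)"
  using AG_simps(3)[OF sub_AG_Aut sub_AG_Aut] by (simp add: compose_eq)

lemma sub_AG_inv:
  assumes \<Gamma>: "subgroup \<Gamma> AG" and g: "g \<in> \<Gamma>" and p: "p \<in> X"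
  shows "(inv\<^bsub>AG\<^esub> g) (g p) = p"
proof -
  interpret G: group AG by (rule group_AG)
  have "g \<in> carrier AG" using subgroup.subset[OF \<Gamma>] g by blast
  then have "inv\<^bsub>AG\<^esub> g \<otimes>\<^bsub>AG\<^esub> g = \<one>\<^bsub>AG\<^esub>" by simp
  then show ?thesis
    using sub_AG_mult[OF \<Gamma> subgroup.m_inv_closed[OF \<Gamma> g] g p] p by (simp add: AG_simps)
qed

lemma orbit_point_eq:
  assumes \<Gamma>: "subgroup \<Gamma> AG" and g: "g \<in> \<Gamma>" and p: "p \<in> X"
  shows "orbit (sub_AG \<Gamma>) (\<lambda>g p. g p) (g p) = orbit (sub_AG \<Gamma>) (\<lambda>g p. g p) p"
proof
  show "orbit (sub_AG \<Gamma>) (\<lambda>g p. g p) (g p) \<subseteq> orbit (sub_AG \<Gamma>) (\<lambda>g p. g p) p"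
  proof
    fix z assume "z \<in> orbit (sub_AG \<Gamma>) (\<lambda>g p. g p) (g p)"
    then obtain k where k: "k \<in> \<Gamma>" "z = k (g p)" by (auto simp: orbit_def)
    then have "z = (k \<otimes>\<^bsub>AG\<^esub> g) p" using sub_AG_mult[OF \<Gamma> k(1) g p] by simp
    then show "z \<in> orbit (sub_AG \<Gamma>) (\<lambda>g p. g p) p"
      using subgroup.m_closed[OF \<Gamma> k(1) g] by (auto simp: orbit_def)
  qed
  show "orbit (sub_AG \<Gamma>) (\<lambda>g p. g p) p \<subseteq> orbit (sub_AG \<Gamma>) (\<lambda>g p. g p) (g p)"
  proof
    fix z assume "z \<in> orbit (sub_AG \<Gamma>) (\<lambda>g p. g p) p"
    then obtain k where k: "k \<in> \<Gamma>" "z = k p" by (auto simp: orbit_def)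
    have i: "inv\<^bsub>AG\<^esub> g \<in> \<Gamma>" using subgroup.m_inv_closed[OF \<Gamma> g] .
    have gp: "g p \<in> X" using Aut_X[OF sub_AG_Aut[OF \<Gamma> g] p] .
    have "z = (k \<otimes>\<^bsub>AG\<^esub> inv\<^bsub>AG\<^esub> g) (g p)"
      using sub_AG_mult[OF \<Gamma> k(1) i gp] sub_AG_inv[OF \<Gamma> g p] k by simp
    then show "z \<in> orbit (sub_AG \<Gamma>) (\<lambda>g p. g p) (g p)"
      using subgroup.m_closed[OF \<Gamma> k(1) i] by (auto simp: orbit_def)
  qed
qed

text \<open>The quotient is then covered by the images of finitely many compact chambers.\<close>

lemma cocompact_if_finite_chamber_orbits:
  assumes \<Gamma>: "subgroup \<Gamma> AG" and R: "finite R" "R \<subseteq> davis_chambers S m \<Phi>"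
    and rep: "\<And>\<phi>. \<phi> \<in> davis_chambers S m \<Phi> \<Longrightarrow> \<exists>\<psi>\<in>R. \<psi> \<in> orbit (sub_AG \<Gamma>) (`) \<phi>"
  shows "cocompact S m \<Phi> \<Gamma>"
proof -
  let ?T = "orbit_space davis.mtopology (sub_AG \<Gamma>) (\<lambda>g p. g p)"
  let ?\<pi> = "orbit (sub_AG \<Gamma>) (\<lambda>g p. g p)"
  have "openin ?T (orbits (sub_AG \<Gamma>) X (\<lambda>g p. g p))"
  proof -
    have "{p \<in> topspace davis.mtopology. ?\<pi> p \<in> orbits (sub_AG \<Gamma>) (topspace davis.mtopology) (\<lambda>g p. g p)}
        = topspace davis.mtopology"
      unfolding orbits_def by blast
    then show ?thesis
      unfolding openin_orbit_space using openin_topspace[of davis.mtopology] by simp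
  qed
  then have top: "topspace ?T = orbits (sub_AG \<Gamma>) X (\<lambda>g p. g p)"
    using openin_topspace[of ?T] openin_subset[of ?T] unfolding openin_orbit_space by auto
  have cont: "continuous_map davis.mtopology ?T ?\<pi>"
    unfolding continuous_map_def top by (auto simp: openin_orbit_space orbits_def)
  have "compactin ?T (\<Union>\<psi>\<in>R. ?\<pi> ` \<psi>)"
  proof (rule compactin_Union)
    show "finite ((\<lambda>\<psi>. ?\<pi> ` \<psi>) ` R)" using R by simp
    fix Z assume "Z \<in> (\<lambda>\<psi>. ?\<pi> ` \<psi>) ` R"
    then obtain h where "h \<in> Ch" "Z = ?\<pi> ` pt h ` K" using R by (auto simp: davis_chambers_def)
    then show "compactin ?T Z" using image_compactin[OF compactin_chamber cont] by blast
  qed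
  moreover have "(\<Union>\<psi>\<in>R. ?\<pi> ` \<psi>) = topspace ?T"
  proof
    show "topspace ?T \<subseteq> (\<Union>\<psi>\<in>R. ?\<pi> ` \<psi>)"
    proof
      fix z assume "z \<in> topspace ?T"
      then obtain p where p: "p \<in> X" "z = ?\<pi> p" unfolding top by (auto simp: orbits_def)
      then obtain h x where h: "h \<in> Ch" "x \<in> K" "p = pt h x" by (auto simp: X_eq)
      then have "pt h ` K \<in> davis_chambers S m \<Phi>" by (auto simp: davis_chambers_def)
      then obtain \<psi> g where \<psi>: "\<psi> \<in> R" "g \<in> \<Gamma>" "\<psi> = g ` pt h ` K"
        using rep unfolding orbit_def by force
      then have "g p \<in> \<psi>" using h by blast
      moreover have "z = ?\<pi> (g p)" using orbit_point_eq[OF \<Gamma> \<psi>(2) p(1)] p by simp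
      ultimately show "z \<in> (\<Union>\<psi>\<in>R. ?\<pi> ` \<psi>)" using \<psi>(1) by blast
    qed
    show "(\<Union>\<psi>\<in>R. ?\<pi> ` \<psi>) \<subseteq> topspace ?T"
      unfolding top using R pt_in_X by (force simp: orbits_def davis_chambers_def)
  qed
  ultimately show ?thesis by (simp add: cocompact_def topology_eq compact_space_def)
qed

lemma stabilizer_chamber:
  assumes \<Gamma>: "subgroup \<Gamma> AG" and h: "h \<in> Ch"
  shows "stabilizer (sub_AG \<Gamma>) (`) (pt h ` K) = {g \<in> \<Gamma>. move g h = h}"
proof -
  have "g ` pt h ` K = pt h ` K \<longleftrightarrow> move g h = h" if "g \<in> \<Gamma>" for g
    using move_chamber[OF sub_AG_Aut[OF \<Gamma> that] h] chamber_eq_iff[OF move(1)[OF sub_AG_Aut[OF \<Gamma> that] h] h]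
    by simp
  then show ?thesis unfolding stabilizer_def by (simp cong: conj_cong)
qed

text \<open>The chambers whose apex lies in \<open>Y\<close> represent the orbits of chambers. They lie in \<open>Y\<close> together with their
  vertices of type \<open>{s}\<close>: the midpoint of the edge from the apex to that vertex has a translate in \<open>Y\<close>, the simplex
  of \<open>Y\<close> around it contains the apex of a chamber in the same orbit, and this chamber is the given one by
  uniqueness. Hence if a translate of one such chamber is \<open>s\<close>-adjacent to another one, then the vertices
  of type \<open>{s}\<close> of the two are points of \<open>Y\<close> in one orbit, so they coincide.\<close>

lemma strict_domain_vertices:
  assumes \<Gamma>: "subgroup \<Gamma> AG" and Y: "strict_fundamental_domain S m \<Phi> \<Gamma> Y"
  defines "D \<equiv> {h \<in> Ch. pt h apex \<in> Y}"
  shows strict_domain_ex: "h \<in> Ch \<Longrightarrow> \<exists>g\<in>\<Gamma>. move g h \<in> D"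
    and strict_domain_unique: "g \<in> \<Gamma> \<Longrightarrow> d \<in> D \<Longrightarrow> d' \<in> D \<Longrightarrow> move g d = d' \<Longrightarrow> d = d'"
    and strict_domain_panel: "g \<in> \<Gamma> \<Longrightarrow> s \<in> S \<Longrightarrow> d \<in> D \<Longrightarrow> d' \<in> D \<Longrightarrow>
      (move g d, d') \<in> residue_rel \<Phi> {s} \<Longrightarrow> (d, d') \<in> residue_rel \<Phi> {s}"
proof -
  have sub: "subcomplex S m \<Phi> Y" and
    Y1: "\<And>p. p \<in> X \<Longrightarrow> \<exists>y. y \<in> Y \<and> y \<in> orbit (sub_AG \<Gamma>) (\<lambda>g p. g p) p" and
    Y2: "\<And>p y z. p \<in> X \<Longrightarrow> y \<in> Y \<Longrightarrow> z \<in> Y \<Longrightarrow> y \<in> orbit (sub_AG \<Gamma>) (\<lambda>g p. g p) p \<Longrightarrow>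
      z \<in> orbit (sub_AG \<Gamma>) (\<lambda>g p. g p) p \<Longrightarrow> y = z"
    using Y unfolding strict_fundamental_domain_def by blast+
  have meets: "\<exists>g\<in>\<Gamma>. pt (move g h) x \<in> Y" if hx: "h \<in> Ch" "x \<in> K" for h x
  proof -
    obtain g where g: "g \<in> \<Gamma>" "g (pt h x) \<in> Y"
      using Y1[OF pt_in_X[OF hx]] unfolding orbit_def by auto
    then show ?thesis using move(2)[OF sub_AG_Aut[OF \<Gamma> g(1)] hx] by auto
  qed
  have unique: "pt h x = pt (move g h) x"
    if "h \<in> Ch" "x \<in> K" "g \<in> \<Gamma>" "pt h x \<in> Y" "pt (move g h) x \<in> Y" for h x g
  proof (rule Y2[OF pt_in_X[OF that(1,2)]])
    interpret G: group AG by (rule group_AG)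
    have "\<one>\<^bsub>AG\<^esub> \<in> \<Gamma>" using subgroup.one_closed[OF \<Gamma>] .
    moreover have "pt h x = \<one>\<^bsub>AG\<^esub> (pt h x)" using pt_in_X[OF that(1,2)] by (simp add: AG_simps)
    ultimately show "pt h x \<in> orbit (sub_AG \<Gamma>) (\<lambda>g p. g p) (pt h x)" by (auto simp: orbit_def)
    have "pt (move g h) x = g (pt h x)" using move(2)[OF sub_AG_Aut[OF \<Gamma> that(3)] that(1,2)] by simp
    then show "pt (move g h) x \<in> orbit (sub_AG \<Gamma>) (\<lambda>g p. g p) (pt h x)"
      using that(3) by (auto simp: orbit_def)
  qed (use that in simp_all)
  show "\<exists>g\<in>\<Gamma>. move g h \<in> D" if h: "h \<in> Ch" for h
    using meets[OF h apex(1)] move(1)[OF sub_AG_Aut[OF \<Gamma>] h] by (auto simp: D_def)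
  show D_unique: "d = d'" if "g \<in> \<Gamma>" "d \<in> D" "d' \<in> D" "move g d = d'" for g d d'
    using unique[OF _ apex(1) that(1), of d] that pt_eq_generic[OF _ apex, of d d' apex] by (auto simp: D_def)
  have panel: "pt d (indicat_real {s}) \<in> Y" if d: "d \<in> D" and s: "s \<in> S" for d s
  proof -
    have dc: "d \<in> Ch" using d by (simp add: D_def)
    obtain g where g: "g \<in> \<Gamma>" "pt (move g d) (half_edge s) \<in> Y"
      using meets[OF dc half_edge(1)[OF s]] by blast
    have gc: "move g d \<in> Ch" using move(1)[OF sub_AG_Aut[OF \<Gamma> g(1)] dc] .
    note * = subcomplex_half_edge[OF sub s gc g(2)]
    then have "move g d \<in> D" using gc by (simp add: D_def)
    then have "d = move g d" using D_unique[OF g(1) d] by blast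
    then show ?thesis using *(2) by simp
  qed
  show "(d, d') \<in> residue_rel \<Phi> {s}"
    if g: "g \<in> \<Gamma>" and s: "s \<in> S" and d: "d \<in> D" "d' \<in> D" and r: "(move g d, d') \<in> residue_rel \<Phi> {s}"
    for g s d d'
  proof -
    let ?v = "indicat_real {s}"
    have v: "?v \<in> K" "mt ?v = {s}"
      using vertex_model[OF right_angled] mirror_types_vertex[OF right_angled]
        spherical_singleton[OF right_angled s] by auto
    have c: "d \<in> Ch" "move g d \<in> Ch" using d move(1)[OF sub_AG_Aut[OF \<Gamma> g]] by (auto simp: D_def)
    have eq: "pt (move g d) ?v = pt d' ?v" using pt_eq_iff[OF c(2) v(1)] v(2) r by simp
    have "pt (move g d) ?v \<in> Y" using panel[OF d(2) s] by (simp only: eq)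
    then have "pt d ?v = pt d' ?v" using unique[OF c(1) v(1) g panel[OF d(1) s]] eq by simp
    then show ?thesis using pt_eq_iff[OF c(1) v(1)] v(2) by simp
  qed
qed

text \<open>The trivial group is relatively open, so it contains all elements of \<open>\<Gamma>\<close> that fix the chambers of a
  suitable finite set.\<close>

lemma discrete_imp_nbhd:
  assumes \<Gamma>: "subgroup \<Gamma> AG"
    and disc: "subtopology (aut_topology S m \<Phi>) \<Gamma> = discrete_topology \<Gamma>"
  shows "\<exists>E. finite E \<and> E \<subseteq> Ch \<and> (\<forall>g\<in>\<Gamma>. (\<forall>e\<in>E. move g e = e) \<longrightarrow> g = \<one>\<^bsub>AG\<^esub>)"
proof -
  have one: "\<one>\<^bsub>AG\<^esub> \<in> \<Gamma>" using subgroup.one_closed[OF \<Gamma>] .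
  then have "openin (subtopology (aut_topology S m \<Phi>) \<Gamma>) {\<one>\<^bsub>AG\<^esub>}" unfolding disc by simp
  then obtain U where U: "openin (aut_topology S m \<Phi>) U" "{\<one>\<^bsub>AG\<^esub>} = U \<inter> \<Gamma>"
    by (auto simp: openin_subtopology)
  then have "(\<lambda>p\<in>X. p) \<in> U" by (auto simp: AG_simps)
  then obtain E where "finite E" "E \<subseteq> Ch" "\<forall>g\<in>Aut. (\<forall>e\<in>E. move g e = e) \<longrightarrow> g \<in> U"
    using fixing_set_in_open[OF U(1)] by blast
  moreover have "g = \<one>\<^bsub>AG\<^esub>" if "g \<in> \<Gamma>" "g \<in> U" for g using U(2) that by blast
  ultimately show ?thesis using sub_AG_Aut[OF \<Gamma>] by meson
qed

end

context graph_product_building begin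

lemma strict_chamber_action_domain:
  assumes \<Gamma>: "subgroup \<Gamma> D.AG" and Y: "strict_fundamental_domain S m \<Phi> \<Gamma> Y"
  shows "strict_chamber_action H S V perp (D.sub_AG \<Gamma>) D.move {h \<in> chambers \<Phi>. D.pt h D.apex \<in> Y}"
proof (intro strict_chamber_action.intro strict_chamber_action_axioms.intro)
  note Aut = D.sub_AG_Aut[OF \<Gamma>]
  show "right_angled_group H S V perp" by (rule B.right_angled_group_axioms)
  show "group (D.sub_AG \<Gamma>)" by (rule D.group_sub_AG[OF \<Gamma>])
  show "D.move g x \<in> carrier H" if "g \<in> carrier (D.sub_AG \<Gamma>)" "x \<in> carrier H" for g x
    using D.move(1)[OF Aut, of g x] that by (simp add: chambers_eq)
  show "D.move \<one>\<^bsub>D.sub_AG \<Gamma>\<^esub> x = x" if "x \<in> carrier H" for x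
    using D.move_id[of x] that by (simp add: chambers_eq D.AG_simps)
  show "D.move (g \<otimes>\<^bsub>D.sub_AG \<Gamma>\<^esub> h) x = D.move g (D.move h x)"
    if "g \<in> carrier (D.sub_AG \<Gamma>)" "h \<in> carrier (D.sub_AG \<Gamma>)" "x \<in> carrier H" for g h x
    using D.move_compose[OF Aut Aut, of g h x] D.AG_simps(3)[OF Aut Aut, of g h] that
    by (simp add: chambers_eq)
  show "B.adj s (D.move g x) (D.move g y)"
    if "g \<in> carrier (D.sub_AG \<Gamma>)" "s \<in> S" "B.adj s x y" for g s x y
    using D.move_residue[OF Aut, of g s x y] residue_singleton_iff that by simp
  show "{h \<in> chambers \<Phi>. D.pt h D.apex \<in> Y} \<subseteq> carrier H" by (auto simp: chambers_eq)
  show "\<exists>g\<in>carrier (D.sub_AG \<Gamma>). D.move g x \<in> {h \<in> chambers \<Phi>. D.pt h D.apex \<in> Y}"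
    if "x \<in> carrier H" for x
    using D.strict_domain_ex[OF \<Gamma> Y] that by (simp add: chambers_eq)
  show "d = d'" if "g \<in> carrier (D.sub_AG \<Gamma>)" "d \<in> {h \<in> chambers \<Phi>. D.pt h D.apex \<in> Y}"
    "d' \<in> {h \<in> chambers \<Phi>. D.pt h D.apex \<in> Y}" "D.move g d = d'" for g d d'
    using D.strict_domain_unique[OF \<Gamma> Y _ that(2-4)] that(1) by simp
  show "B.adj s d d'"
    if "g \<in> carrier (D.sub_AG \<Gamma>)" "s \<in> S" "d \<in> {h \<in> chambers \<Phi>. D.pt h D.apex \<in> Y}"
    "d' \<in> {h \<in> chambers \<Phi>. D.pt h D.apex \<in> Y}" "B.adj s (D.move g d) d'" for g s d d'
    using D.strict_domain_panel[OF \<Gamma> Y _ that(2-4), of g] that residue_singleton_iff[OF that(2)] by simp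
qed

text \<open>Finite generation would bound the orders of the stabilizers. Then a convergent series of their
  reciprocals has finitely many terms, and the quotient is compact. Finiteness of the stabilizers has
  to be established first: an infinite one would contain nontrivial elements fixing
  any given finite set of chambers, against discreteness.\<close>

theorem not_finitely_generated:
  assumes \<Gamma>: "subgroup \<Gamma> D.AG" and Y: "strict_fundamental_domain S m \<Phi> \<Gamma> Y"
    and disc: "subtopology (aut_topology S m \<Phi>) \<Gamma> = discrete_topology \<Gamma>"
    and R: "R \<subseteq> davis_chambers S m \<Phi>"
      "\<And>\<phi>. \<phi> \<in> davis_chambers S m \<Phi> \<Longrightarrow> \<exists>\<psi>\<in>R. \<psi> \<in> orbit (D.sub_AG \<Gamma>) (`) \<phi>"
      "(\<lambda>\<phi>. 1 / real (card (stabilizer (D.sub_AG \<Gamma>) (`) \<phi>))) summable_on R"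
    and nc: "\<not> cocompact S m \<Phi> \<Gamma>"
  shows "\<not> finitely_generated D.AG \<Gamma>"
proof
  assume "finitely_generated D.AG \<Gamma>"
  then obtain A where A: "finite A" "A \<subseteq> \<Gamma>" "generate D.AG A = \<Gamma>" by (auto simp: finitely_generated_def)
  interpret AG: group D.AG by (rule D.group_AG)
  interpret Act: strict_chamber_action H S V perp "D.sub_AG \<Gamma>" D.move "{h \<in> chambers \<Phi>. D.pt h D.apex \<in> Y}"
    by (rule strict_chamber_action_domain[OF \<Gamma> Y])
  obtain E where E: "finite E" "E \<subseteq> chambers \<Phi>"
    "\<forall>g\<in>\<Gamma>. (\<forall>e\<in>E. D.move g e = e) \<longrightarrow> g = \<one>\<^bsub>D.AG\<^esub>"
    using D.discrete_imp_nbhd[OF \<Gamma> disc] by blast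
  have fin: "finite (Act.stab x)" if x: "x \<in> carrier H" for x
  proof (rule ccontr)
    assume inf: "infinite (Act.stab x)"
    then obtain g where "g \<in> \<Gamma>" "g \<noteq> \<one>\<^bsub>D.AG\<^esub>" "\<forall>e\<in>E. D.move g e = e"
      using Act.infinite_stab_fixing[OF x inf E(1)] E(2) chambers_eq by auto
    then show False using E(3) by blast
  qed
  have gen: "generate (D.sub_AG \<Gamma>) A = carrier (D.sub_AG \<Gamma>)"
    using AG.generate_consistent[OF A(2) \<Gamma>] A(3) by simp
  obtain M where M: "\<forall>x\<in>carrier H. card (Act.stab x) \<le> M"
    using Act.stabilizers_bounded[OF A(1) _ gen fin] A(2) by auto
  \<comment> \<open>By the bound, it remains to see that R is infinite; Suc M below is never 0.\<close>
  have "infinite R" using D.cocompact_if_finite_chamber_orbits[OF \<Gamma> _ R(1,2)] nc by blast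
  moreover have "1 / real (Suc M) \<le> 1 / real (card (stabilizer (D.sub_AG \<Gamma>) (`) \<phi>))" if \<phi>: "\<phi> \<in> R" for \<phi>
  proof -
    obtain h where h: "h \<in> carrier H" "\<phi> = D.pt h ` D.K"
      using R(1) \<phi> chambers_eq by (auto simp: davis_chambers_def)
    have st: "stabilizer (D.sub_AG \<Gamma>) (`) \<phi> = Act.stab h"
      using D.stabilizer_chamber[OF \<Gamma>, of h] h chambers_eq by (simp add: Act.stab_def)
    have "\<one>\<^bsub>D.AG\<^esub> \<in> Act.stab h"
      using Act.act_one[OF h(1)] subgroup.one_closed[OF \<Gamma>] by (simp add: Act.stab_def)
    then have "0 < card (Act.stab h)" using fin[OF h(1)] by (auto simp: card_gt_0_iff)
    moreover have "card (Act.stab h) \<le> Suc M" using M h(1) by (simp add: le_SucI)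
    ultimately show ?thesis unfolding st by (intro divide_left_mono) auto
  qed
  ultimately show False
    using not_summable_infinite_lower_bound[of R "1 / real (Suc M)"] R(3) by simp
qed

end

theorem theorem1:
  fixes S :: "'s set" and m :: "'s \<Rightarrow> 's \<Rightarrow> enat"
    and q :: "'s \<Rightarrow> nat" and Hs :: "'s \<Rightarrow> 'a monoid"
  defines "\<Phi> \<equiv> graph_product_chambers S m Hs"
  assumes "right_angled S m"
    and "\<And>s. s \<in> S \<Longrightarrow> q s \<ge> 2"
    and "\<And>s. s \<in> S \<Longrightarrow> group (Hs s)"
    and "\<And>s. s \<in> S \<Longrightarrow> card (carrier (Hs s)) = q s"
    and "subgroup G (aut_group S m \<Phi>)"
    and "closedin (aut_topology S m \<Phi>) G"
    and "cocompact S m \<Phi> G"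
    and "lattice_in S m \<Phi> G \<Gamma>"
    and "\<not> cocompact S m \<Phi> \<Gamma>"
    and "\<exists>Y. strict_fundamental_domain S m \<Phi> \<Gamma> Y"
  shows "\<not> finitely_generated (aut_group S m \<Phi>) \<Gamma>"
proof -
  have "finite (carrier (Hs s))" if "s \<in> S" for s
  proof -
    have "0 < card (carrier (Hs s))" using assms(3)[OF that] assms(5)[OF that] by simp
    then show ?thesis by (rule card_ge_0_finite)
  qed
  then interpret graph_product_building S m Hs
    by (intro graph_product_building.intro graph_product_building_axioms.intro
      graph_product_data.intro assms(2,4) right_angledD(3)[OF assms(2)])
  obtain Y where Y: "strict_fundamental_domain S m \<Phi> \<Gamma> Y" using assms(11) by blast
  obtain R where "subgroup \<Gamma> (aut_group S m \<Phi>)"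
    "subtopology (aut_topology S m \<Phi>) \<Gamma> = discrete_topology \<Gamma>"
    "R \<subseteq> davis_chambers S m \<Phi>"
    "\<forall>\<phi>\<in>davis_chambers S m \<Phi>. \<exists>!\<psi>. \<psi> \<in> R \<and> \<psi> \<in> orbit ((aut_group S m \<Phi>)\<lparr>carrier := \<Gamma>\<rparr>) (`) \<phi>"
    "(\<lambda>\<phi>. 1 / real (card (stabilizer ((aut_group S m \<Phi>)\<lparr>carrier := \<Gamma>\<rparr>) (`) \<phi>))) summable_on R"
    using assms(9) unfolding lattice_in_def Let_def by blast
  then show ?thesis
    unfolding \<Phi>_def by (intro not_finitely_generated[of \<Gamma> Y R] Y[unfolded \<Phi>_def] assms(10)[unfolded \<Phi>_def]) blast+
qed

end
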